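(* Let $\bar u\in U_{ad}\cap L^\infty(Q)$, let $\bar y=y_{\bar u}$ and $\bar\varphi\in C(\bar Q)\cap H^1(Q)$ be its state and adjoint state, and let $\bar\mu\in L^\infty(Q)$ be such that $\bar\varphi+\kappa\bar u+\bar\mu=0$ and (a) $\bar u(x,t)\bar\mu(x,t)=|\bar u(x,t)||\bar\mu(x,t)|$ for a.a. $(x,t)\in Q$; (b) for a.a. $t\in(0,T)$: if $\|\bar u(t)\|_{L^1(\Omega)}<\gamma$ then $\bar\mu(t)\equiv0$ in $\Omega$; (c) for a.a. $t\in(0,T)$: if $\|\bar u(t)\|_{L^1(\Omega)}=\gamma$ and $\bar\mu(t)\not\equiv0$ in $\Omega$, then $\operatorname{supp}(\bar u(t))\subset\{x\in\Omega:|\bar\mu(x,t)|=\|\bar\mu(t)\|_{L^\infty(\Omega)}\}$. Then for a.a. $(x,t)\in Q$ $$\bar u(x,t)=-\frac1\kappa\operatorname{sign}(\bar\varphi(x,t))\big(|\bar\varphi(x,t)|-\|\bar\mu(t)\|_{L^\infty(\Omega)}\big)^+=-\frac1\kappa\Big\{\big[\bar\varphi(x,t)+\|\bar\mu(t)\|_{L^\infty(\Omega)}\big]^-+\big[\bar\varphi(x,t)-\|\bar\mu(t)\|_{L^\infty(\Omega)}\big]^+\Big\}.$$ Moreover, $\bar u\in H^1(Q)$ and $\bar\mu\in H^1(Q)$.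
   Context: Setting: $\Omega\subset\mathbb{R}^n$, $n\in\{2,3\}$, is a bounded, connected, open set with Lipschitz boundary $\Gamma$, $0<T<\infty$, $Q=\Omega\times(0,T)$, $\Sigma=\Gamma\times(0,T)$. $Ay=-\sum_{i,j=1}^n\partial_{x_j}(a_{ij}(x)\partial_{x_i}y)$ and $A^*\varphi=-\sum_{i,j=1}^n\partial_{x_j}(a_{ji}(x)\partial_{x_i}\varphi)$ with $a_{ij}\in L^\infty(\Omega)$ and, for some $\Lambda_A>0$, $\Lambda_A|\xi|^2\le\sum_{i,j=1}^n a_{ij}(x)\xi_i\xi_j$ for all $\xi\in\mathbb{R}^n$ and a.a. $x\in\Omega$. $y_0\in L^\infty(\Omega)$. $a:Q\times\mathbb{R}\to\mathbb{R}$ is a Carathéodory function, of class $C^2$ in the last variable, such that for a.a. $(x,t)\in Q$: (i) there is $C_a\in\mathbb{R}$ with $\frac{\partial a}{\partial y}(x,t,y)\ge C_a$ for all $y\in\mathbb{R}$; (ii) $a(\cdot,\cdot,0)\in L^{\hat r}(0,T;L^{\hat p}(\Omega))$ with $\hat r,\hat p\ge2$ and $\frac1{\hat r}+\frac{n}{2\hat p}<1$; (iii) for all $M>0$ there is $C_{a,M}>0$ with $|\frac{\partial^ja}{\partial y^j}(x,t,y)|\le C_{a,M}$ for all $|y|\le M$, $j=1,2$; (iv) for all $\rho>0$ and $M>0$ there is $\varepsilon>0$ with $|\frac{\partial^2a}{\partial y^2}(x,t,y_1)-\frac{\partial^2a}{\partial y^2}(x,t,y_2)|<\rho$ whenever $|y_1|,|y_2|\le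 M$, $|y_1-y_2|<\varepsilon$. Also $y_d\in L^{\hat r}(0,T;L^{\hat p}(\Omega))$, $\kappa>0$, $0<\gamma<\infty$. $W(0,T)=\{y\in L^2(0,T;H_0^1(\Omega)):\frac{\partial y}{\partial t}\in L^2(0,T;H^{-1}(\Omega))\}$. Equations are understood in the weak sense. For $u\in L^\infty(Q)$, $y_u\in L^\infty(Q)\cap W(0,T)$ is the unique solution of $\frac{\partial y}{\partial t}+Ay+a(x,t,y)=u$ in $Q$, $y=0$ on $\Sigma$, $y(0)=y_0$ in $\Omega$. The adjoint state $\bar\varphi$ of $\bar u$ is the solution of $-\frac{\partial\bar\varphi}{\partial t}+A^*\bar\varphi+\frac{\partial a}{\partial y}(x,t,\bar y)\bar\varphi=\bar y-y_d$ in $Q$, $\bar\varphi=0$ on $\Sigma$, $\bar\varphi(T)=0$ in $\Omega$. $U_{ad}=\{u\in L^\infty(0,T;L^1(\Omega)):\|u(t)\|_{L^1(\Omega)}\le\gamma\text{ for a.a. }t\in(0,T)\}$. Conventions: $s^+=\max\{s,0\}$, $s^-=\min\{s,0\}$; $\operatorname{supp}(\bar u(t))$ stands for $\{x\in\Omega:\bar u(x,t)\ne0\}$ and the inclusion in (c) is up to Lebesgue null sets. *)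

theory Defs
  imports "HOL-Analysis.Analysis" "HOL-Probability.Essential_Supremum"
begin

text \<open>Elements of Lebesgue and Sobolev spaces are represented by functions, all statements about
  them being insensitive to changes on null sets.\<close>

section \<open>Lebesgue spaces\<close>

definition Lp :: "ennreal \<Rightarrow> 'a measure \<Rightarrow> ('a \<Rightarrow> real) set" where
  "Lp p M = {f \<in> borel_measurable M.
     if p = \<infinity> then \<exists>C. AE x in M. \<bar>f x\<bar> \<le> C
     else integrable M (\<lambda>x. \<bar>f x\<bar> powr enn2real p)}"

definition Lp_norm :: "ennreal \<Rightarrow> 'a measure \<Rightarrow> ('a \<Rightarrow> real) \<Rightarrow> real" where
  "Lp_norm p M f =
     (if p = \<infinity> then real_of_ereal (esssup M (\<lambda>x. ereal \<bar>f x\<bar>))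
      else (\<integral>x. \<bar>f x\<bar> powr enn2real p \<partial>M) powr (1 / enn2real p))"

text \<open>\<open>L\<^sup>r(0,T; L\<^sup>p(\<Omega>))\<close>, as functions on \<open>\<Omega> \<times> (0,T)\<close>\<close>

definition LrLp :: "ennreal \<Rightarrow> ennreal \<Rightarrow> 'a::euclidean_space set \<Rightarrow> real \<Rightarrow> ('a \<times> real \<Rightarrow> real) set" where
  "LrLp r p \<Omega> T = {f \<in> borel_measurable (lebesgue_on (\<Omega> \<times> {0<..<T})).
     (AE t in lebesgue_on {0<..<T}. (\<lambda>x. f (x, t)) \<in> Lp p (lebesgue_on \<Omega>)) \<and>
     (\<lambda>t. Lp_norm p (lebesgue_on \<Omega>) (\<lambda>x. f (x, t))) \<in> Lp r (lebesgue_on {0<..<T})}"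


section \<open>Sobolev spaces\<close>

primrec C_k :: "nat \<Rightarrow> ('a::euclidean_space \<Rightarrow> real) \<Rightarrow> bool" where
  "C_k 0 f \<longleftrightarrow> continuous_on UNIV f"
| "C_k (Suc k) f \<longleftrightarrow> (\<forall>x. f differentiable (at x)) \<and>
     (\<forall>b\<in>Basis. C_k k (\<lambda>x. frechet_derivative f (at x) b))"

definition test_functions :: "'a::euclidean_space set \<Rightarrow> ('a \<Rightarrow> real) set" where
  "test_functions S = {\<phi>. (\<forall>k. C_k k \<phi>) \<and>
     compact (closure {x. \<phi> x \<noteq> 0}) \<and> closure {x. \<phi> x \<noteq> 0} \<subseteq> S}"

definition is_weak_partial ::
  "'a::euclidean_space set \<Rightarrow> 'a \<Rightarrow> ('a \<Rightarrow> real) \<Rightarrow> ('a \<Rightarrow> real) \<Rightarrow> bool" where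
  "is_weak_partial S b u g \<longleftrightarrow> (\<forall>\<phi>\<in>test_functions S.
     (\<integral>x. u x * frechet_derivative \<phi> (at x) b \<partial>lebesgue_on S) = - (\<integral>x. g x * \<phi> x \<partial>lebesgue_on S))"

definition H1 :: "'a::euclidean_space set \<Rightarrow> ('a \<Rightarrow> real) set" where
  "H1 S = {u \<in> Lp 2 (lebesgue_on S).
     \<forall>b\<in>Basis. \<exists>g\<in>Lp 2 (lebesgue_on S). is_weak_partial S b u g}"

text \<open>Meaningful for \<open>u \<in> H1 S\<close>, and then unique up to null sets.\<close>

definition weak_partial :: "'a::euclidean_space set \<Rightarrow> 'a \<Rightarrow> ('a \<Rightarrow> real) \<Rightarrow> 'a \<Rightarrow> real" where
  "weak_partial S b u = (SOME g. g \<in> Lp 2 (lebesgue_on S) \<and> is_weak_partial S b u g)"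

definition H1_norm :: "'a::euclidean_space set \<Rightarrow> ('a \<Rightarrow> real) \<Rightarrow> real" where
  "H1_norm S u = sqrt ((Lp_norm 2 (lebesgue_on S) u)\<^sup>2 +
     (\<Sum>b\<in>Basis. (Lp_norm 2 (lebesgue_on S) (weak_partial S b u))\<^sup>2))"

text \<open>\<open>H\<^sub>0\<^sup>1\<close> is the closure of the test functions in \<open>H\<^sup>1\<close>.\<close>

definition H10 :: "'a::euclidean_space set \<Rightarrow> ('a \<Rightarrow> real) set" where
  "H10 S = {u \<in> H1 S. \<forall>\<epsilon>>0. \<exists>\<phi>\<in>test_functions S. H1_norm S (\<lambda>x. u x - \<phi> x) < \<epsilon>}"

text \<open>The dual of \<open>H\<^sub>0\<^sup>1\<close>. Boundedness forces its elements to respect equality almost everywhere.\<close>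

definition Hm1 :: "'a::euclidean_space set \<Rightarrow> (('a \<Rightarrow> real) \<Rightarrow> real) set" where
  "Hm1 S = {F. (\<forall>v\<in>H10 S. \<forall>w\<in>H10 S. F (\<lambda>x. v x + w x) = F v + F w) \<and>
     (\<forall>c. \<forall>v\<in>H10 S. F (\<lambda>x. c * v x) = c * F v) \<and>
     (\<exists>C. \<forall>v\<in>H10 S. \<bar>F v\<bar> \<le> C * H1_norm S v)}"

definition Hm1_norm :: "'a::euclidean_space set \<Rightarrow> (('a \<Rightarrow> real) \<Rightarrow> real) \<Rightarrow> real" where
  "Hm1_norm S F = (SUP v\<in>{v \<in> H10 S. H1_norm S v \<le> 1}. \<bar>F v\<bar>)"


section \<open>Bochner spaces and \<open>W(0,T)\<close>\<close>

text \<open>\<open>H\<^sub>0\<^sup>1\<close> and its dual are separable and reflexive, so by Pettis' theorem strong measurability in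
  time amounts to weak measurability; for \<open>H\<^sub>0\<^sup>1\<close>-valued maps the latter follows from joint
  measurability.\<close>

definition L2_H10 :: "'a::euclidean_space set \<Rightarrow> real \<Rightarrow> ('a \<times> real \<Rightarrow> real) set" where
  "L2_H10 \<Omega> T = {y \<in> borel_measurable (lebesgue_on (\<Omega> \<times> {0<..<T})).
     (AE t in lebesgue_on {0<..<T}. (\<lambda>x. y (x, t)) \<in> H10 \<Omega>) \<and>
     (\<lambda>t. H1_norm \<Omega> (\<lambda>x. y (x, t))) \<in> Lp 2 (lebesgue_on {0<..<T})}"

definition L2_Hm1 :: "'a::euclidean_space set \<Rightarrow> real \<Rightarrow> (real \<Rightarrow> ('a \<Rightarrow> real) \<Rightarrow> real) set" where
  "L2_Hm1 \<Omega> T = {F. (\<forall>v\<in>H10 \<Omega>. (\<lambda>t. F t v) \<in> borel_measurable (lebesgue_on {0<..<T})) \<and>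
     (AE t in lebesgue_on {0<..<T}. F t \<in> Hm1 \<Omega>) \<and>
     (\<lambda>t. Hm1_norm \<Omega> (F t)) \<in> Lp 2 (lebesgue_on {0<..<T})}"

definition is_time_derivative ::
  "'a::euclidean_space set \<Rightarrow> real \<Rightarrow> ('a \<times> real \<Rightarrow> real) \<Rightarrow> (real \<Rightarrow> ('a \<Rightarrow> real) \<Rightarrow> real) \<Rightarrow> bool" where
  "is_time_derivative \<Omega> T y F \<longleftrightarrow> (\<forall>v\<in>H10 \<Omega>.
     is_weak_partial {0<..<T} 1 (\<lambda>t. \<integral>x. y (x, t) * v x \<partial>lebesgue_on \<Omega>) (\<lambda>t. F t v))"

definition W0T :: "'a::euclidean_space set \<Rightarrow> real \<Rightarrow> ('a \<times> real \<Rightarrow> real) set" where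
  "W0T \<Omega> T = {y \<in> L2_H10 \<Omega> T. \<exists>F\<in>L2_Hm1 \<Omega> T. is_time_derivative \<Omega> T y F}"

text \<open>\<open>y(s) = w\<close> for the representative of \<open>y\<close> in \<open>C([0,T]; L\<^sup>2(\<Omega>))\<close>, which exists for \<open>y \<in> W(0,T)\<close>\<close>

definition has_value_at_time ::
  "'a::euclidean_space set \<Rightarrow> real \<Rightarrow> ('a \<times> real \<Rightarrow> real) \<Rightarrow> real \<Rightarrow> ('a \<Rightarrow> real) \<Rightarrow> bool" where
  "has_value_at_time \<Omega> T y s w \<longleftrightarrow> (\<exists>z :: real \<Rightarrow> 'a \<Rightarrow> real.
     (\<forall>t\<in>{0..T}. z t \<in> Lp 2 (lebesgue_on \<Omega>)) \<and>
     (\<forall>t\<in>{0..T}. ((\<lambda>\<tau>. Lp_norm 2 (lebesgue_on \<Omega>) (\<lambda>x. z \<tau> x - z t x)) \<longlongrightarrow> 0) (at t within {0..T})) \<and>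
     (AE t in lebesgue_on {0<..<T}. AE x in lebesgue_on \<Omega>. z t x = y (x, t)) \<and>
     (AE x in lebesgue_on \<Omega>. z s x = w x))"


section \<open>The data of the control problem\<close>

text \<open>Near each boundary point, \<open>\<Omega>\<close> is the strict epigraph, in some direction \<open>\<nu>\<close>, of a Lipschitz
  function on the hyperplane orthogonal to \<open>\<nu>\<close>.\<close>

definition lipschitz_boundary :: "'a::euclidean_space set \<Rightarrow> bool" where
  "lipschitz_boundary \<Omega> \<longleftrightarrow> (\<forall>z\<in>frontier \<Omega>. \<exists>\<rho>>0. \<exists>\<nu> L g. norm \<nu> = 1 \<and>
     L-lipschitz_on {w. w \<bullet> \<nu> = 0} g \<and>
     (\<forall>x\<in>ball z \<rho>. x \<in> \<Omega> \<longleftrightarrow> g (x - (x \<bullet> \<nu>) *\<^sub>R \<nu>) < x \<bullet> \<nu>))"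

definition lipschitz_domain :: "'a::euclidean_space set \<Rightarrow> bool" where
  "lipschitz_domain \<Omega> \<longleftrightarrow> \<Omega> \<noteq> {} \<and> open \<Omega> \<and> bounded \<Omega> \<and> connected \<Omega> \<and> lipschitz_boundary \<Omega>"

definition elliptic_coefficients :: "(real^'n) set \<Rightarrow> (real^'n \<Rightarrow> real^'n^'n) \<Rightarrow> bool" where
  "elliptic_coefficients \<Omega> A \<longleftrightarrow>
     (\<forall>i j. (\<lambda>x. A x $ i $ j) \<in> Lp \<infinity> (lebesgue_on \<Omega>)) \<and>
     (\<exists>\<Lambda>>0. AE x in lebesgue_on \<Omega>. \<forall>\<xi>.
        \<Lambda> * (norm \<xi>)\<^sup>2 \<le> (\<Sum>i\<in>UNIV. \<Sum>j\<in>UNIV. A x $ i $ j * \<xi> $ i * \<xi> $ j))"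

definition nonlinearity ::
  "(real^'n) set \<Rightarrow> real \<Rightarrow> ennreal \<Rightarrow> ennreal \<Rightarrow> (real^'n \<Rightarrow> real \<Rightarrow> real \<Rightarrow> real) \<Rightarrow> bool" where
  "nonlinearity \<Omega> T r p a \<longleftrightarrow>
     (\<forall>y. (\<lambda>(x, t). a x t y) \<in> borel_measurable (lebesgue_on (\<Omega> \<times> {0<..<T}))) \<and>
     (AE (x, t) in lebesgue_on (\<Omega> \<times> {0<..<T}). C_k 2 (a x t)) \<and>
     (\<exists>C. AE (x, t) in lebesgue_on (\<Omega> \<times> {0<..<T}). \<forall>y. C \<le> deriv (a x t) y) \<and>
     (\<lambda>(x, t). a x t 0) \<in> LrLp r p \<Omega> T \<and>
     (\<forall>M>0. \<exists>C>0. AE (x, t) in lebesgue_on (\<Omega> \<times> {0<..<T}).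
        \<forall>y. \<bar>y\<bar> \<le> M \<longrightarrow> (\<forall>j\<in>{1, 2}. \<bar>(deriv ^^ j) (a x t) y\<bar> \<le> C)) \<and>
     (\<forall>\<rho>>0. \<forall>M>0. \<exists>\<epsilon>>0. AE (x, t) in lebesgue_on (\<Omega> \<times> {0<..<T}).
        \<forall>y1 y2. \<bar>y1\<bar> \<le> M \<and> \<bar>y2\<bar> \<le> M \<and> \<bar>y1 - y2\<bar> < \<epsilon> \<longrightarrow>
          \<bar>(deriv ^^ 2) (a x t) y1 - (deriv ^^ 2) (a x t) y2\<bar> < \<rho>)"

text \<open>The bilinear form of \<open>y \<mapsto> - \<Sum>\<^sub>i\<^sub>j \<partial>\<^sub>j (a\<^sub>i\<^sub>j \<partial>\<^sub>i y)\<close>; transposing \<open>A\<close> gives the form of the adjoint.\<close>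

definition elliptic_form ::
  "(real^'n) set \<Rightarrow> (real^'n \<Rightarrow> real^'n^'n) \<Rightarrow> (real^'n \<Rightarrow> real) \<Rightarrow> (real^'n \<Rightarrow> real) \<Rightarrow> real" where
  "elliptic_form \<Omega> A y v = (\<integral>x. (\<Sum>i\<in>UNIV. \<Sum>j\<in>UNIV.
     A x $ i $ j * weak_partial \<Omega> (axis i 1) y x * weak_partial \<Omega> (axis j 1) v x) \<partial>lebesgue_on \<Omega>)"

text \<open>\<open>y = y\<^sub>u\<close>; the lateral boundary condition is part of \<open>W(0,T)\<close>.\<close>

definition is_state ::
  "(real^'n) set \<Rightarrow> real \<Rightarrow> (real^'n \<Rightarrow> real^'n^'n) \<Rightarrow> (real^'n \<Rightarrow> real \<Rightarrow> real \<Rightarrow> real) \<Rightarrow>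
   (real^'n \<Rightarrow> real) \<Rightarrow> ((real^'n) \<times> real \<Rightarrow> real) \<Rightarrow> ((real^'n) \<times> real \<Rightarrow> real) \<Rightarrow> bool" where
  "is_state \<Omega> T A a y0 u y \<longleftrightarrow>
     y \<in> Lp \<infinity> (lebesgue_on (\<Omega> \<times> {0<..<T})) \<and> y \<in> W0T \<Omega> T \<and>
     (\<exists>F\<in>L2_Hm1 \<Omega> T. is_time_derivative \<Omega> T y F \<and>
        (AE t in lebesgue_on {0<..<T}. \<forall>v\<in>H10 \<Omega>.
           F t v + elliptic_form \<Omega> A (\<lambda>x. y (x, t)) v + (\<integral>x. a x t (y (x, t)) * v x \<partial>lebesgue_on \<Omega>)
           = (\<integral>x. u (x, t) * v x \<partial>lebesgue_on \<Omega>))) \<and>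
     has_value_at_time \<Omega> T y 0 y0"

definition is_adjoint_state ::
  "(real^'n) set \<Rightarrow> real \<Rightarrow> (real^'n \<Rightarrow> real^'n^'n) \<Rightarrow> (real^'n \<Rightarrow> real \<Rightarrow> real \<Rightarrow> real) \<Rightarrow>
   ((real^'n) \<times> real \<Rightarrow> real) \<Rightarrow> ((real^'n) \<times> real \<Rightarrow> real) \<Rightarrow> ((real^'n) \<times> real \<Rightarrow> real) \<Rightarrow> bool" where
  "is_adjoint_state \<Omega> T A a yd y \<phi> \<longleftrightarrow>
     \<phi> \<in> W0T \<Omega> T \<and>
     (\<exists>F\<in>L2_Hm1 \<Omega> T. is_time_derivative \<Omega> T \<phi> F \<and>
        (AE t in lebesgue_on {0<..<T}. \<forall>v\<in>H10 \<Omega>.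
           - F t v + elliptic_form \<Omega> (\<lambda>x. transpose (A x)) (\<lambda>x. \<phi> (x, t)) v
             + (\<integral>x. deriv (a x t) (y (x, t)) * \<phi> (x, t) * v x \<partial>lebesgue_on \<Omega>)
           = (\<integral>x. (y (x, t) - yd (x, t)) * v x \<partial>lebesgue_on \<Omega>))) \<and>
     has_value_at_time \<Omega> T \<phi> T (\<lambda>x. 0)"

definition U_ad :: "'a::euclidean_space set \<Rightarrow> real \<Rightarrow> real \<Rightarrow> ('a \<times> real \<Rightarrow> real) set" where
  "U_ad \<Omega> T \<gamma> = {u \<in> LrLp \<infinity> 1 \<Omega> T.
     AE t in lebesgue_on {0<..<T}. Lp_norm 1 (lebesgue_on \<Omega>) (\<lambda>x. u (x, t)) \<le> \<gamma>}"

end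

theory Submission
  imports Defs
begin

text \<open>
  At almost every time the conditions on \<open>u\<close> and \<open>\<mu>\<close> are pointwise in space. Put
  \<open>m(t) = \<parallel>\<mu>(t)\<parallel>\<^sub>\<infinity>\<close>. Where \<open>u \<noteq> 0\<close>, the multiplier has modulus \<open>m(t)\<close> and the sign of \<open>u\<close>, so that
  \<open>\<phi> = - (\<kappa> u + \<mu>)\<close> has the opposite sign and \<open>\<bar>\<phi>\<bar> = \<kappa> \<bar>u\<bar> + m(t)\<close>; where \<open>u = 0\<close>,
  \<open>\<bar>\<phi>\<bar> = \<bar>\<mu>\<bar> \<le> m(t)\<close>. In both cases \<open>- \<kappa> u\<close> is the soft thresholding of \<open>\<phi>\<close> at level \<open>m(t)\<close>, which
  is the formula (\<open>time_slice_threshold\<close>).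

  The regularity of \<open>u\<close> and \<open>\<mu>\<close> in time depends on the regularity of the level \<open>m\<close>, of which the
  hypotheses only say that it is bounded. Integrating the formula shows, however, that \<open>m(t)\<close> is
  determined by \<open>\<phi>(t)\<close>: the integral of \<open>(\<bar>\<phi>(t)\<bar> - m(t))\<^sup>+\<close> is \<open>\<kappa> \<parallel>u(t)\<parallel>\<^sub>1 \<le> \<kappa> \<gamma>\<close>, with equality
  if \<open>m(t) > 0\<close>. A level of this kind exists at every time, and it is a Lipschitz function of
  \<open>\<phi>(t)\<close> with respect to the norm of \<open>L\<^sup>1(\<Omega>)\<close> (\<open>threshold_lipschitz\<close>), because a positive excess mass
  \<open>\<kappa> \<gamma>\<close> of a bounded function forces its superlevel set to have measure bounded below. Hence \<open>m\<close> has
  a continuous version whose increments are at most a constant times those of \<open>\<phi>\<close> in \<open>L\<^sup>1(\<Omega>)\<close>.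
  Since soft thresholding is a Lipschitz function of the argument and of the level, increments of
  \<open>u\<close> and \<open>\<mu>\<close> are dominated by those of \<open>\<phi>\<close> and \<open>m\<close>.

  This settles the matter because, for bounded continuous functions on a bounded open set,
  membership in \<open>H\<^sup>1\<close> is equivalent to an \<open>L\<^sup>2\<close> bound of order \<open>h\<close> on the increments by \<open>h\<close> in each
  coordinate direction (\<open>difference_quotients_bounded_of_H1\<close> and
  \<open>H1_of_difference_quotients_bounded\<close>). The first implication follows by testing the weak derivative
  with averages of a mollifier along a segment. For the second, the bound makes
  \<open>\<psi> \<mapsto> - \<integral> f \<partial>\<psi>\<close> continuous in the norm of \<open>L\<^sup>2\<close> on test functions, and a Riesz representation
  theorem produces the weak derivative.
\<close>

section \<open>Calculus of \<open>C\<^sup>k\<close> functions\<close>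

lemma C_k_SucI:
  assumes "\<And>x. (f has_derivative D x) (at x)"
    and "\<And>b. b \<in> Basis \<Longrightarrow> C_k k (\<lambda>x. D x b)"
  shows "C_k (Suc k) f"
proof -
  have "frechet_derivative f (at x) = D x" for x
    using frechet_derivative_at[OF assms(1)[of x]] by simp
  then show ?thesis
    using assms by (auto simp: differentiable_def)
qed

lemma C_k_Suc_has_derivative:
  "C_k (Suc k) f \<Longrightarrow> (f has_derivative frechet_derivative f (at x)) (at x)"
  by (simp add: frechet_derivative_works[symmetric])

lemma C_k_SucD: "C_k (Suc k) f \<Longrightarrow> C_k k f"
proof (induction k arbitrary: f)
  case 0
  then show ?case
    by (auto intro!: continuous_at_imp_continuous_on differentiable_imp_continuous_within)
next
  case (Suc k)
  then show ?case
    by (metis C_k.simps(2))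
qed

lemma C_k_continuous: "C_k k f \<Longrightarrow> continuous_on UNIV f"
  by (induction k) (auto dest: C_k_SucD simp del: C_k.simps(2))

lemma C_k_const: "C_k k (\<lambda>x. c)"
proof (induction k arbitrary: c)
  case (Suc k)
  show ?case
    by (rule C_k_SucI[where D="\<lambda>x v. 0"]) (auto intro: Suc)
qed auto

lemma C_k_add: "C_k k f \<Longrightarrow> C_k k g \<Longrightarrow> C_k k (\<lambda>x. f x + g x)"
proof (induction k arbitrary: f g)
  case (Suc k)
  show ?case
    by (rule C_k_SucI[OF has_derivative_add[OF Suc.prems[THEN C_k_Suc_has_derivative]]])
      (use Suc in auto)
qed (auto intro: continuous_intros)

lemma C_k_mult: "C_k k f \<Longrightarrow> C_k k g \<Longrightarrow> C_k k (\<lambda>x. f x * g x)"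
proof (induction k arbitrary: f g)
  case (Suc k)
  have "C_k k f" "C_k k g"
    using Suc.prems C_k_SucD by blast+
  then show ?case
    by (intro C_k_SucI[OF has_derivative_mult[OF Suc.prems[THEN C_k_Suc_has_derivative]]]
        C_k_add Suc.IH) (use Suc.prems in auto)
qed (auto intro: continuous_intros)

lemma C_k_inner: "C_k k (\<lambda>x. x \<bullet> c)"
proof (cases k)
  case (Suc j)
  show ?thesis
    unfolding Suc by (rule C_k_SucI[where D="\<lambda>x v. v \<bullet> c"])
      (auto intro!: derivative_eq_intros C_k_const)
qed (auto intro!: continuous_intros)

lemma C_k_reflect: "C_k k f \<Longrightarrow> C_k k (\<lambda>w. f (z - w))"
proof (induction k arbitrary: f)
  case 0
  then show ?case
    by (auto intro!: continuous_intros continuous_on_compose2[of UNIV f])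
next
  case (Suc k)
  have "((\<lambda>w. f (z - w)) has_derivative (\<lambda>v. frechet_derivative f (at (z - w)) (- v))) (at w)" for w
    by (rule has_derivative_compose[where g=f and f="\<lambda>w. z - w" and f'=uminus])
      (auto intro!: derivative_eq_intros C_k_Suc_has_derivative[OF Suc.prems])
  then show ?case
  proof (rule C_k_SucI)
    fix b :: 'a assume b: "b \<in> Basis"
    have "frechet_derivative f (at (z - w)) (- b) = - 1 * frechet_derivative f (at (z - w)) b" for w
      using has_derivative_linear[OF C_k_Suc_has_derivative[OF Suc.prems]]
      by (simp add: linear_neg)
    then show "C_k k (\<lambda>w. frechet_derivative f (at (z - w)) (- b))"
      using Suc b by (simp only:) (intro C_k_mult C_k_const Suc.IH, simp)
  qed
qed

lemma frechet_derivative_reflect: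
  assumes "C_k (Suc k) f"
  shows "frechet_derivative (\<lambda>w. f (z - w)) (at w) b = - frechet_derivative f (at (z - w)) b"
proof -
  have "((\<lambda>w. f (z - w)) has_derivative (\<lambda>v. frechet_derivative f (at (z - w)) (- v))) (at w)"
    by (rule has_derivative_compose[where g=f and f="\<lambda>w. z - w" and f'=uminus])
      (auto intro!: derivative_eq_intros C_k_Suc_has_derivative[OF assms])
  then show ?thesis
    using has_derivative_linear[OF C_k_Suc_has_derivative[OF assms]]
    by (simp add: linear_neg frechet_derivative_at[symmetric])
qed

text \<open>
  Averages of translates are differentiated under the integral sign. The Leibniz
  rule asks for a derivative that is continuous into the space of bounded linear maps; in finite
  dimension this amounts to continuity of the partial derivatives.
\<close>
lemma has_derivative_integral_translate:
  fixes f :: "'a::euclidean_space \<Rightarrow> real"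
  assumes f: "C_k (Suc k) f" and h: "0 \<le> h"
  shows "((\<lambda>x. integral {0..h} (\<lambda>s. f (x + s *\<^sub>R c))) has_derivative
     (\<lambda>v. integral {0..h} (\<lambda>s. frechet_derivative f (at (x + s *\<^sub>R c)) v))) (at x)"
proof -
  define D where "D = (\<lambda>x. Blinfun (frechet_derivative f (at x)))"
  have D: "blinfun_apply (D x) = frechet_derivative f (at x)" for x
    unfolding D_def
    by (intro bounded_linear_Blinfun_apply has_derivative_bounded_linear[OF C_k_Suc_has_derivative[OF f]])
  have cD: "continuous_on UNIV D"
  proof (rule continuous_on_blinfun_componentwise)
    fix i :: 'a assume "i \<in> Basis"
    then show "continuous_on UNIV (\<lambda>x. blinfun_apply (D x) i)"
      using f C_k_continuous by (auto simp: D)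
  qed
  have cont: "continuous_on {0..h} (\<lambda>s. D (x + s *\<^sub>R c))" for x
    by (intro continuous_on_compose2[OF cD] continuous_intros) auto
  have "((\<lambda>x. integral (cbox 0 h) (\<lambda>s. f (x + s *\<^sub>R c))) has_derivative
      integral (cbox 0 h) (\<lambda>s. D (x + s *\<^sub>R c))) (at x within UNIV)"
  proof (rule leibniz_rule[where U=UNIV and fx="\<lambda>x s. D (x + s *\<^sub>R c)"])
    fix x s
    have "((\<lambda>x. f (x + s *\<^sub>R c)) has_derivative (\<lambda>v. frechet_derivative f (at (x + s *\<^sub>R c)) v)) (at x)"
      by (rule has_derivative_compose[where g=f and f="\<lambda>x. x + s *\<^sub>R c" and f'="\<lambda>v. v"])
        (auto intro!: derivative_eq_intros C_k_Suc_has_derivative[OF f])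
    then show "((\<lambda>x. f (x + s *\<^sub>R c)) has_derivative blinfun_apply (D (x + s *\<^sub>R c))) (at x)"
      by (simp add: D)
  next
    fix x
    show "(\<lambda>s. f (x + s *\<^sub>R c)) integrable_on cbox 0 h"
      by (intro integrable_continuous continuous_on_compose2[OF C_k_continuous[OF f]] continuous_intros) auto
  next
    show "continuous_on (UNIV \<times> cbox 0 h) (\<lambda>(x, s). D (x + s *\<^sub>R c))"
      unfolding case_prod_beta by (intro continuous_on_compose2[OF cD] continuous_intros) auto
  qed auto
  moreover have "blinfun_apply (integral (cbox 0 h) (\<lambda>s. D (x + s *\<^sub>R c))) =
      (\<lambda>v. integral (cbox 0 h) (\<lambda>s. frechet_derivative f (at (x + s *\<^sub>R c)) v))"
    by (rule ext, subst blinfun_apply_integral) (auto intro!: integrable_continuous_real cont simp: D)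
  ultimately show ?thesis
    by simp
qed

lemma C_k_integral_translate:
  fixes f :: "'a::euclidean_space \<Rightarrow> real"
  assumes h: "0 \<le> h"
  shows "C_k k f \<Longrightarrow> C_k k (\<lambda>x. integral {0..h} (\<lambda>s. f (x + s *\<^sub>R c)))"
proof (induction k arbitrary: f)
  case 0
  then have f: "continuous_on UNIV f" by simp
  have "continuous_on (UNIV \<times> cbox 0 h) (\<lambda>(x, s). f (x + s *\<^sub>R c))"
    unfolding case_prod_beta by (intro continuous_on_compose2[OF f] continuous_intros) auto
  from integral_continuous_on_param[OF this] show ?case by simp
next
  case (Suc k)
  show ?case
    by (rule C_k_SucI[OF has_derivative_integral_translate[OF Suc.prems h]], rule Suc.IH)
      (use Suc.prems in auto)
qed

text \<open>
  Averaging along \<open>c\<close> turns the derivative in direction \<open>c\<close> into a difference. This is how finite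
  increments of a function become accessible to its weak derivative.
\<close>
lemma frechet_derivative_integral_translate:
  fixes f :: "'a::euclidean_space \<Rightarrow> real"
  assumes f: "\<And>k. C_k k f" and h: "0 \<le> h"
  shows "frechet_derivative (\<lambda>x. integral {0..h} (\<lambda>s. f (x + s *\<^sub>R c))) (at x) c = f (x + h *\<^sub>R c) - f x"
proof -
  have d: "(f has_derivative frechet_derivative f (at y)) (at y)" for y
    using C_k_Suc_has_derivative f by blast
  have "frechet_derivative (\<lambda>x. integral {0..h} (\<lambda>s. f (x + s *\<^sub>R c))) (at x) c =
      integral {0..h} (\<lambda>s. frechet_derivative f (at (x + s *\<^sub>R c)) c)"
    using frechet_derivative_at[OF has_derivative_integral_translate[OF f h, where x=x and c=c]]
    by (metis)
  also have "((\<lambda>s. frechet_derivative f (at (x + s *\<^sub>R c)) c) has_integral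
      f (x + h *\<^sub>R c) - f (x + 0 *\<^sub>R c)) {0..h}"
  proof (rule fundamental_theorem_of_calculus[OF h])
    fix s
    have "((\<lambda>s. f (x + s *\<^sub>R c)) has_derivative (\<lambda>v. frechet_derivative f (at (x + s *\<^sub>R c)) (v *\<^sub>R c))) (at s within {0..h})"
      by (rule has_derivative_compose[where g=f and f="\<lambda>s. x + s *\<^sub>R c"])
        (auto intro!: derivative_eq_intros d)
    then show "((\<lambda>s. f (x + s *\<^sub>R c)) has_vector_derivative frechet_derivative f (at (x + s *\<^sub>R c)) c) (at s within {0..h})"
      using has_derivative_linear[OF d]
      by (simp add: has_vector_derivative_def linear_cmul)
  qed
  then have "integral {0..h} (\<lambda>s. frechet_derivative f (at (x + s *\<^sub>R c)) c) = f (x + h *\<^sub>R c) - f x"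
    by (simp add: integral_unique)
  finally show ?thesis .
qed

section \<open>Smooth mollifiers\<close>

text \<open>
  The functions \<open>p(1/x) exp(-1/x)\<close>, extended by \<open>0\<close> to \<open>x \<le> 0\<close>, form a family closed under
  differentiation. This gives smoothness of all of them at once, in particular of \<open>exp(-1/x)\<close>.
\<close>
definition flat_exp :: "real poly \<Rightarrow> real \<Rightarrow> real" where
  "flat_exp p x = (if x > 0 then poly p (1 / x) * exp (- (1 / x)) else 0)"

definition flat_exp_deriv :: "real poly \<Rightarrow> real poly" where
  "flat_exp_deriv p = [:0, 0, 1:] * (p - pderiv p)"

lemma poly_times_exp_neg_tendsto_0: "((\<lambda>x. poly p x * exp (- x)) \<longlongrightarrow> (0::real)) at_top"
proof -
  have "((\<lambda>x::real. \<Sum>i\<le>degree p. coeff p i * (x ^ i / exp x)) \<longlongrightarrow> (\<Sum>i\<le>degree p. coeff p i * 0)) at_top"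
    by (intro tendsto_intros tendsto_power_div_exp_0)
  then show ?thesis
    by (simp add: poly_altdef exp_minus divide_inverse sum_distrib_right mult.assoc)
qed

lemma flat_exp_has_derivative:
  "(flat_exp p has_real_derivative flat_exp (flat_exp_deriv p) x) (at x)"
proof (cases x "0::real" rule: linorder_cases)
  case greater
  have "((\<lambda>x. poly p (1 / x) * exp (- (1 / x))) has_real_derivative flat_exp (flat_exp_deriv p) x) (at x)"
    unfolding flat_exp_def flat_exp_deriv_def using greater
    by (auto intro!: derivative_eq_intros DERIV_chain'[where g="poly p"] poly_DERIV
        simp: field_simps power2_eq_square)
  then show ?thesis
    by (rule has_field_derivative_transform_within_open[where S="{0<..}"])
      (use greater in \<open>auto simp: flat_exp_def\<close>)
next
  case less
  have "((\<lambda>x. 0) has_real_derivative flat_exp (flat_exp_deriv p) x) (at x)"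
    using less by (auto simp: flat_exp_def)
  then show ?thesis
    by (rule has_field_derivative_transform_within_open[where S="{..<0}"])
      (use less in \<open>auto simp: flat_exp_def\<close>)
next
  case equal
  have "((\<lambda>h. flat_exp p h / h) \<longlongrightarrow> 0) (at_right 0)"
  proof (rule Lim_transform_eventually)
    show "((\<lambda>h. poly ([:0, 1:] * p) (inverse h) * exp (- (inverse h))) \<longlongrightarrow> (0::real)) (at_right 0)"
      by (rule filterlim_compose[OF poly_times_exp_neg_tendsto_0 filterlim_inverse_at_top_right])
    show "\<forall>\<^sub>F h in at_right 0. poly ([:0, 1:] * p) (inverse h) * exp (- (inverse h)) = flat_exp p h / h"
      by (rule eventually_at_right_less[THEN eventually_mono]) (auto simp: flat_exp_def field_simps)
  qed
  moreover have "((\<lambda>h. flat_exp p h / h) \<longlongrightarrow> 0) (at_left 0)"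
    by (rule Lim_transform_eventually[OF tendsto_const])
      (auto simp: flat_exp_def eventually_at_left_field intro: exI[of _ "-1"])
  ultimately have "((\<lambda>h. flat_exp p h / h) \<longlongrightarrow> 0) (at 0)"
    by (simp add: filterlim_at_split)
  then show ?thesis
    unfolding DERIV_def equal by (simp add: flat_exp_def)
qed

text \<open>
  Composition with the polynomial \<open>d - \<bar>w\<bar>\<^sup>2\<close> gives bump functions on the ball of radius \<open>\<surd>d\<close>. The
  induction needs all polynomials \<open>p\<close> simultaneously.
\<close>
lemma C_k_flat_exp_norm: "C_k k (\<lambda>w::'a::euclidean_space. flat_exp p (d - w \<bullet> w))"
proof (induction k arbitrary: p)
  case 0
  have "continuous_on UNIV (flat_exp p)"
    by (meson DERIV_isCont flat_exp_has_derivative continuous_at_imp_continuous_on)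
  then show ?case
    by (auto intro!: continuous_intros continuous_on_compose2[of UNIV "flat_exp p"])
next
  case (Suc k)
  show ?case
  proof (rule C_k_SucI)
    fix w :: 'a
    have "(flat_exp p has_derivative (\<lambda>v. flat_exp (flat_exp_deriv p) (d - w \<bullet> w) * v)) (at (d - w \<bullet> w))"
      using flat_exp_has_derivative has_field_derivative_imp_has_derivative by blast
    then show "((\<lambda>w. flat_exp p (d - w \<bullet> w)) has_derivative
        (\<lambda>v. flat_exp (flat_exp_deriv p) (d - w \<bullet> w) * (- 2 * (w \<bullet> v)))) (at w)"
      by (rule has_derivative_compose[rotated])
        (auto intro!: derivative_eq_intros simp: inner_commute)
  next
    fix b :: 'a
    show "C_k k (\<lambda>w. flat_exp (flat_exp_deriv p) (d - w \<bullet> w) * (- 2 * (w \<bullet> b)))"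
      by (intro C_k_mult Suc C_k_const C_k_inner)
  qed
qed

lemma mollifier_exists:
  assumes "0 < \<epsilon>"
  obtains \<rho> :: "'a::euclidean_space \<Rightarrow> real"
  where "\<And>k. C_k k \<rho>" "\<And>w. 0 \<le> \<rho> w" "\<And>w. \<rho> w \<noteq> 0 \<Longrightarrow> norm w \<le> \<epsilon>"
    "(\<integral>\<^sup>+w. ennreal (\<rho> w) \<partial>lborel) = 1"
proof -
  define f :: "'a \<Rightarrow> real" where "f = (\<lambda>w. flat_exp 1 (\<epsilon>\<^sup>2 - w \<bullet> w))"
  have f_C: "C_k k f" for k
    unfolding f_def by (rule C_k_flat_exp_norm)
  have f_nonneg: "0 \<le> f w" for w
    by (simp add: f_def flat_exp_def)
  have f_supp: "f w \<noteq> 0 \<longleftrightarrow> norm w < \<epsilon>" for w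
    using assms by (simp add: f_def flat_exp_def norm_lt_square)
  have [measurable]: "f \<in> borel_measurable borel"
    using C_k_continuous[OF f_C] by (rule borel_measurable_continuous_onI)
  have "integrable lborel (\<lambda>x. indicator (cball 0 \<epsilon>) x *\<^sub>R f x)"
    by (rule borel_integrable_compact) (auto intro: continuous_on_subset[OF C_k_continuous[OF f_C]])
  also have "(\<lambda>x. indicator (cball 0 \<epsilon>) x *\<^sub>R f x) = f"
    using f_supp by (intro ext) (metis indicator_simps dist_0_norm less_imp_le mem_cball mult_zero_right
        real_scaleR_def scaleR_one)
  finally have int: "integrable lborel f" .
  define c where "c = (\<integral>\<^sup>+w. ennreal (f w) \<partial>lborel)"
  have "c \<noteq> \<infinity>"
    using int f_nonneg unfolding c_def integrable_iff_bounded by (simp add: less_top)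
  moreover have "c \<noteq> 0"
  proof
    assume "c = 0"
    then have "AE w in lborel. f w = 0"
      unfolding c_def by (subst (asm) nn_integral_0_iff_AE) (use f_nonneg in \<open>auto simp: order_antisym\<close>)
    then have "AE w in lborel. w \<notin> ball (0::'a) \<epsilon>"
      by (rule eventually_mono) (use f_supp in force)
    then have "ball (0::'a) \<epsilon> \<in> null_sets lborel"
      by (subst AE_iff_null_sets) auto
    then show False
      using assms negligible_iff_null_sets open_not_negligible[of "ball (0::'a) \<epsilon>"]
      by (auto simp: negligible_iff_null_sets null_sets_completionI)
  qed
  ultimately obtain C where C: "c = ennreal C" "0 < C"
    by (cases c) (auto simp: top_unique)
  show ?thesis
  proof (rule that[of "\<lambda>w. inverse C * f w"])
    show "C_k k (\<lambda>w. inverse C * f w)" for k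
      by (intro C_k_mult C_k_const f_C)
    have "(\<integral>\<^sup>+w. ennreal (inverse C * f w) \<partial>lborel) = ennreal (inverse C) * c"
      unfolding c_def using C f_nonneg
      by (subst nn_integral_cmult[symmetric]) (auto simp: ennreal_mult)
    also have "\<dots> = 1"
      using C by (simp add: ennreal_mult[symmetric])
    finally show "(\<integral>\<^sup>+w. ennreal (inverse C * f w) \<partial>lborel) = 1" .
  qed (use f_nonneg f_supp C in \<open>auto simp: less_imp_le\<close>)
qed

section \<open>Increments of functions with a weak derivative\<close>

lemma nn_integral_lborel_reflect:
  fixes f :: "'a::euclidean_space \<Rightarrow> ennreal"
  assumes [measurable]: "f \<in> borel_measurable borel"
  shows "(\<integral>\<^sup>+w. f (z - w) \<partial>lborel) = (\<integral>\<^sup>+w. f w \<partial>lborel)"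
proof -
  have "(\<integral>\<^sup>+w. f w \<partial>lborel) = (\<integral>\<^sup>+w. f w \<partial>distr lborel borel (\<lambda>w. z + (-1) *\<^sub>R w))"
    by (subst lborel_affine[of "-1" z]) (simp_all add: density_1 nn_integral_density)
  also have "\<dots> = (\<integral>\<^sup>+w. f (z - w) \<partial>lborel)"
    by (subst nn_integral_distr) auto
  finally show ?thesis ..
qed

lemma nn_integral_lborel_translate:
  fixes f :: "'a::euclidean_space \<Rightarrow> ennreal"
  assumes [measurable]: "f \<in> borel_measurable borel"
  shows "(\<integral>\<^sup>+w. f (w + z) \<partial>lborel) = (\<integral>\<^sup>+w. f w \<partial>lborel)"
proof -
  have "(\<integral>\<^sup>+w. f w \<partial>lborel) = (\<integral>\<^sup>+w. f w \<partial>distr lborel borel ((+) z))"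
    by (simp add: lborel_distr_plus)
  also have "\<dots> = (\<integral>\<^sup>+w. f (w + z) \<partial>lborel)"
    by (subst nn_integral_distr) (auto simp: add.commute)
  finally show ?thesis ..
qed

lemma test_functionsI:
  assumes "\<And>k. C_k k \<psi>" and "compact K" "K \<subseteq> S" and "\<And>x. \<psi> x \<noteq> 0 \<Longrightarrow> x \<in> K"
  shows "\<psi> \<in> test_functions S"
proof -
  have "closure {x. \<psi> x \<noteq> 0} \<subseteq> K"
    using assms by (intro closure_minimal compact_imp_closed) auto
  moreover from this have "compact (closure {x. \<psi> x \<noteq> 0})"
    using assms(2) by (metis closed_closure compact_Int_closed inf.absorb_iff2)
  ultimately show ?thesis
    using assms by (auto simp: test_functions_def)
qed

lemma translate_average_nn_integral:
  fixes \<rho> :: "'a::euclidean_space \<Rightarrow> real"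
  assumes C: "\<And>k. C_k k \<rho>" and nonneg: "\<And>w. 0 \<le> \<rho> w" and h: "0 \<le> h"
  shows "ennreal (integral {0..h} (\<lambda>s. \<rho> (v + s *\<^sub>R b))) =
    (\<integral>\<^sup>+s. indicator {0..h} s * ennreal (\<rho> (v + s *\<^sub>R b)) \<partial>lborel)"
proof -
  have cont: "continuous_on {0..h} (\<lambda>s. \<rho> (v + s *\<^sub>R b))"
    by (intro continuous_on_compose2[OF C_k_continuous[OF C]] continuous_intros) auto
  then have int: "set_integrable lborel {0..h} (\<lambda>s. \<rho> (v + s *\<^sub>R b))"
    unfolding set_integrable_def by (intro borel_integrable_compact) auto
  have "ennreal (integral {0..h} (\<lambda>s. \<rho> (v + s *\<^sub>R b))) =
      ennreal (\<integral>s. indicator {0..h} s *\<^sub>R \<rho> (v + s *\<^sub>R b) \<partial>lborel)"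
    using set_borel_integral_eq_integral(2)[OF int] by (simp add: set_lebesgue_integral_def)
  also have "\<dots> = (\<integral>\<^sup>+s. ennreal (indicator {0..h} s *\<^sub>R \<rho> (v + s *\<^sub>R b)) \<partial>lborel)"
    using int nonneg unfolding set_integrable_def
    by (intro nn_integral_eq_integral[symmetric]) auto
  also have "\<dots> = (\<integral>\<^sup>+s. indicator {0..h} s * ennreal (\<rho> (v + s *\<^sub>R b)) \<partial>lborel)"
    by (intro nn_integral_cong) (auto simp: indicator_def)
  finally show ?thesis .
qed

lemma nn_integral_translate_average:
  fixes \<rho> :: "'a::euclidean_space \<Rightarrow> real"
  assumes C: "\<And>k. C_k k \<rho>" and nonneg: "\<And>w. 0 \<le> \<rho> w" and h: "0 \<le> h"
    and mass: "(\<integral>\<^sup>+w. ennreal (\<rho> w) \<partial>lborel) = 1"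
  shows "(\<integral>\<^sup>+v. ennreal (integral {0..h} (\<lambda>s. \<rho> (v + s *\<^sub>R b))) \<partial>lborel) = ennreal h"
proof -
  have [measurable]: "\<rho> \<in> borel_measurable borel"
    using C_k_continuous[OF C] by (rule borel_measurable_continuous_onI)
  have "(\<integral>\<^sup>+v. ennreal (integral {0..h} (\<lambda>s. \<rho> (v + s *\<^sub>R b))) \<partial>lborel) =
      (\<integral>\<^sup>+v. (\<integral>\<^sup>+s. indicator {0..h} s * ennreal (\<rho> (v + s *\<^sub>R b)) \<partial>lborel) \<partial>lborel)"
    by (simp only: translate_average_nn_integral[OF C nonneg h])
  also have "\<dots> = (\<integral>\<^sup>+s. (\<integral>\<^sup>+v. indicator {0..h} s * ennreal (\<rho> (v + s *\<^sub>R b)) \<partial>lborel) \<partial>lborel)"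
    by (rule lborel_pair.Fubini') measurable
  also have "\<dots> = (\<integral>\<^sup>+s. indicator {0..h} s \<partial>lborel)"
  proof (intro nn_integral_cong)
    fix s :: real
    have "(\<integral>\<^sup>+v. ennreal (\<rho> (v + s *\<^sub>R b)) \<partial>lborel) = 1"
      using nn_integral_lborel_translate[of "\<lambda>v. ennreal (\<rho> v)" "s *\<^sub>R b"] mass by simp
    then show "(\<integral>\<^sup>+v. indicator {0..h} s * ennreal (\<rho> (v + s *\<^sub>R b)) \<partial>lborel) = indicator {0..h} s"
      by (subst nn_integral_cmult) auto
  qed
  also have "\<dots> = ennreal h"
    using h by simp
  finally show ?thesis .
qed

text \<open>
  The test function for the increment of a mollified function between \<open>z\<close> and \<open>z + h b\<close>: the
  mollifier, centred at \<open>z\<close>, averaged along the segment. Its support lies in the closed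
  \<open>\<epsilon>\<close>-neighbourhood of the segment.
\<close>
lemma translate_average_test_function:
  fixes \<rho> :: "'a::euclidean_space \<Rightarrow> real"
  assumes C: "\<And>k. C_k k \<rho>" and supp: "\<And>w. \<rho> w \<noteq> 0 \<Longrightarrow> norm w \<le> \<epsilon>" and h: "0 \<le> h"
    and S: "\<And>s. 0 \<le> s \<Longrightarrow> s \<le> h \<Longrightarrow> cball (z + s *\<^sub>R b) \<epsilon> \<subseteq> S"
  shows "(\<lambda>w. integral {0..h} (\<lambda>s. \<rho> (z - w + s *\<^sub>R b))) \<in> test_functions S"
    and "frechet_derivative (\<lambda>w. integral {0..h} (\<lambda>s. \<rho> (z - w + s *\<^sub>R b))) (at w) b =
      \<rho> (z - w) - \<rho> (z + h *\<^sub>R b - w)"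
proof -
  define \<Theta> where "\<Theta> = (\<lambda>v. integral {0..h} (\<lambda>s. \<rho> (v + s *\<^sub>R b)))"
  have \<Theta>: "C_k k \<Theta>" for k
    unfolding \<Theta>_def by (intro C_k_integral_translate C h)
  define K where "K = {x + y |x y. x \<in> (\<lambda>s. z + s *\<^sub>R b) ` {0..h} \<and> y \<in> cball 0 \<epsilon>}"
  have "(\<lambda>w. \<Theta> (z - w)) \<in> test_functions S"
  proof (rule test_functionsI)
    show "C_k k (\<lambda>w. \<Theta> (z - w))" for k
      by (intro C_k_reflect \<Theta>)
    show "compact K"
      unfolding K_def by (intro compact_sums compact_continuous_image continuous_intros) auto
    show "K \<subseteq> S"
    proof
      fix x assume "x \<in> K"
      then obtain s y where "x = z + s *\<^sub>R b + y" "0 \<le> s" "s \<le> h" "norm y \<le> \<epsilon>"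
        unfolding K_def by auto
      then show "x \<in> S"
        using S[of s] by (auto simp: subset_eq dist_norm)
    qed
    fix w assume "\<Theta> (z - w) \<noteq> 0"
    then obtain s where s: "s \<in> {0..h}" "\<rho> (z - w + s *\<^sub>R b) \<noteq> 0"
      unfolding \<Theta>_def by (metis (no_types, lifting) integral_cong integral_0)
    then have "norm (z - w + s *\<^sub>R b) \<le> \<epsilon>"
      using supp by blast
    then have "norm (w - (z + s *\<^sub>R b)) \<le> \<epsilon>"
      by (metis add_diff_eq diff_diff_eq2 norm_minus_commute add.commute add_diff_cancel_left')
    then show "w \<in> K"
      unfolding K_def using s
      by (intro CollectI exI[of _ "z + s *\<^sub>R b"] exI[of _ "w - (z + s *\<^sub>R b)"]) auto
  qed
  then show "(\<lambda>w. integral {0..h} (\<lambda>s. \<rho> (z - w + s *\<^sub>R b))) \<in> test_functions S"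
    by (simp add: \<Theta>_def)
  have "frechet_derivative (\<lambda>w. \<Theta> (z - w)) (at w) b = - frechet_derivative \<Theta> (at (z - w)) b"
    by (rule frechet_derivative_reflect[OF \<Theta>])
  also have "\<dots> = \<rho> (z - w) - \<rho> (z - w + h *\<^sub>R b)"
    unfolding \<Theta>_def using frechet_derivative_integral_translate[OF C h, of b "z - w"] by simp
  finally show "frechet_derivative (\<lambda>w. integral {0..h} (\<lambda>s. \<rho> (z - w + s *\<^sub>R b))) (at w) b =
      \<rho> (z - w) - \<rho> (z + h *\<^sub>R b - w)"
    by (simp add: \<Theta>_def algebra_simps)
qed

lemma mollification_integrable:
  fixes \<rho> :: "'a::euclidean_space \<Rightarrow> real"
  assumes cont: "continuous_on S f" and sub: "cball z e \<subseteq> S"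
    and C: "C_k k \<rho>" and supp: "\<And>w. \<rho> w \<noteq> 0 \<Longrightarrow> norm w \<le> e"
  shows "integrable lborel (\<lambda>w. indicator S w * f w * \<rho> (z - w))"
proof -
  have "integrable lborel (\<lambda>w. indicator (cball z e) w *\<^sub>R (f w * \<rho> (z - w)))"
    by (intro borel_integrable_compact continuous_intros continuous_on_subset[OF cont sub]
        continuous_on_compose2[OF C_k_continuous[OF C]]) auto
  also have "(\<lambda>w. indicator (cball z e) w *\<^sub>R (f w * \<rho> (z - w))) = (\<lambda>w. indicator S w * f w * \<rho> (z - w))"
  proof
    fix w
    show "indicator (cball z e) w *\<^sub>R (f w * \<rho> (z - w)) = indicator S w * f w * \<rho> (z - w)"
      using sub supp[of "z - w"] by (cases "\<rho> (z - w) = 0") (auto simp: indicator_def dist_norm)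
  qed
  finally show ?thesis .
qed

lemma mollification_tendsto:
  fixes \<rho> :: "nat \<Rightarrow> 'a::euclidean_space \<Rightarrow> real"
  assumes S: "open S" "continuous_on S f" "z \<in> S"
    and C: "\<And>n k. C_k k (\<rho> n)" and nonneg: "\<And>n w. 0 \<le> \<rho> n w"
    and supp: "\<And>n w. \<rho> n w \<noteq> 0 \<Longrightarrow> norm w \<le> inverse (real (Suc n))"
    and mass: "\<And>n. (\<integral>\<^sup>+w. ennreal (\<rho> n w) \<partial>lborel) = 1"
  shows "(\<lambda>n. \<integral>w. indicator S w * f w * \<rho> n (z - w) \<partial>lborel) \<longlonglongrightarrow> f z"
proof (rule LIMSEQ_I)
  fix \<delta> :: real assume \<delta>: "0 < \<delta>"
  have [measurable]: "\<rho> n \<in> borel_measurable borel" for n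
    using C_k_continuous[OF C] by (rule borel_measurable_continuous_onI)
  have "isCont f z"
    using S by (simp add: continuous_on_eq_continuous_at)
  then obtain d where d: "0 < d" "\<And>w. dist w z < d \<Longrightarrow> dist (f w) (f z) < \<delta> / 2"
    using \<delta> unfolding continuous_at_eps_delta by (meson half_gt_zero)
  obtain e where e: "0 < e" "cball z e \<subseteq> S"
    using S by (meson open_contains_cball)
  obtain N where N: "inverse (real (Suc N)) < min d e"
    using reals_Archimedean[of "min d e"] d e by auto
  show "\<exists>N. \<forall>n\<ge>N. norm ((\<integral>w. indicator S w * f w * \<rho> n (z - w) \<partial>lborel) - f z) < \<delta>"
  proof (intro exI[of _ N] allI impI)
    fix n assume "N \<le> n"
    then have n: "inverse (real (Suc n)) < min d e"
      using N by (smt (verit) inverse_le_iff_le le_imp_inverse_le of_nat_0_less_iff of_nat_mono Suc_le_mono zero_less_Suc)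
    have "(\<integral>\<^sup>+w. ennreal (\<rho> n (z - w)) \<partial>lborel) = 1"
      using nn_integral_lborel_reflect[of "\<lambda>w. ennreal (\<rho> n w)" z] mass by simp
    then have int: "has_bochner_integral lborel (\<lambda>w. \<rho> n (z - w)) 1"
      by (intro has_bochner_integral_nn_integral) (auto simp: nonneg)
    have int_f: "integrable lborel (\<lambda>w. indicator S w * f w * \<rho> n (z - w))"
      by (rule mollification_integrable[OF S(2) e(2) C]) (use supp n in \<open>fastforce\<close>)
    have bound: "norm (indicator S w * f w * \<rho> n (z - w) - f z * \<rho> n (z - w)) \<le> \<delta> / 2 * \<rho> n (z - w)" for w
    proof (cases "\<rho> n (z - w) = 0")
      case False
      then have "dist w z < d" "dist w z < e"
        using supp[OF False] n by (auto simp: dist_norm norm_minus_commute)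
      then have "w \<in> S" "\<bar>f w - f z\<bar> \<le> \<delta> / 2"
        using e(2) d(2)[of w] by (auto simp: dist_commute dist_real_def subset_eq)
      then have "\<bar>f w - f z\<bar> * \<rho> n (z - w) \<le> \<delta> / 2 * \<rho> n (z - w)"
        using nonneg by (intro mult_right_mono) auto
      then show ?thesis
        using \<open>w \<in> S\<close> nonneg[of n "z - w"] by (simp add: left_diff_distrib[symmetric] abs_mult)
    qed auto
    have "(\<integral>w. indicator S w * f w * \<rho> n (z - w) \<partial>lborel) - f z =
        (\<integral>w. indicator S w * f w * \<rho> n (z - w) - f z * \<rho> n (z - w) \<partial>lborel)"
      using int int_f by (simp add: has_bochner_integral_iff)
    also have "norm \<dots> \<le> (\<integral>w. \<delta> / 2 * \<rho> n (z - w) \<partial>lborel)"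
      by (rule order.trans[OF integral_norm_bound integral_mono]) (use int int_f bound in \<open>auto simp: has_bochner_integral_iff\<close>)
    also have "\<dots> = \<delta> / 2"
      using int by (simp add: has_bochner_integral_iff)
    finally show "norm ((\<integral>w. indicator S w * f w * \<rho> n (z - w) \<partial>lborel) - f z) < \<delta>"
      using \<delta> by linarith
  qed
qed

lemma integral_Cauchy_Schwarz:
  fixes f g :: "'a \<Rightarrow> real"
  assumes [measurable]: "f \<in> borel_measurable M" "g \<in> borel_measurable M"
  shows "ennreal ((\<integral>x. f x * g x \<partial>M)\<^sup>2) \<le> (\<integral>\<^sup>+x. ennreal ((f x)\<^sup>2) \<partial>M) * (\<integral>\<^sup>+x. ennreal ((g x)\<^sup>2) \<partial>M)"
proof (cases "integrable M (\<lambda>x. f x * g x)")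
  case True
  have "ennreal ((\<integral>x. f x * g x \<partial>M)\<^sup>2) = (ennreal (norm (\<integral>x. f x * g x \<partial>M)))\<^sup>2"
    by (simp add: ennreal_power)
  also have "\<dots> \<le> (\<integral>\<^sup>+x. ennreal (norm (f x * g x)) \<partial>M)\<^sup>2"
    by (intro power_mono integral_norm_bound_ennreal True) auto
  also have "\<dots> = (\<integral>\<^sup>+x. ennreal \<bar>f x\<bar> * ennreal \<bar>g x\<bar> \<partial>M)\<^sup>2"
    by (simp add: ennreal_mult abs_mult)
  also have "\<dots> \<le> (\<integral>\<^sup>+x. (ennreal \<bar>f x\<bar>)\<^sup>2 \<partial>M) * (\<integral>\<^sup>+x. (ennreal \<bar>g x\<bar>)\<^sup>2 \<partial>M)"
    by (rule Cauchy_Schwarz_nn_integral) auto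
  also have "\<dots> = (\<integral>\<^sup>+x. ennreal ((f x)\<^sup>2) \<partial>M) * (\<integral>\<^sup>+x. ennreal ((g x)\<^sup>2) \<partial>M)"
    by (simp add: ennreal_power)
  finally show ?thesis .
qed (simp add: not_integrable_integral_eq)

text \<open>
  Mollify \<open>f\<close> with \<open>\<rho>\<^sub>n\<close>. The increment of the mollified function over \<open>h b\<close> is the integral of \<open>g\<close>
  against the kernel \<open>\<Theta>\<^sub>n(z - w)\<close>, the average of \<open>\<rho>\<^sub>n\<close> along the segment, which has mass \<open>h\<close> in either
  variable. So the Cauchy-Schwarz inequality and Tonelli's theorem bound the squared increment by
  \<open>h\<^sup>2 \<integral> g\<^sup>2\<close>. As \<open>f\<close> is continuous, its mollifications converge pointwise, and Fatou's lemma gives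
  the claim. Near \<open>z\<close> the kernels are supported in \<open>S\<close> only for large \<open>n\<close>, depending on the distance
  of the segment to the complement of \<open>S\<close>; therefore the limit is taken pointwise in \<open>z\<close> first.
\<close>
lemma difference_quotient_bound:
  fixes f g :: "'a::euclidean_space \<Rightarrow> real"
  assumes S: "open S" "continuous_on S f" and g[measurable]: "g \<in> borel_measurable borel"
    and weak: "\<And>\<psi>. \<psi> \<in> test_functions S \<Longrightarrow>
      (\<integral>x. indicator S x * f x * frechet_derivative \<psi> (at x) b \<partial>lborel) = - (\<integral>x. g x * \<psi> x \<partial>lborel)"
    and h: "0 < h" and K: "\<And>z s. z \<in> K \<Longrightarrow> 0 \<le> s \<Longrightarrow> s \<le> h \<Longrightarrow> z + s *\<^sub>R b \<in> S"
  shows "(\<integral>\<^sup>+z. indicator K z * ennreal ((f (z + h *\<^sub>R b) - f z)\<^sup>2) \<partial>lborel)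
    \<le> ennreal (h\<^sup>2) * (\<integral>\<^sup>+w. ennreal ((g w)\<^sup>2) \<partial>lborel)"
proof -
  have "\<exists>\<rho> :: nat \<Rightarrow> 'a \<Rightarrow> real. \<forall>n. (\<forall>k. C_k k (\<rho> n)) \<and> (\<forall>w. 0 \<le> \<rho> n w) \<and>
      (\<forall>w. \<rho> n w \<noteq> 0 \<longrightarrow> norm w \<le> inverse (real (Suc n))) \<and> (\<integral>\<^sup>+w. ennreal (\<rho> n w) \<partial>lborel) = 1"
  proof (intro choice allI)
    fix n
    obtain \<rho> :: "'a \<Rightarrow> real" where "\<And>k. C_k k \<rho>" "\<And>w. 0 \<le> \<rho> w"
      "\<And>w. \<rho> w \<noteq> 0 \<Longrightarrow> norm w \<le> inverse (real (Suc n))" "(\<integral>\<^sup>+w. ennreal (\<rho> w) \<partial>lborel) = 1"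
      using mollifier_exists[of "inverse (real (Suc n))"] by auto
    then show "\<exists>\<rho> :: 'a \<Rightarrow> real. (\<forall>k. C_k k \<rho>) \<and> (\<forall>w. 0 \<le> \<rho> w) \<and>
        (\<forall>w. \<rho> w \<noteq> 0 \<longrightarrow> norm w \<le> inverse (real (Suc n))) \<and> (\<integral>\<^sup>+w. ennreal (\<rho> w) \<partial>lborel) = 1"
      by blast
  qed
  then obtain \<rho> :: "nat \<Rightarrow> 'a \<Rightarrow> real" where C: "\<And>n k. C_k k (\<rho> n)" and nonneg: "\<And>n w. 0 \<le> \<rho> n w"
    and supp: "\<And>n w. \<rho> n w \<noteq> 0 \<Longrightarrow> norm w \<le> inverse (real (Suc n))"
    and mass: "\<And>n. (\<integral>\<^sup>+w. ennreal (\<rho> n w) \<partial>lborel) = 1"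
    by blast
  define \<Theta> where "\<Theta> n v = integral {0..h} (\<lambda>s. \<rho> n (v + s *\<^sub>R b))" for n v
  have \<Theta>_C: "C_k k (\<Theta> n)" for n k
    unfolding \<Theta>_def using h by (intro C_k_integral_translate C) auto
  have [measurable]: "\<Theta> n \<in> borel_measurable borel" for n
    using C_k_continuous[OF \<Theta>_C] by (rule borel_measurable_continuous_onI)
  have \<Theta>_nonneg: "0 \<le> \<Theta> n v" for n v
  proof -
    have "(\<lambda>s. \<rho> n (v + s *\<^sub>R b)) integrable_on {0..h}"
      by (intro integrable_continuous_real continuous_on_compose2[OF C_k_continuous[OF C]] continuous_intros) auto
    then show ?thesis
      unfolding \<Theta>_def by (intro integral_nonneg nonneg)
  qed
  have \<Theta>_mass: "(\<integral>\<^sup>+v. ennreal (\<Theta> n v) \<partial>lborel) = ennreal h" for n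
    unfolding \<Theta>_def using h by (intro nn_integral_translate_average C nonneg mass) auto
  have \<Theta>_mass_left: "(\<integral>\<^sup>+w. ennreal (\<Theta> n (z - w)) \<partial>lborel) = ennreal h" for n z
    using nn_integral_lborel_reflect[of "\<lambda>w. ennreal (\<Theta> n w)" z] by (simp add: \<Theta>_mass)
  have \<Theta>_mass_right: "(\<integral>\<^sup>+z. ennreal (\<Theta> n (z - w)) \<partial>lborel) = ennreal h" for n w
    using nn_integral_lborel_translate[of "\<lambda>v. ennreal (\<Theta> n v)" "- w"] by (simp add: \<Theta>_mass)
  define F where "F n z = (\<integral>\<^sup>+w. ennreal ((g w)\<^sup>2 * \<Theta> n (z - w)) \<partial>lborel)" for n z
  have [measurable]: "F n \<in> borel_measurable borel" for n
    unfolding F_def by measurable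
  have F_int: "(\<integral>\<^sup>+z. F n z \<partial>lborel) = ennreal h * (\<integral>\<^sup>+w. ennreal ((g w)\<^sup>2) \<partial>lborel)" for n
  proof -
    have "(\<integral>\<^sup>+z. F n z \<partial>lborel) = (\<integral>\<^sup>+w. (\<integral>\<^sup>+z. ennreal ((g w)\<^sup>2 * \<Theta> n (z - w)) \<partial>lborel) \<partial>lborel)"
      unfolding F_def by (rule lborel_pair.Fubini') measurable
    also have "\<dots> = (\<integral>\<^sup>+w. ennreal h * ennreal ((g w)\<^sup>2) \<partial>lborel)"
      using \<Theta>_nonneg by (simp add: ennreal_mult nn_integral_cmult \<Theta>_mass_right) (simp add: mult.commute nn_integral_cmult)
    finally show ?thesis
      by (simp add: nn_integral_cmult)
  qed
  have "indicator K z * ennreal ((f (z + h *\<^sub>R b) - f z)\<^sup>2) \<le> liminf (\<lambda>n. ennreal h * F n z)" for z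
  proof (cases "z \<in> K")
    case True
    have "compact ((\<lambda>s. z + s *\<^sub>R b) ` {0..h})"
      by (intro compact_continuous_image continuous_intros) auto
    moreover have "(\<lambda>s. z + s *\<^sub>R b) ` {0..h} \<subseteq> S"
      using K[OF True] by auto
    ultimately obtain e where e: "0 < e" "(\<Union>x\<in>(\<lambda>s. z + s *\<^sub>R b) ` {0..h}. cball x e) \<subseteq> S"
      using S(1) compact_subset_open_imp_cball_epsilon_subset by metis
    then have e_sub: "cball (z + s *\<^sub>R b) e \<subseteq> S" if "0 \<le> s" "s \<le> h" for s
      using that by (force simp: subset_eq)
    define I where "I n y = (\<integral>w. indicator S w * f w * \<rho> n (y - w) \<partial>lborel)" for n y
    have in_S: "z \<in> S" "z + h *\<^sub>R b \<in> S"
      using K[OF True, of 0] K[OF True, of h] h by auto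
    then have "(\<lambda>n. I n (z + h *\<^sub>R b) - I n z) \<longlonglongrightarrow> f (z + h *\<^sub>R b) - f z"
      unfolding I_def by (intro tendsto_diff mollification_tendsto S C nonneg supp mass)
    then have "(\<lambda>n. ennreal ((I n (z + h *\<^sub>R b) - I n z)\<^sup>2)) \<longlonglongrightarrow> ennreal ((f (z + h *\<^sub>R b) - f z)\<^sup>2)"
      by (intro tendsto_ennrealI tendsto_power)
    then have "ennreal ((f (z + h *\<^sub>R b) - f z)\<^sup>2) = liminf (\<lambda>n. ennreal ((I n (z + h *\<^sub>R b) - I n z)\<^sup>2))"
      using lim_imp_Liminf by (metis trivial_limit_sequentially)
    also have "\<dots> \<le> liminf (\<lambda>n. ennreal h * F n z)"
    proof (rule Liminf_mono)
      obtain N where N: "inverse (real (Suc N)) < e"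
        using reals_Archimedean e by blast
      show "\<forall>\<^sub>F n in sequentially. ennreal ((I n (z + h *\<^sub>R b) - I n z)\<^sup>2) \<le> ennreal h * F n z"
        unfolding eventually_sequentially
      proof (intro exI[of _ N] allI impI)
        fix n assume "N \<le> n"
        then have n: "inverse (real (Suc n)) \<le> e"
          using N by (smt (verit) inverse_le_iff_le le_imp_inverse_le of_nat_0_less_iff of_nat_mono Suc_le_mono zero_less_Suc)
        have supp_e: "norm w \<le> e" if "\<rho> n w \<noteq> 0" for w
          using supp[OF that] n by linarith
        have S_n: "cball (z + s *\<^sub>R b) e \<subseteq> S" if "0 \<le> s" "s \<le> h" for s
          using e_sub that .
        have test: "(\<lambda>w. \<Theta> n (z - w)) \<in> test_functions S"
          "frechet_derivative (\<lambda>w. \<Theta> n (z - w)) (at w) b = \<rho> n (z - w) - \<rho> n (z + h *\<^sub>R b - w)" for w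
          unfolding \<Theta>_def
          using translate_average_test_function[OF C supp_e less_imp_le[OF h] S_n] by auto
        have int: "integrable lborel (\<lambda>w. indicator S w * f w * \<rho> n (y - w))" if "cball y e \<subseteq> S" for y
          using mollification_integrable[OF S(2) that C supp_e] .
        have "I n (z + h *\<^sub>R b) - I n z = (\<integral>w. indicator S w * f w * \<rho> n (z + h *\<^sub>R b - w)
            - indicator S w * f w * \<rho> n (z - w) \<partial>lborel)"
          unfolding I_def using e_sub[of 0] e_sub[of h] h
          by (intro Bochner_Integration.integral_diff[symmetric] int) auto
        also have "\<dots> = - (\<integral>w. indicator S w * f w * frechet_derivative (\<lambda>w. \<Theta> n (z - w)) (at w) b \<partial>lborel)"
          unfolding test(2) Bochner_Integration.integral_minus[symmetric]
          by (intro Bochner_Integration.integral_cong) (auto simp: algebra_simps)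
        also have "\<dots> = (\<integral>w. g w * \<Theta> n (z - w) \<partial>lborel)"
          using weak[OF test(1)] by simp
        finally have "ennreal ((I n (z + h *\<^sub>R b) - I n z)\<^sup>2) = ennreal ((\<integral>w. g w * \<Theta> n (z - w) \<partial>lborel)\<^sup>2)"
          by simp
        also have "\<dots> = ennreal ((\<integral>w. sqrt (\<Theta> n (z - w)) * (g w * sqrt (\<Theta> n (z - w))) \<partial>lborel)\<^sup>2)"
          using \<Theta>_nonneg by (simp add: mult.left_commute flip: real_sqrt_mult)
        also have "\<dots> \<le> (\<integral>\<^sup>+w. ennreal ((sqrt (\<Theta> n (z - w)))\<^sup>2) \<partial>lborel)
            * (\<integral>\<^sup>+w. ennreal ((g w * sqrt (\<Theta> n (z - w)))\<^sup>2) \<partial>lborel)"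
          by (rule integral_Cauchy_Schwarz) auto
        also have "\<dots> = (\<integral>\<^sup>+w. ennreal (\<Theta> n (z - w)) \<partial>lborel) * F n z"
          using \<Theta>_nonneg by (simp add: F_def power_mult_distrib)
        finally show "ennreal ((I n (z + h *\<^sub>R b) - I n z)\<^sup>2) \<le> ennreal h * F n z"
          by (simp add: \<Theta>_mass_left)
      qed
    qed
    finally show ?thesis
      using True by simp
  qed simp
  then have "(\<integral>\<^sup>+z. indicator K z * ennreal ((f (z + h *\<^sub>R b) - f z)\<^sup>2) \<partial>lborel)
      \<le> (\<integral>\<^sup>+z. liminf (\<lambda>n. ennreal h * F n z) \<partial>lborel)"
    by (intro nn_integral_mono) auto
  also have "\<dots> \<le> liminf (\<lambda>n. \<integral>\<^sup>+z. ennreal h * F n z \<partial>lborel)"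
    by (rule nn_integral_liminf) measurable
  also have "\<dots> = ennreal (h\<^sup>2) * (\<integral>\<^sup>+w. ennreal ((g w)\<^sup>2) \<partial>lborel)"
    using h by (simp add: nn_integral_cmult F_int Liminf_const mult.assoc[symmetric] power2_eq_square ennreal_mult)
  finally show ?thesis .
qed

section \<open>Riesz representation in \<open>L\<^sup>2\<close>\<close>

definition L2 :: "'a measure \<Rightarrow> ('a \<Rightarrow> real) set" where
  "L2 M = {f \<in> borel_measurable M. integrable M (\<lambda>x. (f x)\<^sup>2)}"

lemma Lp_2_eq_L2: "Lp 2 M = L2 M"
proof -
  have "enn2real 2 = 2"
    by (metis enn2real_numeral)
  then show ?thesis
    by (auto simp: Lp_def L2_def powr_numeral)
qed

lemma L2_integrable_mult:
  assumes "f \<in> L2 M" "g \<in> L2 M"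
  shows "integrable M (\<lambda>x. f x * g x)"
proof (rule Bochner_Integration.integrable_bound)
  show "integrable M (\<lambda>x. (f x)\<^sup>2 + (g x)\<^sup>2)"
    using assms by (auto simp: L2_def)
  show "AE x in M. norm (f x * g x) \<le> norm ((f x)\<^sup>2 + (g x)\<^sup>2)"
  proof (intro AE_I2)
    fix x
    have "2 * (\<bar>f x\<bar> * \<bar>g x\<bar>) \<le> (f x)\<^sup>2 + (g x)\<^sup>2"
      using zero_le_power2[of "\<bar>f x\<bar> - \<bar>g x\<bar>"] by (simp add: power2_diff algebra_simps)
    then show "norm (f x * g x) \<le> norm ((f x)\<^sup>2 + (g x)\<^sup>2)"
      by (simp add: abs_mult) (smt (verit) abs_ge_zero mult_nonneg_nonneg)
  qed
qed (use assms in \<open>auto simp: L2_def\<close>)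

lemma L2_lincomb:
  assumes "f \<in> L2 M" "g \<in> L2 M"
  shows "(\<lambda>x. c * f x + d * g x) \<in> L2 M"
proof -
  have "integrable M (\<lambda>x. c\<^sup>2 * (f x)\<^sup>2 + 2 * c * d * (f x * g x) + d\<^sup>2 * (g x)\<^sup>2)"
    using assms L2_integrable_mult[OF assms] by (auto simp: L2_def)
  then have "integrable M (\<lambda>x. (c * f x + d * g x)\<^sup>2)"
    by (rule Bochner_Integration.integrable_cong[THEN iffD1, rotated -1])
      (auto simp: power2_eq_square algebra_simps)
  then show ?thesis
    using assms by (auto simp: L2_def)
qed

lemma L2_integral_square_lincomb:
  assumes "f \<in> L2 M" "g \<in> L2 M"
  shows "(\<integral>x. (c * f x + d * g x)\<^sup>2 \<partial>M) =
    c\<^sup>2 * (\<integral>x. (f x)\<^sup>2 \<partial>M) + 2 * c * d * (\<integral>x. f x * g x \<partial>M) + d\<^sup>2 * (\<integral>x. (g x)\<^sup>2 \<partial>M)"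
proof -
  have "(\<integral>x. (c * f x + d * g x)\<^sup>2 \<partial>M) =
      (\<integral>x. c\<^sup>2 * (f x)\<^sup>2 + 2 * c * d * (f x * g x) + d\<^sup>2 * (g x)\<^sup>2 \<partial>M)"
    by (intro Bochner_Integration.integral_cong) (auto simp: power2_eq_square algebra_simps)
  also have "\<dots> = c\<^sup>2 * (\<integral>x. (f x)\<^sup>2 \<partial>M) + 2 * c * d * (\<integral>x. f x * g x \<partial>M) + d\<^sup>2 * (\<integral>x. (g x)\<^sup>2 \<partial>M)"
    using assms L2_integrable_mult[OF assms] by (simp add: L2_def)
  finally show ?thesis .
qed

lemma L2_nn_integral: "f \<in> L2 M \<Longrightarrow> (\<integral>\<^sup>+x. ennreal ((f x)\<^sup>2) \<partial>M) = ennreal (\<integral>x. (f x)\<^sup>2 \<partial>M)"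
  by (intro nn_integral_eq_integral) (auto simp: L2_def)

lemma L2I_nn_integral:
  assumes "f \<in> borel_measurable M" "(\<integral>\<^sup>+x. ennreal ((f x)\<^sup>2) \<partial>M) < \<infinity>"
  shows "f \<in> L2 M"
  using assms by (auto simp: L2_def integrable_iff_bounded)

lemma L2_Cauchy_Schwarz:
  assumes "f \<in> L2 M" "g \<in> L2 M"
  shows "(\<integral>x. f x * g x \<partial>M)\<^sup>2 \<le> (\<integral>x. (f x)\<^sup>2 \<partial>M) * (\<integral>x. (g x)\<^sup>2 \<partial>M)"
proof -
  have "ennreal ((\<integral>x. f x * g x \<partial>M)\<^sup>2) \<le> ennreal ((\<integral>x. (f x)\<^sup>2 \<partial>M) * (\<integral>x. (g x)\<^sup>2 \<partial>M))"
    using integral_Cauchy_Schwarz[of f M g] assms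
    by (simp add: L2_nn_integral ennreal_mult) (simp add: L2_def)
  then show ?thesis
    by (subst (asm) ennreal_le_iff) auto
qed

text \<open>
  Finiteness forces \<open>\<bar>v\<^sub>k\<^sub>+\<^sub>1 - v\<^sub>k\<bar>\<close> to decay like \<open>2 powr (-k/2)\<close>. The weights \<open>2\<^sup>k\<close> are small enough
  for the integrated sum to converge when the squared \<open>L\<^sup>2\<close> distances decay like \<open>4 powr (-k)\<close>.
\<close>
lemma convergent_of_weighted_square_sum_finite:
  fixes v :: "nat \<Rightarrow> real"
  assumes "(\<Sum>k. ennreal (2 ^ k * (v (Suc k) - v k)\<^sup>2)) < \<infinity>"
  shows "convergent v"
proof -
  obtain B where B: "(\<Sum>k. ennreal (2 ^ k * (v (Suc k) - v k)\<^sup>2)) = ennreal B" "0 \<le> B"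
    using that assms unfolding infinity_ennreal_def less_top_ennreal by blast
  have bound: "\<bar>v (Suc k) - v k\<bar> \<le> sqrt B * (sqrt (1 / 2)) ^ k" for k
  proof -
    have "ennreal (2 ^ k * (v (Suc k) - v k)\<^sup>2) \<le> ennreal B"
      using sum_le_suminf[of "\<lambda>k. ennreal (2 ^ k * (v (Suc k) - v k)\<^sup>2)" "{k}"] B(1) by simp
    then have "2 ^ k * (v (Suc k) - v k)\<^sup>2 \<le> B"
      using B(2) by (simp add: ennreal_le_iff)
    then have "(1 / 2) ^ k * (2 ^ k * (v (Suc k) - v k)\<^sup>2) \<le> (1 / 2) ^ k * B"
      by (intro mult_left_mono) auto
    then have "(v (Suc k) - v k)\<^sup>2 \<le> B * (1 / 2) ^ k"
      by (simp only: mult.assoc[symmetric] power_mult_distrib[symmetric]) (simp add: mult.commute)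
    then have "sqrt ((v (Suc k) - v k)\<^sup>2) \<le> sqrt (B * (1 / 2) ^ k)"
      by (rule real_sqrt_le_mono)
    then have "\<bar>v (Suc k) - v k\<bar> \<le> sqrt (B * (1 / 2) ^ k)"
      by (simp only: real_sqrt_abs)
    then show ?thesis
      by (simp only: real_sqrt_mult real_sqrt_power)
  qed
  have "summable (\<lambda>k. v (Suc k) - v k)"
  proof (rule summable_comparison_test)
    show "\<exists>N. \<forall>n\<ge>N. norm (v (Suc n) - v n) \<le> sqrt B * (sqrt (1 / 2)) ^ n"
      using bound by auto
    have "sqrt (1 / 2) < 1"
      by simp
    then show "summable (\<lambda>k. sqrt B * (sqrt (1 / 2)) ^ k)"
      by (intro summable_mult summable_geometric) auto
  qed
  then have "(\<lambda>n. \<Sum>k<n. v (Suc k) - v k) \<longlonglongrightarrow> (\<Sum>k. v (Suc k) - v k)"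
    by (rule summable_LIMSEQ)
  then have "(\<lambda>n. v 0 + (\<Sum>k<n. v (Suc k) - v k)) \<longlonglongrightarrow> v 0 + (\<Sum>k. v (Suc k) - v k)"
    by (intro tendsto_intros)
  then show ?thesis
    by (auto simp: sum_lessThan_telescope convergent_def)
qed

text \<open>
  The part of the completeness of \<open>L\<^sup>2\<close> that is needed here: a sequence that converges at a geometric
  rate converges almost everywhere, and by Fatou's lemma also in norm.
\<close>
lemma L2_geometric_Cauchy_limit:
  fixes v :: "nat \<Rightarrow> 'a \<Rightarrow> real"
  assumes v: "\<And>n. v n \<in> L2 M"
    and cauchy: "\<And>m n. m \<le> n \<Longrightarrow> (\<integral>x. (v n x - v m x)\<^sup>2 \<partial>M) \<le> (1 / 4) ^ m"
  obtains g where "g \<in> L2 M" "\<And>n. (\<integral>x. (v n x - g x)\<^sup>2 \<partial>M) \<le> (1 / 4) ^ n"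
proof -
  have [measurable]: "v n \<in> borel_measurable M" for n
    using v by (auto simp: L2_def)
  have diff: "(\<lambda>x. f x - h x) \<in> L2 M" if "f \<in> L2 M" "h \<in> L2 M" for f h
    using L2_lincomb[OF that, of 1 "-1"] by simp
  have nn: "(\<integral>\<^sup>+x. ennreal ((v n x - v m x)\<^sup>2) \<partial>M) \<le> ennreal ((1 / 4) ^ m)" if "m \<le> n" for m n
    using L2_nn_integral[OF diff[OF v v], of n m] cauchy[OF that] by (simp add: ennreal_leI)
  have "(\<integral>\<^sup>+x. (\<Sum>k. ennreal (2 ^ k * (v (Suc k) x - v k x)\<^sup>2)) \<partial>M) =
      (\<Sum>k. \<integral>\<^sup>+x. ennreal (2 ^ k * (v (Suc k) x - v k x)\<^sup>2) \<partial>M)"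
    by (rule nn_integral_suminf) measurable
  also have "\<dots> \<le> (\<Sum>k. ennreal ((1 / 2) ^ k))"
  proof (intro suminf_le)
    fix k
    have "(\<integral>\<^sup>+x. ennreal (2 ^ k * (v (Suc k) x - v k x)\<^sup>2) \<partial>M) =
        ennreal (2 ^ k) * (\<integral>\<^sup>+x. ennreal ((v (Suc k) x - v k x)\<^sup>2) \<partial>M)"
      by (subst nn_integral_cmult[symmetric]) (auto simp: ennreal_mult)
    also have "\<dots> \<le> ennreal (2 ^ k) * ennreal ((1 / 4) ^ k)"
      by (intro mult_left_mono nn) auto
    also have "\<dots> = ennreal ((1 / 2) ^ k)"
      by (simp add: ennreal_mult[symmetric] power_mult_distrib[symmetric])
    finally show "(\<integral>\<^sup>+x. ennreal (2 ^ k * (v (Suc k) x - v k x)\<^sup>2) \<partial>M) \<le> ennreal ((1 / 2) ^ k)" .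
  qed auto
  also have "\<dots> = ennreal (\<Sum>k. (1 / 2) ^ k)"
    by (intro suminf_ennreal2) (auto intro: summable_geometric)
  finally have "(\<integral>\<^sup>+x. (\<Sum>k. ennreal (2 ^ k * (v (Suc k) x - v k x)\<^sup>2)) \<partial>M) \<noteq> \<infinity>"
    using ennreal_less_top le_less_trans by (metis infinity_ennreal_def less_irrefl)
  then have "AE x in M. (\<Sum>k. ennreal (2 ^ k * (v (Suc k) x - v k x)\<^sup>2)) \<noteq> \<infinity>"
    by (intro nn_integral_PInf_AE) measurable
  then have conv: "AE x in M. convergent (\<lambda>n. v n x)"
    by (rule eventually_mono) (intro convergent_of_weighted_square_sum_finite, simp add: less_top)
  define g where "g x = lim (\<lambda>n. v n x)" for x
  have [measurable]: "g \<in> borel_measurable M"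
    unfolding g_def by measurable
  have lim: "AE x in M. (\<lambda>n. v n x) \<longlonglongrightarrow> g x"
    using conv by (rule eventually_mono) (simp add: g_def convergent_LIMSEQ_iff)
  have bound: "(\<integral>\<^sup>+x. ennreal ((v n x - g x)\<^sup>2) \<partial>M) \<le> ennreal ((1 / 4) ^ n)" for n
  proof -
    have "(\<integral>\<^sup>+x. ennreal ((v n x - g x)\<^sup>2) \<partial>M) = (\<integral>\<^sup>+x. liminf (\<lambda>m. ennreal ((v n x - v m x)\<^sup>2)) \<partial>M)"
    proof (rule nn_integral_cong_AE)
      show "AE x in M. ennreal ((v n x - g x)\<^sup>2) = liminf (\<lambda>m. ennreal ((v n x - v m x)\<^sup>2))"
        using lim
      proof (rule eventually_mono)
        fix x assume "(\<lambda>n. v n x) \<longlonglongrightarrow> g x"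
        then have "(\<lambda>m. ennreal ((v n x - v m x)\<^sup>2)) \<longlonglongrightarrow> ennreal ((v n x - g x)\<^sup>2)"
          by (intro tendsto_ennrealI tendsto_intros)
        then show "ennreal ((v n x - g x)\<^sup>2) = liminf (\<lambda>m. ennreal ((v n x - v m x)\<^sup>2))"
          using lim_imp_Liminf by (metis trivial_limit_sequentially)
      qed
    qed
    also have "\<dots> \<le> liminf (\<lambda>m. \<integral>\<^sup>+x. ennreal ((v n x - v m x)\<^sup>2) \<partial>M)"
      by (rule nn_integral_liminf) measurable
    also have "\<dots> \<le> liminf (\<lambda>m. ennreal ((1 / 4) ^ n))"
      by (intro Liminf_mono eventually_sequentiallyI[of n]) (use nn in \<open>simp add: power2_commute[of "v n _"]\<close>)
    finally show ?thesis
      by (simp add: Liminf_const)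
  qed
  have d: "(\<lambda>x. v n x - g x) \<in> L2 M" for n
    by (rule L2I_nn_integral) (use bound[of n] in \<open>auto intro: le_less_trans\<close>)
  show ?thesis
  proof (rule that)
    show "g \<in> L2 M"
      using diff[OF v[of 0] d[of 0]] by simp
    show "(\<integral>x. (v n x - g x)\<^sup>2 \<partial>M) \<le> (1 / 4) ^ n" for n
      using bound[of n] unfolding L2_nn_integral[OF d] by (subst (asm) ennreal_le_iff) auto
  qed
qed

text \<open>
  Riesz representation on a subspace \<open>V\<close> of \<open>L\<^sup>2\<close>. The functional \<open>J v = 2 F v - \<parallel>v\<parallel>\<^sup>2\<close> is bounded
  above on \<open>V\<close>, and by the parallelogram law a maximising sequence converges in \<open>L\<^sup>2\<close>. Its limit \<open>g\<close>,
  which need not lie in \<open>V\<close>, represents \<open>F\<close>, since the first variation of \<open>J\<close> vanishes at a maximum.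
\<close>
lemma L2_functional_representation:
  fixes V :: "('a \<Rightarrow> real) set" and F :: "('a \<Rightarrow> real) \<Rightarrow> real"
  assumes V: "V \<subseteq> L2 M" "V \<noteq> {}"
    and lincomb: "\<And>v w c d. v \<in> V \<Longrightarrow> w \<in> V \<Longrightarrow> (\<lambda>x. c * v x + d * w x) \<in> V"
    and linear: "\<And>v w c d. v \<in> V \<Longrightarrow> w \<in> V \<Longrightarrow> F (\<lambda>x. c * v x + d * w x) = c * F v + d * F w"
    and bound: "\<And>v. v \<in> V \<Longrightarrow> (F v)\<^sup>2 \<le> C * (\<integral>x. (v x)\<^sup>2 \<partial>M)" and C: "0 \<le> C"
  obtains g where "g \<in> L2 M" "\<And>v. v \<in> V \<Longrightarrow> F v = (\<integral>x. g x * v x \<partial>M)"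
proof -
  define N where "N v = (\<integral>x. (v x)\<^sup>2 \<partial>M)" for v :: "'a \<Rightarrow> real"
  define J where "J v = 2 * F v - N v" for v
  have N_nonneg: "0 \<le> N v" for v
    by (simp add: N_def)
  have J_le: "J v \<le> C" if "v \<in> V" for v
  proof -
    have "(2 * F v)\<^sup>2 \<le> 4 * (C * N v)"
      using bound[OF that] by (simp add: N_def power_mult_distrib)
    \<comment> \<open>arithmetic and geometric mean\<close>
    also have "\<dots> \<le> (C + N v)\<^sup>2"
      using zero_le_power2[of "C - N v"] by (simp add: power2_eq_square algebra_simps)
    finally have "2 * F v \<le> C + N v"
      using C N_nonneg power2_le_imp_le by (metis add_nonneg_nonneg)
    then show ?thesis
      by (simp add: J_def)
  qed
  define S where "S = (SUP v\<in>V. J v)"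
  have bdd: "bdd_above (J ` V)"
    by (intro bdd_aboveI2[of V J C] J_le)
  have J_S: "J v \<le> S" if "v \<in> V" for v
    unfolding S_def using that bdd by (intro cSUP_upper)
  have "\<exists>v\<in>V. S - J v \<le> (1 / 4) ^ n / 4" for n
  proof -
    have "S - (1 / 4) ^ n / 4 < (SUP v\<in>V. J v)"
      by (simp add: S_def)
    then obtain v where "v \<in> V" "S - (1 / 4) ^ n / 4 < J v"
      using less_cSUP_iff[of V J "S - (1 / 4) ^ n / 4"] V bdd by auto
    then show ?thesis
      by (intro bexI[of _ v]) auto
  qed
  then obtain v where v: "\<And>n. v n \<in> V" "\<And>n. S - J (v n) \<le> (1 / 4) ^ n / 4"
    by metis
  have cauchy: "(\<integral>x. (v n x - v m x)\<^sup>2 \<partial>M) \<le> (1 / 4) ^ m" if "m \<le> n" for m n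
  proof -
    have L2: "v n \<in> L2 M" "v m \<in> L2 M"
      using V v by auto
    define P where "P = (\<integral>x. v n x * v m x \<partial>M)"
    have "J (\<lambda>x. 1 / 2 * v n x + 1 / 2 * v m x) \<le> S"
      by (intro J_S lincomb v)
    moreover have "J (\<lambda>x. 1 / 2 * v n x + 1 / 2 * v m x) =
        F (v n) + F (v m) - (1 / 4 * N (v n) + 1 / 2 * P + 1 / 4 * N (v m))"
      unfolding J_def N_def P_def L2_integral_square_lincomb[OF L2] linear[OF v(1) v(1)]
      by (simp add: power2_eq_square)
    moreover have "(\<integral>x. (v n x - v m x)\<^sup>2 \<partial>M) = N (v n) - 2 * P + N (v m)"
      using L2_integral_square_lincomb[OF L2, of 1 "-1"] by (simp add: N_def P_def)
    ultimately have "(\<integral>x. (v n x - v m x)\<^sup>2 \<partial>M) \<le> 2 * (S - J (v n)) + 2 * (S - J (v m))"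
      by (simp add: J_def)
    also have "\<dots> \<le> 2 * ((1 / 4) ^ m / 4) + 2 * ((1 / 4) ^ m / 4)"
    proof -
      have "(1 / 4 :: real) ^ n \<le> (1 / 4) ^ m"
        by (intro power_decreasing that) auto
      then have "(1 / 4 :: real) ^ n / 4 \<le> (1 / 4) ^ m / 4"
        by (rule divide_right_mono) simp
      then show ?thesis
        by (intro add_mono mult_left_mono order_trans[OF v(2)[of n]] v(2)[of m]) auto
    qed
    finally show ?thesis
      by simp
  qed
  obtain g where g: "g \<in> L2 M" "\<And>n. (\<integral>x. (v n x - g x)\<^sup>2 \<partial>M) \<le> (1 / 4) ^ n"
    using L2_geometric_Cauchy_limit[of v M] V v(1) cauchy by blast
  show ?thesis
  proof (rule that[OF g(1)])
    fix w assume w: "w \<in> V"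
    then have w2: "w \<in> L2 M"
      using V by auto
    have geo: "(\<lambda>n. (1 / 4 :: real) ^ n) \<longlonglongrightarrow> 0"
      by (rule LIMSEQ_power_zero) auto
    have "(\<lambda>n. (\<integral>x. (v n x - g x) * w x \<partial>M)) \<longlonglongrightarrow> 0"
    proof -
      have "(\<lambda>n. (\<integral>x. (v n x - g x) * w x \<partial>M)\<^sup>2) \<longlonglongrightarrow> 0"
      proof (rule tendsto_sandwich[OF _ _ tendsto_const])
        have "(\<integral>x. (v n x - g x) * w x \<partial>M)\<^sup>2 \<le> (1 / 4) ^ n * N w" for n
        proof -
          have "(\<lambda>x. v n x - g x) \<in> L2 M"
            using L2_lincomb[of "v n" M g 1 "-1"] V v g by auto
          then have "(\<integral>x. (v n x - g x) * w x \<partial>M)\<^sup>2 \<le> (\<integral>x. (v n x - g x)\<^sup>2 \<partial>M) * N w"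
            unfolding N_def by (rule L2_Cauchy_Schwarz[OF _ w2])
          also have "\<dots> \<le> (1 / 4) ^ n * N w"
            by (intro mult_right_mono g N_nonneg)
          finally show ?thesis .
        qed
        then show "\<forall>\<^sub>F n in sequentially. (\<integral>x. (v n x - g x) * w x \<partial>M)\<^sup>2 \<le> (1 / 4) ^ n * N w"
          by simp
        show "(\<lambda>n. (1 / 4) ^ n * N w) \<longlonglongrightarrow> 0"
          using tendsto_mult[OF geo tendsto_const[of "N w"]] by simp
      qed simp
      then show ?thesis
        by (simp add: power_tendsto_0_iff)
    qed
    moreover have "(\<integral>x. (v n x - g x) * w x \<partial>M) = (\<integral>x. v n x * w x \<partial>M) - (\<integral>x. g x * w x \<partial>M)" for n
    proof -
      have "v n \<in> L2 M"
        using V v(1) by auto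
      then show ?thesis
        using L2_integrable_mult[OF _ w2] g(1) by (simp add: left_diff_distrib)
    qed
    ultimately have lim: "(\<lambda>n. \<integral>x. v n x * w x \<partial>M) \<longlonglongrightarrow> (\<integral>x. g x * w x \<partial>M)"
      by (simp add: LIM_zero_iff)
    define a where "a = F w - (\<integral>x. g x * w x \<partial>M)"
    \<comment> \<open>the first variation of \<open>J\<close> in direction \<open>w\<close>, in the limit along the maximising sequence\<close>
    have a: "2 * s * a \<le> s\<^sup>2 * N w" for s
    proof -
      have "2 * s * (F w - (\<integral>x. v n x * w x \<partial>M)) \<le> (1 / 4) ^ n + s\<^sup>2 * N w" for n
      proof -
        have vn: "v n \<in> L2 M"
          using V v by auto
        have "J (\<lambda>x. 1 * v n x + s * w x) \<le> S"
          by (intro J_S lincomb v w)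
        also have "J (\<lambda>x. 1 * v n x + s * w x) =
            J (v n) + 2 * s * (F w - (\<integral>x. v n x * w x \<partial>M)) - s\<^sup>2 * N w"
          unfolding J_def N_def L2_integral_square_lincomb[OF vn w2] linear[OF v(1) w]
          by (simp add: algebra_simps)
        finally show ?thesis
          using order_trans[OF v(2)[of n], of "(1 / 4) ^ n"] by auto
      qed
      moreover have "(\<lambda>n. 2 * s * (F w - (\<integral>x. v n x * w x \<partial>M))) \<longlonglongrightarrow> 2 * s * a"
        unfolding a_def by (intro tendsto_intros lim)
      moreover have "(\<lambda>n. (1 / 4) ^ n + s\<^sup>2 * N w) \<longlonglongrightarrow> s\<^sup>2 * N w"
        using tendsto_add[OF geo tendsto_const[of "s\<^sup>2 * N w"]] by simp
      ultimately show ?thesis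
        by (intro LIMSEQ_le) auto
    qed
    have "a = 0"
    proof (rule ccontr)
      assume "a \<noteq> 0"
      define m where "m = N w + 1"
      have pos: "0 < m" "N w \<le> m"
        using N_nonneg[of w] by (auto simp: m_def)
      have "2 * (a / m) * a \<le> (a / m)\<^sup>2 * N w"
        by (rule a)
      also have "\<dots> \<le> (a / m)\<^sup>2 * m"
        using pos by (intro mult_left_mono) auto
      finally have "2 * (a * a) / m \<le> (a * a) / m"
        using pos by (simp add: power2_eq_square)
      moreover have "0 < (a * a) / m"
        using pos \<open>a \<noteq> 0\<close> by (intro divide_pos_pos) (simp_all add: zero_less_mult_iff, linarith)
      ultimately show False
        by simp
    qed
    then show "F w = (\<integral>x. g x * w x \<partial>M)"
      by (simp add: a_def)
  qed
qed

section \<open>Weak derivatives from bounded increments\<close>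

lemma lborel_translate:
  fixes f :: "'a::euclidean_space \<Rightarrow> real"
  assumes [measurable]: "f \<in> borel_measurable borel"
  shows integral_lborel_translate: "(\<integral>z. f (z + c) \<partial>lborel) = (\<integral>z. f z \<partial>lborel)"
    and integrable_lborel_translate: "integrable lborel (\<lambda>z. f (z + c)) \<longleftrightarrow> integrable lborel f"
proof -
  have "(\<integral>z. f z \<partial>lborel) = (\<integral>z. f z \<partial>distr lborel borel ((+) c))"
    by (simp add: lborel_distr_plus)
  also have "\<dots> = (\<integral>z. f (z + c) \<partial>lborel)"
    by (subst integral_distr) (auto simp: add.commute)
  finally show "(\<integral>z. f (z + c) \<partial>lborel) = (\<integral>z. f z \<partial>lborel)" ..
  have "integrable lborel f \<longleftrightarrow> integrable (distr lborel borel ((+) c)) f"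
    by (simp add: lborel_distr_plus)
  also have "\<dots> \<longleftrightarrow> integrable lborel (\<lambda>z. f (z + c))"
    by (subst integrable_distr_eq) (auto simp: add.commute)
  finally show "integrable lborel (\<lambda>z. f (z + c)) \<longleftrightarrow> integrable lborel f" ..
qed

lemma test_function_C_k: "\<psi> \<in> test_functions S \<Longrightarrow> C_k k \<psi>"
  by (simp add: test_functions_def)

lemma test_function_has_derivative:
  "\<psi> \<in> test_functions S \<Longrightarrow> (\<psi> has_derivative frechet_derivative \<psi> (at x)) (at x)"
  using C_k_Suc_has_derivative test_function_C_k by blast

lemma test_functions_lincomb:
  assumes "v \<in> test_functions S" "w \<in> test_functions S"
  shows "(\<lambda>x. c * v x + d * w x) \<in> test_functions S"
proof (rule test_functionsI)
  show "C_k k (\<lambda>x. c * v x + d * w x)" for k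
    using assms by (intro C_k_add C_k_mult C_k_const test_function_C_k)
  let ?K = "\<lambda>v. closure {x. v x \<noteq> (0::real)}"
  show "compact (?K v \<union> ?K w)" "?K v \<union> ?K w \<subseteq> S"
    using assms by (auto simp: test_functions_def)
  fix x assume "c * v x + d * w x \<noteq> 0"
  then have "v x \<noteq> 0 \<or> w x \<noteq> 0"
    by auto
  then show "x \<in> ?K v \<union> ?K w"
    using closure_subset[of "{x. v x \<noteq> 0}"] closure_subset[of "{x. w x \<noteq> 0}"] by auto
qed

lemma frechet_derivative_lincomb:
  assumes "v \<in> test_functions S" "w \<in> test_functions S"
  shows "frechet_derivative (\<lambda>x. c * v x + d * w x) (at x) b =
    c * frechet_derivative v (at x) b + d * frechet_derivative w (at x) b"
proof -
  have "((\<lambda>x. c * v x + d * w x) has_derivative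
      (\<lambda>b. c * frechet_derivative v (at x) b + d * frechet_derivative w (at x) b)) (at x)"
    using assms[THEN test_function_has_derivative] by (auto intro!: derivative_eq_intros)
  then show ?thesis
    by (simp add: frechet_derivative_at[symmetric])
qed

lemma test_function_partial_continuous:
  assumes "\<psi> \<in> test_functions S" "b \<in> Basis"
  shows "continuous_on UNIV (\<lambda>x. frechet_derivative \<psi> (at x) b)"
proof -
  have "C_k 0 (\<lambda>x. frechet_derivative \<psi> (at x) b)"
    using test_function_C_k[OF assms(1), of "Suc 0"] assms(2) by simp
  then show ?thesis
    by simp
qed

text \<open>
  Outside the support the derivative vanishes, so compactness of the support suffices.
\<close>
lemma test_function_partial_bounded:
  assumes \<psi>: "\<psi> \<in> test_functions S" and b: "b \<in> Basis"
  obtains L where "0 \<le> L" "\<And>x. \<bar>frechet_derivative \<psi> (at x) b\<bar> \<le> L"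
proof -
  define K where "K = closure {x. \<psi> x \<noteq> 0}"
  have "compact K"
    using \<psi> by (simp add: K_def test_functions_def)
  then have "bounded ((\<lambda>x. frechet_derivative \<psi> (at x) b) ` K)"
    by (intro compact_imp_bounded compact_continuous_image
        continuous_on_subset[OF test_function_partial_continuous[OF \<psi> b]]) auto
  then obtain L where L: "\<And>x. x \<in> K \<Longrightarrow> \<bar>frechet_derivative \<psi> (at x) b\<bar> \<le> L"
    by (auto simp: bounded_iff)
  have "\<bar>frechet_derivative \<psi> (at x) b\<bar> \<le> max L 0" for x
  proof (cases "x \<in> K")
    case False
    have zero: "\<psi> y = 0" if "y \<in> - K" for y
      using that closure_subset[of "{x. \<psi> x \<noteq> 0}"] by (auto simp: K_def)
    have "open (- K)"
      unfolding K_def by (intro open_Compl closed_closure)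
    have "(\<psi> has_derivative (\<lambda>v. 0)) (at x)"
      by (rule has_derivative_transform_within_open[where f="\<lambda>x. 0" and s="- K"])
        (use False zero \<open>open (- K)\<close> in auto)
    then show ?thesis
      by (simp add: frechet_derivative_at[symmetric])
  qed (use L in \<open>fastforce simp: le_max_iff_disj\<close>)
  then show ?thesis
    using that[of "max L 0"] by simp
qed

lemma test_function_L2:
  assumes "\<psi> \<in> test_functions S"
  shows "\<psi> \<in> L2 lborel"
proof -
  have cont: "continuous_on UNIV \<psi>"
    using C_k_continuous test_function_C_k[OF assms] by blast
  define K where "K = closure {x. \<psi> x \<noteq> 0}"
  have "integrable lborel (\<lambda>x. indicator K x *\<^sub>R (\<psi> x)\<^sup>2)"
    using assms by (intro borel_integrable_compact continuous_intros continuous_on_subset[OF cont])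
      (auto simp: K_def test_functions_def)
  also have "(\<lambda>x. indicator K x *\<^sub>R (\<psi> x)\<^sup>2) = (\<lambda>x. (\<psi> x)\<^sup>2)"
    using closure_subset[of "{x. \<psi> x \<noteq> 0}"] by (force simp: K_def indicator_def)
  finally show ?thesis
    using cont by (auto simp: L2_def intro: borel_measurable_continuous_onI)
qed

lemma test_function_directional_derivative:
  assumes \<psi>: "\<psi> \<in> test_functions S"
  shows "((\<lambda>s. \<psi> (z + s *\<^sub>R b)) has_real_derivative frechet_derivative \<psi> (at (z + s *\<^sub>R b)) b) (at s)"
proof -
  have "((\<lambda>s. \<psi> (z + s *\<^sub>R b)) has_derivative (\<lambda>v. frechet_derivative \<psi> (at (z + s *\<^sub>R b)) (v *\<^sub>R b))) (at s)"
    by (rule has_derivative_compose[where g=\<psi> and f="\<lambda>s. z + s *\<^sub>R b"])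
      (auto intro!: derivative_eq_intros test_function_has_derivative[OF \<psi>])
  moreover have "(\<lambda>v. frechet_derivative \<psi> (at (z + s *\<^sub>R b)) (v *\<^sub>R b)) =
      (*) (frechet_derivative \<psi> (at (z + s *\<^sub>R b)) b)"
    using has_derivative_linear[OF test_function_has_derivative[OF \<psi>]]
    by (simp add: linear_cmul fun_eq_iff)
  ultimately show ?thesis
    by (simp add: has_field_derivative_def)
qed

text \<open>
  For a test function \<open>\<psi>\<close>, the integral of \<open>f \<partial>\<^sub>b \<psi>\<close> is the limit of the integrals of \<open>f\<close> against
  backward difference quotients of \<open>\<psi>\<close>. A translation moves the difference to \<open>f\<close>, where the
  assumption applies; hence \<open>(\<integral> f \<partial>\<^sub>b \<psi>)\<^sup>2 \<le> C \<parallel>\<psi>\<parallel>\<^sup>2\<close>, and the Riesz representation applies.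
\<close>
lemma weak_derivative_of_difference_quotients:
  fixes f :: "'a::euclidean_space \<Rightarrow> real"
  assumes f: "integrable lborel f" and b: "b \<in> Basis" and C: "0 \<le> C"
    and dq: "\<And>K. compact K \<Longrightarrow> K \<subseteq> S \<Longrightarrow> \<exists>\<delta>>0. \<forall>h. 0 < h \<and> h < \<delta> \<longrightarrow>
      (\<integral>\<^sup>+z. indicator K z * ennreal ((f (z + h *\<^sub>R b) - f z)\<^sup>2) \<partial>lborel) \<le> ennreal (C * h\<^sup>2)"
  obtains g where "g \<in> L2 lborel" "\<And>\<psi>. \<psi> \<in> test_functions S \<Longrightarrow>
      (\<integral>x. f x * frechet_derivative \<psi> (at x) b \<partial>lborel) = - (\<integral>x. g x * \<psi> x \<partial>lborel)"
proof -
  have [measurable]: "f \<in> borel_measurable borel"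
    using borel_measurable_integrable[OF f] by simp
  have \<psi>_meas: "\<psi> \<in> borel_measurable borel" if "\<psi> \<in> test_functions S" for \<psi>
    using C_k_continuous[OF test_function_C_k[OF that]] by (rule borel_measurable_continuous_onI)
  have \<psi>'_meas: "(\<lambda>x. frechet_derivative \<psi> (at x) b) \<in> borel_measurable borel" if "\<psi> \<in> test_functions S" for \<psi>
    using test_function_partial_continuous[OF that b] by (rule borel_measurable_continuous_onI)
  have int_f': "integrable lborel (\<lambda>x. f x * frechet_derivative \<psi> (at x) b)" if \<psi>: "\<psi> \<in> test_functions S" for \<psi>
  proof -
    note [measurable] = \<psi>'_meas[OF \<psi>]
    obtain L where L: "0 \<le> L" "\<And>x. \<bar>frechet_derivative \<psi> (at x) b\<bar> \<le> L"
      using test_function_partial_bounded[OF \<psi> b] by blast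
    show ?thesis
      by (rule Bochner_Integration.integrable_bound[OF integrable_mult_right[OF f, of L]])
        (use L in \<open>auto simp: abs_mult mult.commute[of L] intro!: mult_left_mono\<close>)
  qed
  define F where "F \<psi> = - (\<integral>x. f x * frechet_derivative \<psi> (at x) b \<partial>lborel)" for \<psi>
  have "(F \<psi>)\<^sup>2 \<le> C * (\<integral>x. (\<psi> x)\<^sup>2 \<partial>lborel)" if \<psi>: "\<psi> \<in> test_functions S" for \<psi>
  proof -
    note [measurable] = \<psi>_meas[OF \<psi>] \<psi>'_meas[OF \<psi>]
    obtain L where L: "0 \<le> L" "\<And>x. \<bar>frechet_derivative \<psi> (at x) b\<bar> \<le> L"
      using test_function_partial_bounded[OF \<psi> b] by blast
    define K where "K = closure {x. \<psi> x \<noteq> 0}"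
    have K: "compact K" "K \<subseteq> S"
      using \<psi> by (auto simp: K_def test_functions_def)
    have [measurable]: "K \<in> sets borel"
      by (simp add: K_def)
    have zero: "\<psi> y = 0" if "y \<notin> K" for y
      using that closure_subset[of "{x. \<psi> x \<noteq> 0}"] by (auto simp: K_def)
    obtain \<delta> where \<delta>: "0 < \<delta>" and dq_K: "\<And>h. 0 < h \<Longrightarrow> h < \<delta> \<Longrightarrow>
        (\<integral>\<^sup>+z. indicator K z * ennreal ((f (z + h *\<^sub>R b) - f z)\<^sup>2) \<partial>lborel) \<le> ennreal (C * h\<^sup>2)"
      using dq[OF K] by blast
    \<comment> \<open>a null sequence that stays strictly between \<open>0\<close> and \<open>\<delta>\<close>\<close>
    define h where "h n = \<delta> / real (n + 2)" for n
    have h: "0 < h n" "h n < \<delta>" for n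
      using \<delta> by (auto simp: h_def field_simps intro: add_pos_nonneg)
    have h_lim: "h \<longlonglongrightarrow> 0"
      unfolding h_def by (rule LIMSEQ_ignore_initial_segment[OF lim_const_over_n])
    define q where "q n z = (\<psi> z - \<psi> (z - h n *\<^sub>R b)) / h n" for n z
    have [measurable]: "q n \<in> borel_measurable borel" for n
      unfolding q_def by measurable
    have q_lim: "(\<lambda>n. q n z) \<longlonglongrightarrow> frechet_derivative \<psi> (at z) b" for z
    proof -
      have "((\<lambda>s. (\<psi> (z + s *\<^sub>R b) - \<psi> z) / s) \<longlongrightarrow> frechet_derivative \<psi> (at z) b) (at 0)"
        using test_function_directional_derivative[OF \<psi>, of z b 0] by (simp add: DERIV_def)
      moreover have "filterlim (\<lambda>n. - h n) (at 0) sequentially"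
        using tendsto_minus[OF h_lim] h(1) by (auto simp: filterlim_at less_imp_neq[symmetric] eventually_sequentially
            intro!: exI[of _ 0] dest: less_imp_neq)
      ultimately have "(\<lambda>n. (\<psi> (z + (- h n) *\<^sub>R b) - \<psi> z) / (- h n)) \<longlonglongrightarrow> frechet_derivative \<psi> (at z) b"
        by (rule filterlim_compose)
      then show ?thesis
        by (simp add: q_def diff_divide_distrib)
    qed
    have q_bound: "\<bar>q n z\<bar> \<le> L" for n z
    proof -
      obtain s where "\<psi> (z - h n *\<^sub>R b + h n *\<^sub>R b) - \<psi> (z - h n *\<^sub>R b + 0 *\<^sub>R b) =
          (h n - 0) * frechet_derivative \<psi> (at (z - h n *\<^sub>R b + s *\<^sub>R b)) b"
        using MVT2[OF h(1)[of n], of "\<lambda>s. \<psi> (z - h n *\<^sub>R b + s *\<^sub>R b)"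
            "\<lambda>s. frechet_derivative \<psi> (at (z - h n *\<^sub>R b + s *\<^sub>R b)) b"]
          test_function_directional_derivative[OF \<psi>, of "z - h n *\<^sub>R b" b] by blast
      then show ?thesis
        using L(2) h(1)[of n] by (simp add: q_def)
    qed
    have lim: "(\<lambda>n. \<integral>z. f z * q n z \<partial>lborel) \<longlonglongrightarrow> (\<integral>z. f z * frechet_derivative \<psi> (at z) b \<partial>lborel)"
    proof (rule integral_dominated_convergence[where w="\<lambda>z. L * \<bar>f z\<bar>"])
      show "AE z in lborel. (\<lambda>n. f z * q n z) \<longlonglongrightarrow> f z * frechet_derivative \<psi> (at z) b"
        by (intro AE_I2 tendsto_intros q_lim)
      show "AE z in lborel. norm (f z * q n z) \<le> L * \<bar>f z\<bar>" for n
        using q_bound by (intro AE_I2) (auto simp: abs_mult mult.commute[of L] intro!: mult_left_mono)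
    qed (use f in auto)
    have step: "(\<integral>z. f z * q n z \<partial>lborel)\<^sup>2 \<le> C * (\<integral>x. (\<psi> x)\<^sup>2 \<partial>lborel)" for n
    proof -
      have bounded: "bounded (range \<psi>)"
      proof -
        have "bounded (\<psi> ` K)"
          using C_k_continuous[OF test_function_C_k[OF \<psi>]]
          by (intro compact_imp_bounded compact_continuous_image K) (auto intro: continuous_on_subset)
        moreover have "range \<psi> \<subseteq> insert 0 (\<psi> ` K)"
          using zero by force
        ultimately show ?thesis
          using bounded_subset bounded_insert by metis
      qed
      then obtain B where B: "\<And>x. \<bar>\<psi> x\<bar> \<le> B"
        by (auto simp: bounded_iff)
      have int: "integrable lborel (\<lambda>z. f z * \<psi> (z + c))" for c
        by (rule Bochner_Integration.integrable_bound[OF integrable_mult_right[OF f, of B]])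
          (use B in \<open>auto simp: abs_mult mult.commute[of B] intro!: mult_left_mono order_trans[OF B]\<close>)
      define c where "c = h n *\<^sub>R b"
      have int1: "integrable lborel (\<lambda>z. f z * \<psi> z)" "integrable lborel (\<lambda>z. f z * \<psi> (z - c))"
        using int[of 0] int[of "- c"] by auto
      have int2: "integrable lborel (\<lambda>z. f (z + c) * \<psi> z)"
        using integrable_lborel_translate[of "\<lambda>z. f z * \<psi> (z - c)" c] int1 by simp
      have "(\<integral>z. f z * q n z \<partial>lborel) = (\<integral>z. (f z * \<psi> z - f z * \<psi> (z - c)) / h n \<partial>lborel)"
        by (simp add: q_def c_def right_diff_distrib)
      also have "\<dots> = ((\<integral>z. f z * \<psi> z \<partial>lborel) - (\<integral>z. f z * \<psi> (z - c) \<partial>lborel)) / h n"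
        using int1 by simp
      also have "(\<integral>z. f z * \<psi> (z - c) \<partial>lborel) = (\<integral>z. f (z + c) * \<psi> z \<partial>lborel)"
        using integral_lborel_translate[of "\<lambda>z. f z * \<psi> (z - c)" c] by simp
      also have "((\<integral>z. f z * \<psi> z \<partial>lborel) - (\<integral>z. f (z + c) * \<psi> z \<partial>lborel)) / h n =
          (\<integral>z. (f z * \<psi> z - f (z + c) * \<psi> z) / h n \<partial>lborel)"
        using int1 int2 by simp
      also have "\<dots> = (\<integral>z. (indicator K z * (f (z + c) - f z)) * (- \<psi> z / h n) \<partial>lborel)"
        using zero by (intro Bochner_Integration.integral_cong) (auto simp: indicator_def diff_divide_distrib left_diff_distrib)
      finally have "ennreal ((\<integral>z. f z * q n z \<partial>lborel)\<^sup>2) \<le>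
          (\<integral>\<^sup>+z. ennreal ((indicator K z * (f (z + c) - f z))\<^sup>2) \<partial>lborel) * (\<integral>\<^sup>+z. ennreal ((- \<psi> z / h n)\<^sup>2) \<partial>lborel)"
        using integral_Cauchy_Schwarz[of "\<lambda>z. indicator K z * (f (z + c) - f z)" lborel "\<lambda>z. - \<psi> z / h n"] by simp
      also have "(\<integral>\<^sup>+z. ennreal ((indicator K z * (f (z + c) - f z))\<^sup>2) \<partial>lborel) =
          (\<integral>\<^sup>+z. indicator K z * ennreal ((f (z + h n *\<^sub>R b) - f z)\<^sup>2) \<partial>lborel)"
        by (intro nn_integral_cong) (auto simp: indicator_def c_def)
      also have "\<dots> \<le> ennreal (C * (h n)\<^sup>2)"
        by (intro dq_K h)
      also have "(\<integral>\<^sup>+z. ennreal ((- \<psi> z / h n)\<^sup>2) \<partial>lborel) = ennreal (\<integral>z. (\<psi> z)\<^sup>2 / (h n)\<^sup>2 \<partial>lborel)"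
        using test_function_L2[OF \<psi>] unfolding L2_def
        by (subst nn_integral_eq_integral[symmetric]) (auto simp: power_divide)
      also have "ennreal (C * (h n)\<^sup>2) * ennreal (\<integral>z. (\<psi> z)\<^sup>2 / (h n)\<^sup>2 \<partial>lborel) =
          ennreal (C * (h n)\<^sup>2 * (\<integral>z. (\<psi> z)\<^sup>2 / (h n)\<^sup>2 \<partial>lborel))"
        using C by (intro ennreal_mult[symmetric]) auto
      also have "C * (h n)\<^sup>2 * (\<integral>z. (\<psi> z)\<^sup>2 / (h n)\<^sup>2 \<partial>lborel) = C * (\<integral>x. (\<psi> x)\<^sup>2 \<partial>lborel)"
        using h(1)[of n] by simp
      finally have "ennreal ((\<integral>z. f z * q n z \<partial>lborel)\<^sup>2) \<le> ennreal (C * (\<integral>x. (\<psi> x)\<^sup>2 \<partial>lborel))"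
        by (simp add: mult_right_mono)
      then show ?thesis
        using C by (subst (asm) ennreal_le_iff) auto
    qed
    have "(\<integral>z. f z * frechet_derivative \<psi> (at z) b \<partial>lborel)\<^sup>2 \<le> C * (\<integral>x. (\<psi> x)\<^sup>2 \<partial>lborel)"
      using step by (intro LIMSEQ_le_const2[OF tendsto_power[OF lim, of 2]]) auto
    then show ?thesis
      by (simp add: F_def)
  qed
  moreover have "F (\<lambda>x. c * v x + d * w x) = c * F v + d * F w"
    if vw: "v \<in> test_functions S" "w \<in> test_functions S" for v w c d
  proof -
    have "F (\<lambda>x. c * v x + d * w x) = - (\<integral>x. c * (f x * frechet_derivative v (at x) b)
        + d * (f x * frechet_derivative w (at x) b) \<partial>lborel)"
      unfolding F_def frechet_derivative_lincomb[OF vw] by (simp add: algebra_simps)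
    then show ?thesis
      using int_f' vw by (simp add: F_def)
  qed
  moreover have "(\<lambda>x. 0) \<in> test_functions S"
    by (rule test_functionsI[of _ "{}"]) (auto intro: C_k_const)
  ultimately obtain g where "g \<in> L2 lborel" "\<And>\<psi>. \<psi> \<in> test_functions S \<Longrightarrow> F \<psi> = (\<integral>x. g x * \<psi> x \<partial>lborel)"
    using L2_functional_representation[of "test_functions S" lborel F C] test_functions_lincomb
      test_function_L2 C by blast
  then show ?thesis
    unfolding F_def by (intro that[of g]) (simp_all add: minus_equation_iff)
qed

section \<open>The Sobolev space \<open>H\<^sup>1\<close> and difference quotients\<close>

lemma lebesgue_on_borel_version:
  fixes g :: "'a::euclidean_space \<Rightarrow> real"
  assumes S: "S \<in> sets borel" and g: "g \<in> borel_measurable (lebesgue_on S)"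
  obtains g' where "g' \<in> borel_measurable borel" "AE x in lborel. indicator S x *\<^sub>R g x = g' x"
proof -
  have "(\<lambda>x. indicator S x *\<^sub>R g x) \<in> borel_measurable lebesgue"
    using S g by (subst (asm) borel_measurable_restrict_space_iff) auto
  then show ?thesis
    using completion_ex_borel_measurable_real that by fastforce
qed

lemma integral_lebesgue_on_eq:
  fixes k :: "'a::euclidean_space \<Rightarrow> real"
  assumes S: "S \<in> sets borel" and k: "k \<in> borel_measurable (lebesgue_on S)"
    and k': "k' \<in> borel_measurable borel" and eq: "AE x in lborel. indicator S x *\<^sub>R k x = k' x"
  shows "(\<integral>x. k x \<partial>lebesgue_on S) = (\<integral>x. k' x \<partial>lborel)"
    and "integrable (lebesgue_on S) k \<longleftrightarrow> integrable lborel k'"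
proof -
  have m: "(\<lambda>x. indicator S x *\<^sub>R k x) \<in> borel_measurable lebesgue"
    using S k by (subst (asm) borel_measurable_restrict_space_iff) auto
  have m': "k' \<in> borel_measurable lebesgue"
    using k' by (intro measurable_completion) auto
  have eq': "AE x in lebesgue. indicator S x *\<^sub>R k x = k' x"
    using eq by (rule AE_completion)
  have "(\<integral>x. k x \<partial>lebesgue_on S) = (\<integral>x. indicator S x *\<^sub>R k x \<partial>lebesgue)"
    using S by (intro integral_restrict_space) auto
  also have "\<dots> = (\<integral>x. k' x \<partial>lebesgue)"
    by (rule integral_cong_AE[OF m m' eq'])
  also have "\<dots> = (\<integral>x. k' x \<partial>lborel)"
    using k' by (intro integral_completion) auto
  finally show "(\<integral>x. k x \<partial>lebesgue_on S) = (\<integral>x. k' x \<partial>lborel)" .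
  have "integrable (lebesgue_on S) k \<longleftrightarrow> integrable lebesgue (\<lambda>x. indicator S x *\<^sub>R k x)"
    using S by (intro integrable_restrict_space) auto
  also have "\<dots> \<longleftrightarrow> integrable lebesgue k'"
    by (rule integrable_cong_AE[OF m m' eq'])
  also have "\<dots> \<longleftrightarrow> integrable lborel k'"
    using k' by (intro integrable_completion) auto
  finally show "integrable (lebesgue_on S) k \<longleftrightarrow> integrable lborel k'" .
qed

lemma borel_measurable_lebesgue_on:
  fixes f :: "'a::euclidean_space \<Rightarrow> real"
  assumes "f \<in> borel_measurable borel"
  shows "f \<in> borel_measurable (lebesgue_on S)"
  using assms by (intro measurable_restrict_space1 measurable_completion) auto

lemma continuous_on_borel_measurable_lebesgue_on:
  fixes f :: "'a::euclidean_space \<Rightarrow> real"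
  assumes "S \<in> sets borel" "continuous_on S f"
  shows "f \<in> borel_measurable (lebesgue_on S)"
  using borel_measurable_lebesgue_on[OF borel_measurable_continuous_on_indicator[OF assms], of S]
  by (rule measurable_cong[THEN iffD1, rotated]) auto

text \<open>
  For \<open>h > 0\<close> these are the points at which the increment over \<open>h b\<close> can be compared with the weak
  derivative: the whole segment has to stay inside, not only its two ends.
\<close>
definition segment_domain :: "'a::real_normed_vector set \<Rightarrow> 'a \<Rightarrow> real \<Rightarrow> 'a set" where
  "segment_domain S b h = {z. \<forall>s\<in>{0..h}. z + s *\<^sub>R b \<in> S}"

lemma segment_domainD: "z \<in> segment_domain S b h \<Longrightarrow> 0 \<le> h \<Longrightarrow> z \<in> S \<and> z + h *\<^sub>R b \<in> S"
  by (force simp: segment_domain_def)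

lemma open_segment_domain:
  assumes "open S"
  shows "open (segment_domain S b h)"
proof -
  have "closed (\<Union>x\<in>- S. \<Union>y\<in>(\<lambda>s. - (s *\<^sub>R b)) ` {0..h}. {x + y})"
    using assms by (intro closed_compact_sums compact_continuous_image continuous_intros) auto
  also have "(\<Union>x\<in>- S. \<Union>y\<in>(\<lambda>s. - (s *\<^sub>R b)) ` {0..h}. {x + y}) = - segment_domain S b h"
    by (force simp: segment_domain_def algebra_simps)
  finally show ?thesis
    by (simp add: open_closed)
qed

definition difference_quotients_bounded :: "'a::euclidean_space set \<Rightarrow> 'a \<Rightarrow> ('a \<Rightarrow> real) \<Rightarrow> bool" where
  "difference_quotients_bounded S b f \<longleftrightarrow> (\<exists>C\<ge>0. \<forall>h>0.
     (\<integral>\<^sup>+z. indicator (segment_domain S b h) z * ennreal ((f (z + h *\<^sub>R b) - f z)\<^sup>2) \<partial>lborel) \<le> ennreal (C * h\<^sup>2))"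

lemma difference_quotients_bounded_of_H1:
  assumes S: "open S" and cont: "continuous_on S f" and f: "f \<in> H1 S" and b: "b \<in> Basis"
  shows "difference_quotients_bounded S b f"
proof -
  have S': "S \<in> sets borel"
    using S by simp
  obtain g where g: "g \<in> L2 (lebesgue_on S)" "is_weak_partial S b f g"
    using f b by (auto simp: H1_def Lp_2_eq_L2)
  then have g_meas: "g \<in> borel_measurable (lebesgue_on S)"
    by (simp add: L2_def)
  then obtain g' where g': "g' \<in> borel_measurable borel" "AE x in lborel. indicator S x *\<^sub>R g x = g' x"
    using lebesgue_on_borel_version[OF S'] by blast
  have "integrable lborel (\<lambda>x. (g' x)\<^sup>2)"
  proof (rule integral_lebesgue_on_eq(2)[OF S', THEN iffD1])
    show "integrable (lebesgue_on S) (\<lambda>x. (g x)\<^sup>2)" "(\<lambda>x. (g x)\<^sup>2) \<in> borel_measurable (lebesgue_on S)"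
      using g by (auto simp: L2_def)
    show "AE x in lborel. indicator S x *\<^sub>R (g x)\<^sup>2 = (g' x)\<^sup>2"
      using g'(2) by eventually_elim (auto simp: indicator_def split: if_splits)
  qed (use g' in auto)
  then have g'_L2: "g' \<in> L2 lborel"
    using g' by (simp add: L2_def)
  define G where "G = (\<integral>x. (g' x)\<^sup>2 \<partial>lborel)"
  have weak: "(\<integral>x. indicator S x * f x * frechet_derivative \<psi> (at x) b \<partial>lborel) = - (\<integral>x. g' x * \<psi> x \<partial>lborel)"
    if \<psi>: "\<psi> \<in> test_functions S" for \<psi>
  proof -
    have \<psi>_meas: "\<psi> \<in> borel_measurable borel" "(\<lambda>x. frechet_derivative \<psi> (at x) b) \<in> borel_measurable borel"
      using C_k_continuous[OF test_function_C_k[OF \<psi>]] test_function_partial_continuous[OF \<psi> b]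
      by (auto intro: borel_measurable_continuous_onI)
    have "(\<lambda>x. indicator S x * f x * frechet_derivative \<psi> (at x) b) \<in> borel_measurable borel"
      using borel_measurable_times[OF borel_measurable_continuous_on_indicator[OF S' cont] \<psi>_meas(2)] by simp
    moreover have "(\<lambda>x. f x * frechet_derivative \<psi> (at x) b) \<in> borel_measurable (lebesgue_on S)"
      by (intro borel_measurable_times continuous_on_borel_measurable_lebesgue_on[OF S' cont]
          borel_measurable_lebesgue_on \<psi>_meas)
    ultimately have "(\<integral>x. f x * frechet_derivative \<psi> (at x) b \<partial>lebesgue_on S) =
        (\<integral>x. indicator S x * f x * frechet_derivative \<psi> (at x) b \<partial>lborel)"
      by (intro integral_lebesgue_on_eq(1)[OF S']) auto
    moreover have "(\<integral>x. g x * \<psi> x \<partial>lebesgue_on S) = (\<integral>x. g' x * \<psi> x \<partial>lborel)"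
    proof (intro integral_lebesgue_on_eq(1)[OF S'] borel_measurable_times g_meas borel_measurable_lebesgue_on)
      show "AE x in lborel. indicator S x *\<^sub>R (g x * \<psi> x) = g' x * \<psi> x"
        using g'(2) by eventually_elim (auto simp: indicator_def split: if_splits)
    qed (use g' \<psi>_meas in auto)
    ultimately show ?thesis
      using g(2) \<psi> by (simp add: is_weak_partial_def)
  qed
  have "(\<integral>\<^sup>+z. indicator (segment_domain S b h) z * ennreal ((f (z + h *\<^sub>R b) - f z)\<^sup>2) \<partial>lborel)
      \<le> ennreal (G * h\<^sup>2)" if h: "0 < h" for h
  proof -
    have "(\<integral>\<^sup>+z. indicator (segment_domain S b h) z * ennreal ((f (z + h *\<^sub>R b) - f z)\<^sup>2) \<partial>lborel)
        \<le> ennreal (h\<^sup>2) * (\<integral>\<^sup>+w. ennreal ((g' w)\<^sup>2) \<partial>lborel)"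
      by (rule difference_quotient_bound[OF S cont g'(1) weak h]) (auto simp: segment_domain_def)
    also have "\<dots> = ennreal (G * h\<^sup>2)"
      unfolding L2_nn_integral[OF g'_L2] G_def[symmetric]
      by (subst ennreal_mult[symmetric]) (auto simp: G_def mult.commute)
    finally show ?thesis .
  qed
  moreover have "0 \<le> G"
    by (simp add: G_def)
  ultimately show ?thesis
    unfolding difference_quotients_bounded_def by blast
qed

lemma H1_of_difference_quotients_bounded:
  assumes S: "open S" "bounded S" and cont: "continuous_on S f" and B: "\<And>x. x \<in> S \<Longrightarrow> \<bar>f x\<bar> \<le> B"
    and dq: "\<And>b. b \<in> Basis \<Longrightarrow> difference_quotients_bounded S b f"
  shows "f \<in> H1 S"
proof -
  have S': "S \<in> sets borel"
    using S by simp
  define f0 where "f0 = (\<lambda>x. indicator S x *\<^sub>R f x)"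
  have f0_meas[measurable]: "f0 \<in> borel_measurable borel"
    unfolding f0_def by (rule borel_measurable_continuous_on_indicator[OF S' cont])
  have f_meas: "f \<in> borel_measurable (lebesgue_on S)"
    by (rule continuous_on_borel_measurable_lebesgue_on[OF S' cont])
  have fin: "emeasure lborel S < \<infinity>"
    using emeasure_bounded_finite[OF S(2)] by simp
  have int: "integrable lborel (\<lambda>x. (f0 x) ^ n)" if "0 < n" for n
  proof -
    have "integrable lborel (\<lambda>x. indicator S x *\<^sub>R (f0 x) ^ n)"
    proof (rule integrableI_bounded_set_indicator[OF _ _ fin])
      show "AE x in lborel. x \<in> S \<longrightarrow> norm (f0 x ^ n) \<le> B ^ n"
        using B by (auto simp: f0_def power_abs intro!: AE_I2 power_mono)
    qed (use S' in auto)
    also have "(\<lambda>x. indicator S x *\<^sub>R (f0 x) ^ n) = (\<lambda>x. (f0 x) ^ n)"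
      using that by (auto simp: f0_def indicator_def fun_eq_iff zero_power)
    finally show ?thesis .
  qed
  have f_L2: "f \<in> L2 (lebesgue_on S)"
    unfolding L2_def
  proof (intro CollectI conjI f_meas)
    show "integrable (lebesgue_on S) (\<lambda>x. (f x)\<^sup>2)"
    proof (rule integral_lebesgue_on_eq(2)[OF S', THEN iffD2])
      show "integrable lborel (\<lambda>x. (f0 x)\<^sup>2)"
        using int[of 2] by simp
      show "AE x in lborel. indicator S x *\<^sub>R (f x)\<^sup>2 = (f0 x)\<^sup>2"
        by (auto simp: f0_def indicator_def)
    qed (use f_meas in auto)
  qed
  have "\<exists>g\<in>L2 (lebesgue_on S). is_weak_partial S b f g" if b: "b \<in> Basis" for b
  proof -
    obtain C where C: "0 \<le> C" and dq_C: "\<And>h. 0 < h \<Longrightarrow>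
        (\<integral>\<^sup>+z. indicator (segment_domain S b h) z * ennreal ((f (z + h *\<^sub>R b) - f z)\<^sup>2) \<partial>lborel) \<le> ennreal (C * h\<^sup>2)"
      using dq[OF b] by (auto simp: difference_quotients_bounded_def)
    have "\<exists>\<delta>>0. \<forall>h. 0 < h \<and> h < \<delta> \<longrightarrow>
        (\<integral>\<^sup>+z. indicator K z * ennreal ((f0 (z + h *\<^sub>R b) - f0 z)\<^sup>2) \<partial>lborel) \<le> ennreal (C * h\<^sup>2)"
      if K: "compact K" "K \<subseteq> S" for K
    proof -
      obtain \<delta> where \<delta>: "0 < \<delta>" "(\<Union>x\<in>K. cball x \<delta>) \<subseteq> S"
        using compact_subset_open_imp_cball_epsilon_subset[OF K(1) S(1) K(2)] by blast
      have "(\<integral>\<^sup>+z. indicator K z * ennreal ((f0 (z + h *\<^sub>R b) - f0 z)\<^sup>2) \<partial>lborel) \<le> ennreal (C * h\<^sup>2)"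
        if h: "0 < h" "h < \<delta>" for h
      proof -
        have sub: "z \<in> segment_domain S b h" if "z \<in> K" for z
          unfolding segment_domain_def
        proof (intro CollectI ballI)
          fix s assume "s \<in> {0..h}"
          then have "z + s *\<^sub>R b \<in> cball z \<delta>"
            using h b by (auto simp: dist_norm)
          then show "z + s *\<^sub>R b \<in> S"
            using \<delta>(2) \<open>z \<in> K\<close> by blast
        qed
        have "(\<integral>\<^sup>+z. indicator K z * ennreal ((f0 (z + h *\<^sub>R b) - f0 z)\<^sup>2) \<partial>lborel) \<le>
            (\<integral>\<^sup>+z. indicator (segment_domain S b h) z * ennreal ((f (z + h *\<^sub>R b) - f z)\<^sup>2) \<partial>lborel)"
        proof (rule nn_integral_mono)
          fix z
          show "indicator K z * ennreal ((f0 (z + h *\<^sub>R b) - f0 z)\<^sup>2) \<le>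
              indicator (segment_domain S b h) z * ennreal ((f (z + h *\<^sub>R b) - f z)\<^sup>2)"
            using sub[of z] segment_domainD[of z S b h] h by (cases "z \<in> K") (auto simp: f0_def)
        qed
        also have "\<dots> \<le> ennreal (C * h\<^sup>2)"
          by (rule dq_C[OF h(1)])
        finally show ?thesis .
      qed
      then show ?thesis
        using \<delta>(1) by blast
    qed
    then obtain g where g: "g \<in> L2 lborel" and weak: "\<And>\<psi>. \<psi> \<in> test_functions S \<Longrightarrow>
        (\<integral>x. f0 x * frechet_derivative \<psi> (at x) b \<partial>lborel) = - (\<integral>x. g x * \<psi> x \<partial>lborel)"
      using weak_derivative_of_difference_quotients[OF _ b C, of f0 S] int[of 1] by auto
    have g_meas: "g \<in> borel_measurable borel"
      using g by (simp add: L2_def)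
    show ?thesis
    proof (intro bexI)
      show "g \<in> L2 (lebesgue_on S)"
        unfolding L2_def
      proof (intro CollectI conjI)
        have "integrable lborel (\<lambda>x. indicator S x *\<^sub>R (g x)\<^sup>2)"
          using g S' by (intro integrable_mult_indicator) (auto simp: L2_def)
        then show "integrable (lebesgue_on S) (\<lambda>x. (g x)\<^sup>2)"
          using g_meas S' by (subst integral_lebesgue_on_eq(2)[OF S', where k'="\<lambda>x. indicator S x *\<^sub>R (g x)\<^sup>2"])
            (auto intro!: borel_measurable_lebesgue_on)
      qed (use g_meas in \<open>auto intro: borel_measurable_lebesgue_on\<close>)
      show "is_weak_partial S b f g"
        unfolding is_weak_partial_def
      proof
        fix \<psi> assume \<psi>: "\<psi> \<in> test_functions S"
        have \<psi>_meas: "\<psi> \<in> borel_measurable borel" "(\<lambda>x. frechet_derivative \<psi> (at x) b) \<in> borel_measurable borel"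
          using C_k_continuous[OF test_function_C_k[OF \<psi>]] test_function_partial_continuous[OF \<psi> b]
          by (auto intro: borel_measurable_continuous_onI)
        have outside: "\<psi> x = 0" if "x \<notin> S" for x
          using \<psi> that closure_subset[of "{x. \<psi> x \<noteq> 0}"] by (auto simp: test_functions_def)
        have "(\<integral>x. f x * frechet_derivative \<psi> (at x) b \<partial>lebesgue_on S) =
            (\<integral>x. f0 x * frechet_derivative \<psi> (at x) b \<partial>lborel)"
          by (intro integral_lebesgue_on_eq(1)[OF S'] borel_measurable_times f_meas f0_meas
              borel_measurable_lebesgue_on \<psi>_meas) (auto simp: f0_def)
        moreover have "(\<integral>x. g x * \<psi> x \<partial>lebesgue_on S) = (\<integral>x. g x * \<psi> x \<partial>lborel)"
          using \<psi>_meas g_meas outside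
          by (intro integral_lebesgue_on_eq(1)[OF S'] borel_measurable_times borel_measurable_lebesgue_on)
            (auto simp: indicator_def)
        ultimately show "(\<integral>x. f x * frechet_derivative \<psi> (at x) b \<partial>lebesgue_on S) = - (\<integral>x. g x * \<psi> x \<partial>lebesgue_on S)"
          using weak[OF \<psi>] by simp
      qed
    qed
  qed
  then show ?thesis
    using f_L2 by (simp add: H1_def Lp_2_eq_L2)
qed

lemma H1_cong_AE:
  assumes f: "f \<in> H1 S" and f': "f' \<in> borel_measurable (lebesgue_on S)"
    and eq: "AE x in lebesgue_on S. f x = f' x"
  shows "f' \<in> H1 S"
proof -
  have f_meas: "f \<in> borel_measurable (lebesgue_on S)"
    using f by (simp add: H1_def Lp_def)
  have "integrable (lebesgue_on S) (\<lambda>x. (f x)\<^sup>2)"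
    using f by (simp add: H1_def Lp_2_eq_L2 L2_def)
  then have "f' \<in> L2 (lebesgue_on S)"
    unfolding L2_def using eq f' f_meas
    by (auto elim!: integrable_cong_AE_imp)
  moreover have "is_weak_partial S b f' g" if "is_weak_partial S b f g" "b \<in> Basis" for b g
    unfolding is_weak_partial_def
  proof
    fix \<psi> assume \<psi>: "\<psi> \<in> test_functions S"
    have "(\<lambda>x. frechet_derivative \<psi> (at x) b) \<in> borel_measurable (lebesgue_on S)"
      using test_function_partial_continuous[OF \<psi> \<open>b \<in> Basis\<close>]
      by (auto intro!: borel_measurable_lebesgue_on borel_measurable_continuous_onI)
    then have "(\<integral>x. f' x * frechet_derivative \<psi> (at x) b \<partial>lebesgue_on S) =
        (\<integral>x. f x * frechet_derivative \<psi> (at x) b \<partial>lebesgue_on S)"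
      using f' f_meas eq by (intro integral_cong_AE) auto
    then show "(\<integral>x. f' x * frechet_derivative \<psi> (at x) b \<partial>lebesgue_on S) = - (\<integral>x. g x * \<psi> x \<partial>lebesgue_on S)"
      using that \<psi> by (simp add: is_weak_partial_def)
  qed
  ultimately show ?thesis
    using f by (fastforce simp: H1_def Lp_2_eq_L2)
qed

section \<open>Null sets of cylinders and their time slices\<close>

lemma AE_lebesgue_on_iff:
  assumes "S \<in> sets borel"
  shows "(AE x in lebesgue_on S. P x) \<longleftrightarrow> (AE x in lborel. x \<in> S \<longrightarrow> P x)"
  using assms by (simp add: AE_restrict_space_iff AE_completion_iff)

lemma AE_cylinder_slices:
  fixes \<Omega> :: "'a::euclidean_space set" and J :: "real set"
  assumes \<Omega>: "\<Omega> \<in> sets borel" and J: "J \<in> sets borel"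
    and P: "AE z in lebesgue_on (\<Omega> \<times> J). P z"
  shows "AE t in lebesgue_on J. AE x in lebesgue_on \<Omega>. P (x, t)"
proof -
  have Q: "\<Omega> \<times> J \<in> sets borel"
    using \<Omega> J borel_Times by blast
  obtain N where N: "{z \<in> space lborel. \<not> (z \<in> \<Omega> \<times> J \<longrightarrow> P z)} \<subseteq> N" "emeasure lborel N = 0" "N \<in> sets lborel"
    using P unfolding AE_lebesgue_on_iff[OF Q] by (rule AE_E)
  have N'[measurable]: "N \<in> sets (lborel \<Otimes>\<^sub>M lborel)"
    using N(3) by (metis lborel_prod)
  have "AE z in lborel \<Otimes>\<^sub>M lborel. z \<notin> N"
    using N by (intro AE_not_in) (simp add: null_sets_def lborel_prod)
  then have "AE x in lborel. AE t in lborel. (x, t) \<notin> N"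
    by (rule lborel_pair.AE_pair)
  then have "AE t in lborel. AE x in lborel. (x, t) \<notin> N"
    by (subst (asm) lborel_pair.AE_commute) measurable
  then have "AE t in lborel. t \<in> J \<longrightarrow> (AE x in lborel. x \<in> \<Omega> \<longrightarrow> P (x, t))"
  proof (rule eventually_mono)
    fix t assume "AE x in lborel. (x, t) \<notin> N"
    then show "t \<in> J \<longrightarrow> (AE x in lborel. x \<in> \<Omega> \<longrightarrow> P (x, t))"
      using N(1) by (auto elim!: eventually_mono)
  qed
  then show ?thesis
    by (simp add: AE_lebesgue_on_iff \<Omega> J)
qed

text \<open>
  Measurability of the exceptional set cannot be dropped; a set with null slices may fail to be
  null otherwise.
\<close>
lemma AE_cylinder_of_slices:
  fixes \<Omega> :: "'a::euclidean_space set" and J :: "real set"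
  assumes \<Omega>: "\<Omega> \<in> sets borel" and J: "J \<in> sets borel"
    and meas: "{z \<in> \<Omega> \<times> J. \<not> P z} \<in> sets lebesgue"
    and P: "AE t in lebesgue_on J. AE x in lebesgue_on \<Omega>. P (x, t)"
  shows "AE z in lebesgue_on (\<Omega> \<times> J). P z"
proof -
  have Q: "\<Omega> \<times> J \<in> sets borel"
    using \<Omega> J borel_Times by blast
  obtain D N N' where D: "{z \<in> \<Omega> \<times> J. \<not> P z} = D \<union> N" "N \<subseteq> N'" "N' \<in> null_sets lborel" "D \<in> sets lborel"
    using meas by (rule sets_completionE)
  have D'[measurable]: "D \<in> sets (lborel \<Otimes>\<^sub>M lborel)"
    using D(4) by (metis lborel_prod)
  have "AE t in lborel. t \<in> J \<longrightarrow> (AE x in lborel. x \<in> \<Omega> \<longrightarrow> P (x, t))"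
    using P by (simp add: AE_lebesgue_on_iff \<Omega> J)
  then have "AE t in lborel. AE x in lborel. (x, t) \<notin> D"
  proof (rule eventually_mono)
    fix t assume t: "t \<in> J \<longrightarrow> (AE x in lborel. x \<in> \<Omega> \<longrightarrow> P (x, t))"
    show "AE x in lborel. (x, t) \<notin> D"
    proof (cases "t \<in> J")
      case True
      then have "AE x in lborel. x \<in> \<Omega> \<longrightarrow> P (x, t)"
        using t by blast
      then show ?thesis
        by (rule eventually_mono) (use D(1) in blast)
    next
      case False
      then show ?thesis
        using D(1) by (intro AE_I2) blast
    qed
  qed
  then have "AE x in lborel. AE t in lborel. (x, t) \<notin> D"
    by (subst lborel_pair.AE_commute) measurable
  then have "AE z in lborel \<Otimes>\<^sub>M lborel. z \<notin> D"
    by (rule lborel_pair.AE_pair_measure[rotated]) measurable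
  then have "AE z in lborel. z \<notin> D"
    unfolding lborel_prod .
  moreover have "AE z in lborel. z \<notin> N'"
    by (rule AE_not_in[OF D(3)])
  ultimately have "AE z in lborel. z \<in> \<Omega> \<times> J \<longrightarrow> P z"
    by eventually_elim (use D in blast)
  then show ?thesis
    by (simp only: AE_lebesgue_on_iff[OF Q])
qed

lemma AE_cylinder_of_AE_time:
  fixes \<Omega> :: "'a::euclidean_space set" and J :: "real set"
  assumes \<Omega>: "\<Omega> \<in> sets borel" and J: "J \<in> sets borel" and R: "AE t in lebesgue_on J. R t"
  shows "AE z in lebesgue_on (\<Omega> \<times> J). R (snd z)"
proof -
  obtain N where N: "{t \<in> space lborel. \<not> (t \<in> J \<longrightarrow> R t)} \<subseteq> N" "emeasure lborel N = 0" "N \<in> sets lborel"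
    using R unfolding AE_lebesgue_on_iff[OF J] by (rule AE_E)
  have "AE z in lebesgue_on (\<Omega> \<times> J). snd z \<notin> N"
  proof (rule AE_cylinder_of_slices[OF \<Omega> J])
    have "{z \<in> \<Omega> \<times> J. \<not> snd z \<notin> N} = \<Omega> \<times> (J \<inter> N)"
      by auto
    also have "\<dots> \<in> sets borel"
      using \<Omega> J N(3) by (intro borel_Times) auto
    finally show "{z \<in> \<Omega> \<times> J. \<not> snd z \<notin> N} \<in> sets lebesgue"
      by (intro sets_completionI_sets) simp
    have "AE t in lborel. t \<notin> N"
      using N by (intro AE_not_in) (simp add: null_sets_def)
    then show "AE t in lebesgue_on J. AE x in lebesgue_on \<Omega>. snd (x, t) \<notin> N"
      unfolding AE_lebesgue_on_iff[OF J] by (rule eventually_mono) simp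
  qed
  moreover have "AE z in lebesgue_on (\<Omega> \<times> J). z \<in> space (lebesgue_on (\<Omega> \<times> J))"
    by (rule AE_space)
  ultimately show ?thesis
    by eventually_elim (use N(1) in auto)
qed

lemma borel_measurable_lebesgue_on_AE:
  fixes f g :: "'a::euclidean_space \<Rightarrow> real"
  assumes S: "S \<in> sets borel" and f: "f \<in> borel_measurable (lebesgue_on S)"
    and eq: "AE x in lebesgue_on S. f x = g x"
  shows "g \<in> borel_measurable (lebesgue_on S)"
proof -
  have S': "S \<inter> space lebesgue \<in> sets lebesgue"
    using S by simp
  have "(\<lambda>x. indicator S x *\<^sub>R g x) \<in> borel_measurable lebesgue"
  proof (rule borel_measurable_AE)
    show "(\<lambda>x. indicator S x *\<^sub>R f x) \<in> borel_measurable lebesgue"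
      using f by (simp only: borel_measurable_restrict_space_iff[OF S'])
    have "AE x in lebesgue. x \<in> S \<longrightarrow> f x = g x"
      using eq by (simp only: AE_restrict_space_iff[OF S'])
    then show "AE x in lebesgue. indicator S x *\<^sub>R f x = indicator S x *\<^sub>R g x"
      by (rule eventually_mono) (auto simp: indicator_def)
  qed
  then show ?thesis
    by (simp only: borel_measurable_restrict_space_iff[OF S'])
qed

section \<open>Increments on space-time cylinders\<close>

lemma convex_real_between:
  assumes "convex J" "t \<in> J" "t + h \<in> J" "0 \<le> s" "s \<le> h"
  shows "t + s \<in> (J :: real set)"
  using assms by (meson convex_contains_open_segment connected_contains_Icc is_interval_convex_1 mem_is_interval_1_I le_add_same_cancel1 add_left_mono)

lemma square_integral_le_volume:
  assumes "\<Omega> \<in> sets borel" "emeasure lborel \<Omega> = ennreal V" "0 \<le> V"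
    and [measurable]: "f \<in> borel_measurable borel" and k: "\<And>x. x \<in> \<Omega> \<Longrightarrow> k x = \<bar>f x\<bar>"
  shows "ennreal ((\<integral>x. k x \<partial>lebesgue_on \<Omega>)\<^sup>2) \<le> ennreal V * (\<integral>\<^sup>+x. indicator \<Omega> x * ennreal ((f x)\<^sup>2) \<partial>lborel)"
proof -
  have [measurable]: "\<Omega> \<in> sets borel"
    by (rule assms)
  have "k \<in> borel_measurable (lebesgue_on \<Omega>)"
    by (rule measurable_cong[THEN iffD1, OF _ borel_measurable_lebesgue_on[of "\<lambda>x. \<bar>f x\<bar>"]])
      (use k in auto)
  then have "(\<integral>x. k x \<partial>lebesgue_on \<Omega>) = (\<integral>x. indicator \<Omega> x * (indicator \<Omega> x * \<bar>f x\<bar>) \<partial>lborel)"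
    using k by (intro integral_lebesgue_on_eq(1)) (auto simp: indicator_def)
  then have "ennreal ((\<integral>x. k x \<partial>lebesgue_on \<Omega>)\<^sup>2) \<le>
      (\<integral>\<^sup>+x. ennreal ((indicator \<Omega> x)\<^sup>2) \<partial>lborel) * (\<integral>\<^sup>+x. ennreal ((indicator \<Omega> x * \<bar>f x\<bar>)\<^sup>2) \<partial>lborel)"
    using integral_Cauchy_Schwarz[of "indicator \<Omega>" lborel "\<lambda>x. indicator \<Omega> x * \<bar>f x\<bar>"] by simp
  also have "(\<integral>\<^sup>+x. ennreal ((indicator \<Omega> x)\<^sup>2) \<partial>lborel) = (\<integral>\<^sup>+x. indicator \<Omega> x \<partial>lborel)"
    by (intro nn_integral_cong) (auto simp: indicator_def)
  also have "\<dots> = ennreal V"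
    using assms by simp
  also have "(\<integral>\<^sup>+x. ennreal ((indicator \<Omega> x * \<bar>f x\<bar>)\<^sup>2) \<partial>lborel) = (\<integral>\<^sup>+x. indicator \<Omega> x * ennreal ((f x)\<^sup>2) \<partial>lborel)"
    by (intro nn_integral_cong) (auto simp: indicator_def)
  finally show ?thesis .
qed

text \<open>
  By the Cauchy-Schwarz inequality on \<open>\<Omega>\<close>, \<open>\<bar>m(t + h) - m(t)\<bar>\<^sup>2\<close> is at most \<open>c\<^sup>2 \<bar>\<Omega>\<bar>\<close> times the integral of
  \<open>\<bar>\<phi>(t + h) - \<phi>(t)\<bar>\<^sup>2\<close> over the full section \<open>\<Omega>\<close>. Therefore the bound on the increments of \<open>\<phi>\<close> is needed
  up to the lateral boundary, which the segment domain of a cylinder in the time direction provides: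
  it is again a cylinder over \<open>\<Omega>\<close>.
\<close>
lemma time_difference_quotients_bounded:
  fixes \<Omega> :: "'a::euclidean_space set" and J :: "real set"
  assumes \<Omega>: "open \<Omega>" "bounded \<Omega>" and J: "open J" "convex J"
    and cont: "continuous_on (\<Omega> \<times> J) \<phi>"
    and dq: "difference_quotients_bounded (\<Omega> \<times> J) (0, 1) \<phi>"
    and m_meas: "(\<lambda>t. indicator J t * m t) \<in> borel_measurable borel" and c: "0 \<le> c"
    and m: "\<And>s t. s \<in> J \<Longrightarrow> t \<in> J \<Longrightarrow> \<bar>m t - m s\<bar> \<le> c * (\<integral>x. \<bar>\<phi> (x, t) - \<phi> (x, s)\<bar> \<partial>lebesgue_on \<Omega>)"
  shows "difference_quotients_bounded (\<Omega> \<times> J) (0, 1) (\<lambda>z. m (snd z))"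
proof -
  have \<Omega>'[measurable]: "\<Omega> \<in> sets borel" and J'[measurable]: "J \<in> sets borel" and Q: "\<Omega> \<times> J \<in> sets borel"
    using \<Omega> J by (auto intro: open_Times borel_open)
  have "emeasure lborel \<Omega> < \<infinity>"
    using emeasure_bounded_finite[OF \<Omega>(2)] by simp
  then obtain V where V: "emeasure lborel \<Omega> = ennreal V" "0 \<le> V"
    by (cases "emeasure lborel \<Omega>") auto
  define f where "f = (\<lambda>z. indicator (\<Omega> \<times> J) z *\<^sub>R \<phi> z)"
  have f[measurable]: "f \<in> borel_measurable (borel \<Otimes>\<^sub>M borel)"
    using borel_measurable_continuous_on_indicator[OF Q cont] by (simp add: f_def borel_prod)
  define m0 where "m0 = (\<lambda>t. indicator J t * m t)"
  have m0[measurable]: "m0 \<in> borel_measurable borel"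
    using m_meas by (simp add: m0_def)
  obtain C where C: "0 \<le> C" and dq_C: "\<And>h. 0 < h \<Longrightarrow>
      (\<integral>\<^sup>+z. indicator (segment_domain (\<Omega> \<times> J) (0, 1) h) z * ennreal ((\<phi> (z + h *\<^sub>R (0, 1)) - \<phi> z)\<^sup>2) \<partial>lborel)
        \<le> ennreal (C * h\<^sup>2)"
    using dq by (auto simp: difference_quotients_bounded_def)
  have "(\<integral>\<^sup>+z. indicator (segment_domain (\<Omega> \<times> J) (0, 1) h) z *
        ennreal ((m (snd (z + h *\<^sub>R (0, 1))) - m (snd z))\<^sup>2) \<partial>lborel) \<le> ennreal ((c\<^sup>2 * V\<^sup>2 * C) * h\<^sup>2)"
    if h: "0 < h" for h
  proof -
    define I where "I = {t. t \<in> J \<and> t + h \<in> J}"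
    have I[measurable]: "I \<in> sets borel"
      unfolding I_def by measurable
    have seg: "segment_domain (\<Omega> \<times> J) (0, 1) h = \<Omega> \<times> I"
    proof -
      have "t + s \<in> J" if "t \<in> J" "t + h \<in> J" "s \<in> {0..h}" for s t
        using convex_real_between[OF J(2) that(1,2)] that(3) by auto
      then show ?thesis
        using h by (fastforce simp: segment_domain_def I_def)
    qed
    define q where "q z = indicator \<Omega> (fst z) * (indicator I (snd z) * ennreal ((f (fst z, snd z + h) - f z)\<^sup>2))" for z
    have q_meas[measurable]: "q \<in> borel_measurable (lborel \<Otimes>\<^sub>M lborel)"
      unfolding q_def by measurable
    have "(\<integral>\<^sup>+z. q z \<partial>lborel) = (\<integral>\<^sup>+z. indicator (segment_domain (\<Omega> \<times> J) (0, 1) h) z *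
        ennreal ((\<phi> (z + h *\<^sub>R (0, 1)) - \<phi> z)\<^sup>2) \<partial>lborel)"
      by (intro nn_integral_cong) (auto simp: q_def seg f_def indicator_def I_def split: prod.splits)
    also have "\<dots> \<le> ennreal (C * h\<^sup>2)"
      by (rule dq_C[OF h])
    finally have q_le: "(\<integral>\<^sup>+t. (\<integral>\<^sup>+x. q (x, t) \<partial>lborel) \<partial>lborel) \<le> ennreal (C * h\<^sup>2)"
      unfolding lborel_pair.nn_integral_snd[OF q_meas] lborel_prod .
    have m_le: "indicator I t * ennreal ((m0 (t + h) - m0 t)\<^sup>2) \<le> ennreal (c\<^sup>2 * V) * (\<integral>\<^sup>+x. q (x, t) \<partial>lborel)" for t
    proof (cases "t \<in> I")
      case True
      then have t: "t \<in> J" "t + h \<in> J"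
        by (auto simp: I_def)
      have f_t: "(\<lambda>x. f (x, t + h) - f (x, t)) \<in> borel_measurable borel"
        by measurable
      let ?D = "\<integral>x. \<bar>\<phi> (x, t + h) - \<phi> (x, t)\<bar> \<partial>lebesgue_on \<Omega>"
      have "\<bar>m0 (t + h) - m0 t\<bar> \<le> c * ?D"
        using m[OF t] t by (simp add: m0_def)
      then have "\<bar>m0 (t + h) - m0 t\<bar>\<^sup>2 \<le> (c * ?D)\<^sup>2"
        by (intro power_mono) auto
      then have "ennreal ((m0 (t + h) - m0 t)\<^sup>2) \<le> ennreal (c\<^sup>2) * ennreal (?D\<^sup>2)"
        by (subst ennreal_mult[symmetric]) (auto simp: power_mult_distrib intro!: ennreal_leI)
      also have "\<dots> \<le> ennreal (c\<^sup>2) * (ennreal V * (\<integral>\<^sup>+x. indicator \<Omega> x * ennreal ((f (x, t + h) - f (x, t))\<^sup>2) \<partial>lborel))"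
        by (intro mult_left_mono square_integral_le_volume[OF \<Omega>' V f_t]) (use t in \<open>auto simp: f_def\<close>)
      also have "(\<integral>\<^sup>+x. indicator \<Omega> x * ennreal ((f (x, t + h) - f (x, t))\<^sup>2) \<partial>lborel) = (\<integral>\<^sup>+x. q (x, t) \<partial>lborel)"
        using True by (simp add: q_def)
      finally show ?thesis
        using True V by (simp add: ennreal_mult mult.assoc)
    qed simp
    have "(\<integral>\<^sup>+z. indicator (segment_domain (\<Omega> \<times> J) (0, 1) h) z *
        ennreal ((m (snd (z + h *\<^sub>R (0, 1))) - m (snd z))\<^sup>2) \<partial>lborel) =
        (\<integral>\<^sup>+z. indicator \<Omega> (fst z) * (indicator I (snd z) * ennreal ((m0 (snd z + h) - m0 (snd z))\<^sup>2)) \<partial>lborel)"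
      by (intro nn_integral_cong) (auto simp: seg m0_def indicator_def I_def split: prod.splits)
    also have "\<dots> = (\<integral>\<^sup>+t. (\<integral>\<^sup>+x. indicator \<Omega> x * (indicator I t * ennreal ((m0 (t + h) - m0 t)\<^sup>2)) \<partial>lborel) \<partial>lborel)"
    proof -
      have "(\<lambda>z. indicator \<Omega> (fst z) * (indicator I (snd z) * ennreal ((m0 (snd z + h) - m0 (snd z))\<^sup>2)))
          \<in> borel_measurable (lborel \<Otimes>\<^sub>M lborel)"
        by measurable
      from lborel_pair.nn_integral_snd[OF this] show ?thesis
        unfolding lborel_prod fst_conv snd_conv ..
    qed
    also have "\<dots> = (\<integral>\<^sup>+t. ennreal V * (indicator I t * ennreal ((m0 (t + h) - m0 t)\<^sup>2)) \<partial>lborel)"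
      using V by (intro nn_integral_cong) (simp add: nn_integral_multc)
    also have "\<dots> \<le> (\<integral>\<^sup>+t. ennreal V * (ennreal (c\<^sup>2 * V) * (\<integral>\<^sup>+x. q (x, t) \<partial>lborel)) \<partial>lborel)"
      by (intro nn_integral_mono mult_left_mono m_le) auto
    also have "\<dots> = ennreal V * (ennreal (c\<^sup>2 * V) * (\<integral>\<^sup>+t. (\<integral>\<^sup>+x. q (x, t) \<partial>lborel) \<partial>lborel))"
      by (simp add: nn_integral_cmult)
    also have "\<dots> \<le> ennreal V * (ennreal (c\<^sup>2 * V) * ennreal (C * h\<^sup>2))"
      by (intro mult_left_mono q_le) auto
    also have "\<dots> = ennreal (V * (c\<^sup>2 * V * (C * h\<^sup>2)))"
      using V C by (simp add: ennreal_mult)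
    also have "V * (c\<^sup>2 * V * (C * h\<^sup>2)) = (c\<^sup>2 * V\<^sup>2 * C) * h\<^sup>2"
      by (simp add: power2_eq_square)
    finally show ?thesis .
  qed
  then show ?thesis
    unfolding difference_quotients_bounded_def using C V by (intro exI[of _ "c\<^sup>2 * V\<^sup>2 * C"]) auto
qed

lemma difference_quotients_bounded_dominated:
  fixes f g w :: "'a::euclidean_space \<Rightarrow> real"
  assumes S: "open S" and f: "difference_quotients_bounded S b f" "continuous_on S f"
    and g: "difference_quotients_bounded S b g" "continuous_on S g"
    and A: "0 \<le> A"
    and w: "\<And>z z'. z \<in> S \<Longrightarrow> z' \<in> S \<Longrightarrow> \<bar>w z' - w z\<bar> \<le> A * (\<bar>f z' - f z\<bar> + \<bar>g z' - g z\<bar>)"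
  shows "difference_quotients_bounded S b w"
proof -
  let ?I = "\<lambda>f h. \<integral>\<^sup>+z. indicator (segment_domain S b h) z * ennreal ((f (z + h *\<^sub>R b) - f z)\<^sup>2) \<partial>lborel"
  obtain C where C: "0 \<le> C" "\<And>h. 0 < h \<Longrightarrow> ?I f h \<le> ennreal (C * h\<^sup>2)"
    using f by (auto simp: difference_quotients_bounded_def)
  obtain D where D: "0 \<le> D" "\<And>h. 0 < h \<Longrightarrow> ?I g h \<le> ennreal (D * h\<^sup>2)"
    using g by (auto simp: difference_quotients_bounded_def)
  have meas: "(\<lambda>z. indicator (segment_domain S b h) z * ennreal ((f (z + h *\<^sub>R b) - f z)\<^sup>2)) \<in> borel_measurable borel"
    if f: "continuous_on S f" and h: "0 < h" for f :: "'a \<Rightarrow> real" and h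
  proof -
    have [measurable]: "(\<lambda>z. indicator S z *\<^sub>R f z) \<in> borel_measurable borel"
      using S f by (intro borel_measurable_continuous_on_indicator) auto
    have [measurable]: "segment_domain S b h \<in> sets borel"
      using open_segment_domain[OF S] by simp
    have "(\<lambda>z. indicator (segment_domain S b h) z *
        ennreal ((indicator S (z + h *\<^sub>R b) *\<^sub>R f (z + h *\<^sub>R b) - indicator S z *\<^sub>R f z)\<^sup>2)) \<in> borel_measurable borel"
      by measurable
    also have "(\<lambda>z. indicator (segment_domain S b h) z *
        ennreal ((indicator S (z + h *\<^sub>R b) *\<^sub>R f (z + h *\<^sub>R b) - indicator S z *\<^sub>R f z)\<^sup>2)) =
        (\<lambda>z. indicator (segment_domain S b h) z * ennreal ((f (z + h *\<^sub>R b) - f z)\<^sup>2))"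
      using segment_domainD[of _ S b h] h by (force simp: indicator_def)
    finally show ?thesis .
  qed
  have "?I w h \<le> ennreal ((2 * A\<^sup>2 * (C + D)) * h\<^sup>2)" if h: "0 < h" for h
  proof -
    have "?I w h \<le> (\<integral>\<^sup>+z. ennreal (2 * A\<^sup>2) * (indicator (segment_domain S b h) z * ennreal ((f (z + h *\<^sub>R b) - f z)\<^sup>2)
        + indicator (segment_domain S b h) z * ennreal ((g (z + h *\<^sub>R b) - g z)\<^sup>2)) \<partial>lborel)"
    proof (rule nn_integral_mono)
      fix z
      show "indicator (segment_domain S b h) z * ennreal ((w (z + h *\<^sub>R b) - w z)\<^sup>2) \<le>
        ennreal (2 * A\<^sup>2) * (indicator (segment_domain S b h) z * ennreal ((f (z + h *\<^sub>R b) - f z)\<^sup>2)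
        + indicator (segment_domain S b h) z * ennreal ((g (z + h *\<^sub>R b) - g z)\<^sup>2))"
      proof (cases "z \<in> segment_domain S b h")
        case True
        define x y where "x = \<bar>f (z + h *\<^sub>R b) - f z\<bar>" and "y = \<bar>g (z + h *\<^sub>R b) - g z\<bar>"
        have "\<bar>w (z + h *\<^sub>R b) - w z\<bar> \<le> A * (x + y)"
          using w segment_domainD[OF True] h by (simp add: x_def y_def)
        then have "\<bar>w (z + h *\<^sub>R b) - w z\<bar>\<^sup>2 \<le> (A * (x + y))\<^sup>2"
          by (intro power_mono) auto
        also have "\<dots> \<le> A\<^sup>2 * (2 * x\<^sup>2 + 2 * y\<^sup>2)"
          unfolding power_mult_distrib using zero_le_power2[of "x - y"]
          by (intro mult_left_mono) (auto simp: power2_eq_square algebra_simps)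
        finally have "(w (z + h *\<^sub>R b) - w z)\<^sup>2 \<le> 2 * A\<^sup>2 * (x\<^sup>2 + y\<^sup>2)"
          by (simp add: algebra_simps)
        then have "ennreal ((w (z + h *\<^sub>R b) - w z)\<^sup>2) \<le> ennreal (2 * A\<^sup>2) * (ennreal (x\<^sup>2) + ennreal (y\<^sup>2))"
          by (subst ennreal_plus[symmetric], simp, simp, subst ennreal_mult[symmetric]) (auto intro: ennreal_leI)
        then show ?thesis
          using True by (simp add: x_def y_def)
      qed simp
    qed
    also have "\<dots> = ennreal (2 * A\<^sup>2) * (?I f h + ?I g h)"
      using meas[OF f(2) h] meas[OF g(2) h] by (simp add: nn_integral_cmult nn_integral_add)
    also have "\<dots> \<le> ennreal (2 * A\<^sup>2) * (ennreal (C * h\<^sup>2) + ennreal (D * h\<^sup>2))"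
      by (intro mult_left_mono add_mono C D h) auto
    also have "\<dots> = ennreal ((2 * A\<^sup>2 * (C + D)) * h\<^sup>2)"
      using C D by (simp add: ennreal_plus[symmetric] ennreal_mult[symmetric] algebra_simps del: ennreal_plus)
    finally show ?thesis .
  qed
  then show ?thesis
    unfolding difference_quotients_bounded_def using A C D by (intro exI[of _ "2 * A\<^sup>2 * (C + D)"]) auto
qed

text \<open>
  Only increments in time see the function \<open>m\<close>; those in space are dominated by \<open>\<phi>\<close> alone.
\<close>
lemma H1_cylinder_dominated:
  fixes \<Omega> :: "'a::euclidean_space set" and J :: "real set"
  assumes \<Omega>: "open \<Omega>" "bounded \<Omega>" and J: "open J" "bounded J" "convex J"
    and \<phi>: "continuous_on (\<Omega> \<times> J) \<phi>" "\<phi> \<in> H1 (\<Omega> \<times> J)"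
    and m_cont: "continuous_on J m" and c: "0 \<le> c"
    and m: "\<And>s t. s \<in> J \<Longrightarrow> t \<in> J \<Longrightarrow> \<bar>m t - m s\<bar> \<le> c * (\<integral>x. \<bar>\<phi> (x, t) - \<phi> (x, s)\<bar> \<partial>lebesgue_on \<Omega>)"
    and w: "continuous_on (\<Omega> \<times> J) w" "\<And>z. z \<in> \<Omega> \<times> J \<Longrightarrow> \<bar>w z\<bar> \<le> B" and A: "0 \<le> A"
    and dom: "\<And>z z'. z \<in> \<Omega> \<times> J \<Longrightarrow> z' \<in> \<Omega> \<times> J \<Longrightarrow>
      \<bar>w z' - w z\<bar> \<le> A * (\<bar>\<phi> z' - \<phi> z\<bar> + \<bar>m (snd z') - m (snd z)\<bar>)"
  shows "w \<in> H1 (\<Omega> \<times> J)"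
proof (rule H1_of_difference_quotients_bounded)
  show open_Q: "open (\<Omega> \<times> J)" and "bounded (\<Omega> \<times> J)"
    using \<Omega> J by (auto intro: open_Times bounded_Times)
  fix b :: "'a \<times> real" assume b: "b \<in> Basis"
  have dq: "difference_quotients_bounded (\<Omega> \<times> J) b \<phi>"
    by (rule difference_quotients_bounded_of_H1[OF open_Q \<phi> b])
  have "difference_quotients_bounded (\<Omega> \<times> J) b (\<lambda>z. m (snd z))"
  proof (cases "snd b = 0")
    case True
    then show ?thesis
      unfolding difference_quotients_bounded_def by (intro exI[of _ 0]) auto
  next
    case False
    then have b_time: "b = (0, 1)"
      using b by (auto simp: Basis_prod_def)
    have "(\<lambda>t. indicator J t * m t) \<in> borel_measurable borel"
      using borel_measurable_continuous_on_indicator[of J m] J(1) m_cont by simp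
    then show ?thesis
      using time_difference_quotients_bounded[OF \<Omega> J(1,3) \<phi>(1) _ _ c m] dq
      unfolding b_time by blast
  qed
  moreover have "continuous_on (\<Omega> \<times> J) (\<lambda>z. m (snd z))"
    by (intro continuous_on_compose2[OF m_cont] continuous_intros) auto
  ultimately show "difference_quotients_bounded (\<Omega> \<times> J) b w"
    using difference_quotients_bounded_dominated[OF open_Q dq \<phi>(1) _ _ A dom] by blast
qed (use w in auto)

section \<open>Soft thresholding and threshold levels\<close>

definition soft_threshold :: "real \<Rightarrow> real \<Rightarrow> real" where
  "soft_threshold m s = sgn s * max (\<bar>s\<bar> - m) 0"

text \<open>
  In this form, which is the second one in the theorem, soft thresholding is clearly continuous and
  piecewise linear in both variables.
\<close>
lemma soft_threshold_eq: "0 \<le> m \<Longrightarrow> soft_threshold m s = min (s + m) 0 + max (s - m) 0"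
  by (auto simp: soft_threshold_def sgn_if min_def max_def)

lemma soft_threshold_lipschitz:
  assumes "0 \<le> m" "0 \<le> m'"
  shows "\<bar>soft_threshold m s - soft_threshold m' s'\<bar> \<le> \<bar>s - s'\<bar> + \<bar>m - m'\<bar>"
  unfolding soft_threshold_eq[OF assms(1)] soft_threshold_eq[OF assms(2)]
  using assms by linarith

lemma soft_threshold_residual_lipschitz:
  assumes "0 \<le> m" "0 \<le> m'"
  shows "\<bar>(s - soft_threshold m s) - (s' - soft_threshold m' s')\<bar> \<le> \<bar>s - s'\<bar> + \<bar>m - m'\<bar>"
  unfolding soft_threshold_eq[OF assms(1)] soft_threshold_eq[OF assms(2)]
  using assms by linarith

lemma abs_soft_threshold: "\<bar>soft_threshold m s\<bar> = (if s = 0 then 0 else max (\<bar>s\<bar> - m) 0)"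
  by (auto simp: soft_threshold_def abs_mult sgn_if)

text \<open>
  The optimality conditions for \<open>m\<close> as the multiplier in the \<open>L\<^sup>2\<close> projection of \<open>p\<close> onto the ball of
  radius \<open>\<sigma>\<close> in \<open>L\<^sup>1\<close>; the projection is the soft thresholding of \<open>p\<close> at level \<open>m\<close>.
\<close>
definition is_threshold :: "'a measure \<Rightarrow> real \<Rightarrow> ('a \<Rightarrow> real) \<Rightarrow> real \<Rightarrow> bool" where
  "is_threshold M \<sigma> p m \<longleftrightarrow> 0 \<le> m \<and> (\<integral>x. max (\<bar>p x\<bar> - m) 0 \<partial>M) \<le> \<sigma> \<and>
     (0 < m \<longrightarrow> (\<integral>x. max (\<bar>p x\<bar> - m) 0 \<partial>M) = \<sigma>)"

text \<open>
  The excess mass \<open>\<integral> (\<bar>p\<bar> - m)\<^sup>+\<close> is Lipschitz continuous in \<open>m\<close> and vanishes at the bound of \<open>\<bar>p\<bar>\<close>. So either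
  \<open>m = 0\<close> is admissible or the intermediate value theorem yields equality.
\<close>
lemma (in finite_measure) threshold_exists:
  assumes p[measurable]: "p \<in> borel_measurable M" and B: "\<And>x. x \<in> space M \<Longrightarrow> \<bar>p x\<bar> \<le> B" and \<sigma>: "0 \<le> \<sigma>"
  obtains m where "is_threshold M \<sigma> p m"
proof -
  define G where "G m = (\<integral>x. max (\<bar>p x\<bar> - m) 0 \<partial>M)" for m
  have int: "integrable M (\<lambda>x. max (\<bar>p x\<bar> - m) 0)" for m
  proof (rule integrable_const_bound)
    show "AE x in M. norm (max (\<bar>p x\<bar> - m) 0) \<le> \<bar>B\<bar> + \<bar>m\<bar>"
    proof (intro AE_I2)
      fix x assume "x \<in> space M"
      from B[OF this] show "norm (max (\<bar>p x\<bar> - m) 0) \<le> \<bar>B\<bar> + \<bar>m\<bar>"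
        unfolding real_norm_def by linarith
    qed
  qed auto
  have lip: "\<bar>G m - G m'\<bar> \<le> measure M (space M) * \<bar>m - m'\<bar>" for m m'
  proof -
    have "G m - G m' = (\<integral>x. max (\<bar>p x\<bar> - m) 0 - max (\<bar>p x\<bar> - m') 0 \<partial>M)"
      unfolding G_def using int by simp
    also have "\<bar>\<dots>\<bar> \<le> (\<integral>x. \<bar>max (\<bar>p x\<bar> - m) 0 - max (\<bar>p x\<bar> - m') 0\<bar> \<partial>M)"
      by (rule integral_abs_bound)
    also have "\<dots> \<le> (\<integral>x. \<bar>m - m'\<bar> \<partial>M)"
      using int by (intro integral_mono) (auto simp: max_def)
    finally show ?thesis
      by simp
  qed
  have cont: "continuous_on {0..max B 0} G"
  proof (rule lipschitz_on_continuous_on)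
    show "(measure M (space M))-lipschitz_on {0..max B 0} G"
      using lip by (intro lipschitz_onI) (auto simp: dist_real_def)
  qed
  show ?thesis
  proof (cases "G 0 \<le> \<sigma>")
    case True
    then show ?thesis
      using that[of 0] by (simp add: is_threshold_def G_def)
  next
    case False
    have "G (max B 0) = (\<integral>x. 0 \<partial>M)"
      unfolding G_def using B by (intro Bochner_Integration.integral_cong) (auto simp: max_def, fastforce+)
    then have "\<exists>m\<ge>0. m \<le> max B 0 \<and> G m = \<sigma>"
      by (intro IVT2'[OF _ _ _ cont]) (use False \<sigma> in auto)
    then obtain m where "0 \<le> m" "G m = \<sigma>"
      by blast
    then show ?thesis
      using that[of m] by (simp add: is_threshold_def G_def)
  qed
qed

text \<open>
  Lowering the level of \<open>p\<close> from \<open>m\<close> to \<open>m'\<close> increases the excess by the full amount \<open>m - m'\<close> wherever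
  \<open>\<bar>p\<bar> > m\<close>, hence at least by \<open>(m - m') (\<bar>p\<bar> - m)\<^sup>+ / B\<close> everywhere, and the integral of
  \<open>(\<bar>p\<bar> - m)\<^sup>+\<close> is \<open>\<sigma>\<close>. At level \<open>m'\<close> the excess of \<open>q\<close> is at most \<open>\<sigma>\<close>, so the increase is accounted for by
  the distance of \<open>p\<close> and \<open>q\<close>.
\<close>
lemma threshold_diff_le:
  assumes p: "integrable M p" "\<And>x. x \<in> space M \<Longrightarrow> \<bar>p x\<bar> \<le> B" and q: "integrable M q"
    and fin: "finite_measure M"
    and m: "is_threshold M \<sigma> p m" "is_threshold M \<sigma> q m'" and less: "m' < m" and B: "0 < B"
  shows "\<sigma> * (m - m') \<le> B * (\<integral>x. \<bar>p x - q x\<bar> \<partial>M)"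
proof -
  interpret finite_measure M by (rule fin)
  have int: "integrable M (\<lambda>x. max (\<bar>f x\<bar> - c) 0)" if "integrable M f" for f :: "'a \<Rightarrow> real" and c
    using that by (intro integrable_max Bochner_Integration.integrable_diff integrable_abs) auto
  let ?P = "\<lambda>c. \<integral>x. max (\<bar>p x\<bar> - c) 0 \<partial>M"
  have "0 < m"
    using m less by (auto simp: is_threshold_def)
  then have \<sigma>: "?P m = \<sigma>"
    using m by (auto simp: is_threshold_def)
  have "(m - m') * ?P m = (\<integral>x. (m - m') * max (\<bar>p x\<bar> - m) 0 \<partial>M)"
    by simp
  also have "\<dots> \<le> (\<integral>x. B * (max (\<bar>p x\<bar> - m') 0 - max (\<bar>p x\<bar> - m) 0) \<partial>M)"
  proof (rule integral_mono)
    fix x assume "x \<in> space M"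
    show "(m - m') * max (\<bar>p x\<bar> - m) 0 \<le> B * (max (\<bar>p x\<bar> - m') 0 - max (\<bar>p x\<bar> - m) 0)"
    proof (cases "m \<le> \<bar>p x\<bar>")
      case True
      have "(m - m') * (\<bar>p x\<bar> - m) \<le> (m - m') * B"
        using less p(2)[OF \<open>x \<in> space M\<close>] \<open>0 < m\<close> by (intro mult_left_mono) auto
      then show ?thesis
        using True less by (simp add: mult.commute)
    qed (use less B in \<open>auto simp: max_def\<close>)
  qed (use int[OF p(1)] in auto)
  also have "\<dots> = B * (?P m' - \<sigma>)"
    using int[OF p(1)] \<sigma> by simp
  also have "\<dots> \<le> B * (\<integral>x. \<bar>p x - q x\<bar> \<partial>M)"
  proof (intro mult_left_mono)
    have "?P m' - \<sigma> \<le> ?P m' - (\<integral>x. max (\<bar>q x\<bar> - m') 0 \<partial>M)"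
      using m by (simp add: is_threshold_def)
    also have "\<dots> = (\<integral>x. max (\<bar>p x\<bar> - m') 0 - max (\<bar>q x\<bar> - m') 0 \<partial>M)"
      using int[OF p(1)] int[OF q] by simp
    also have "\<dots> \<le> (\<integral>x. \<bar>p x - q x\<bar> \<partial>M)"
    proof (rule integral_mono)
      show "integrable M (\<lambda>x. max (\<bar>p x\<bar> - m') 0 - max (\<bar>q x\<bar> - m') 0)" "integrable M (\<lambda>x. \<bar>p x - q x\<bar>)"
        using int[OF p(1)] int[OF q] p(1) q by auto
      show "max (\<bar>p x\<bar> - m') 0 - max (\<bar>q x\<bar> - m') 0 \<le> \<bar>p x - q x\<bar>" for x
        by linarith
    qed
    finally show "?P m' - \<sigma> \<le> (\<integral>x. \<bar>p x - q x\<bar> \<partial>M)" .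
  qed (use B in auto)
  finally show ?thesis
    by (simp add: \<sigma> mult.commute)
qed

lemma threshold_lipschitz:
  assumes p: "integrable M p" "\<And>x. x \<in> space M \<Longrightarrow> \<bar>p x\<bar> \<le> B"
    and q: "integrable M q" "\<And>x. x \<in> space M \<Longrightarrow> \<bar>q x\<bar> \<le> B"
    and "finite_measure M"
    and m: "is_threshold M \<sigma> p m" "is_threshold M \<sigma> q m'" and "0 < B"
  shows "\<sigma> * \<bar>m - m'\<bar> \<le> B * (\<integral>x. \<bar>p x - q x\<bar> \<partial>M)"
proof (cases m m' rule: linorder_cases)
  case less
  then show ?thesis
    using threshold_diff_le[OF q p(1) assms(5) m(2) m(1)] \<open>0 < B\<close>
    by (simp add: abs_minus_commute)
next
  case equal
  then show ?thesis
    using \<open>0 < B\<close> by simp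
next
  case greater
  then show ?thesis
    using threshold_diff_le[OF p q(1) assms(5) m] \<open>0 < B\<close> by simp
qed

text \<open>
  Uniform continuity of \<open>\<phi>\<close> makes the map from \<open>t\<close> to \<open>\<phi>(t)\<close> continuous into \<open>L\<^sup>1(\<Omega>)\<close>, and the Lipschitz
  estimate for threshold levels carries this over to the levels. With the same slice twice, that
  estimate shows uniqueness.
\<close>
lemma threshold_family:
  fixes \<Omega> :: "'a::euclidean_space set" and J :: "real set"
  assumes \<Omega>: "open \<Omega>" "bounded \<Omega>" and J: "open J" "bounded J"
    and cont: "continuous_on (closure (\<Omega> \<times> J)) \<phi>" and \<sigma>: "0 < \<sigma>"
  obtains m c where "\<And>t. t \<in> J \<Longrightarrow> is_threshold (lebesgue_on \<Omega>) \<sigma> (\<lambda>x. \<phi> (x, t)) (m t)"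
    and "0 \<le> c" and "\<And>s t. s \<in> J \<Longrightarrow> t \<in> J \<Longrightarrow>
      \<bar>m t - m s\<bar> \<le> c * (\<integral>x. \<bar>\<phi> (x, t) - \<phi> (x, s)\<bar> \<partial>lebesgue_on \<Omega>)"
    and "continuous_on J m"
    and "\<And>t n. t \<in> J \<Longrightarrow> is_threshold (lebesgue_on \<Omega>) \<sigma> (\<lambda>x. \<phi> (x, t)) n \<Longrightarrow> n = m t"
proof -
  define M where "M = lebesgue_on \<Omega>"
  have \<Omega>': "\<Omega> \<in> sets borel"
    using \<Omega> by simp
  have "finite_measure M"
    unfolding M_def using \<Omega> by (intro finite_measure_lebesgue_on lmeasurable_open)
  then interpret finite_measure M .
  have space[simp]: "space M = \<Omega>"
    by (simp add: M_def)
  have compact: "compact (closure (\<Omega> \<times> J))"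
    using \<Omega> J by (simp add: bounded_Times compact_closure)
  have sub: "\<Omega> \<times> J \<subseteq> closure (\<Omega> \<times> J)"
    by (rule closure_subset)
  have "bounded (\<phi> ` closure (\<Omega> \<times> J))"
    by (intro compact_imp_bounded compact_continuous_image cont compact)
  then obtain B where B: "0 < B" "\<And>z. z \<in> closure (\<Omega> \<times> J) \<Longrightarrow> \<bar>\<phi> z\<bar> \<le> B"
    by (auto simp: bounded_pos)
  have B': "\<bar>\<phi> (x, t)\<bar> \<le> B" if "x \<in> space M" "t \<in> J" for x t
    using B(2)[of "(x, t)"] sub that by auto
  have meas: "(\<lambda>x. \<phi> (x, t)) \<in> borel_measurable M" if "t \<in> J" for t
    unfolding M_def using that sub
    by (intro continuous_on_borel_measurable_lebesgue_on[OF \<Omega>'] continuous_on_compose2[OF cont] continuous_intros) auto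
  have int: "integrable M (\<lambda>x. \<phi> (x, t))" if "t \<in> J" for t
    by (rule integrable_const_bound[of _ B]) (use B'[OF _ that] meas[OF that] in \<open>auto intro!: AE_I2\<close>)
  define m where "m t = (SOME n. is_threshold M \<sigma> (\<lambda>x. \<phi> (x, t)) n)" for t
  have thr: "is_threshold M \<sigma> (\<lambda>x. \<phi> (x, t)) (m t)" if t: "t \<in> J" for t
  proof -
    obtain n where "is_threshold M \<sigma> (\<lambda>x. \<phi> (x, t)) n"
      using threshold_exists[of "\<lambda>x. \<phi> (x, t)" B \<sigma>] meas[OF t] B'[OF _ t] \<sigma> less_imp_le by blast
    then show ?thesis
      unfolding m_def by (rule someI)
  qed
  have lip: "\<bar>n - n'\<bar> \<le> B / \<sigma> * (\<integral>x. \<bar>\<phi> (x, t) - \<phi> (x, s)\<bar> \<partial>M)"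
    if "s \<in> J" "t \<in> J" "is_threshold M \<sigma> (\<lambda>x. \<phi> (x, t)) n" "is_threshold M \<sigma> (\<lambda>x. \<phi> (x, s)) n'" for s t n n'
  proof -
    have "\<sigma> * \<bar>n - n'\<bar> \<le> B * (\<integral>x. \<bar>\<phi> (x, t) - \<phi> (x, s)\<bar> \<partial>M)"
      using that B' \<open>0 < B\<close> \<open>finite_measure M\<close> by (intro threshold_lipschitz int) auto
    then show ?thesis
      using \<sigma> by (simp add: field_simps)
  qed
  have "continuous_on J m"
    unfolding continuous_on_iff
  proof (intro ballI allI impI)
    fix t and e :: real assume t: "t \<in> J" and e: "0 < e"
    define V where "V = measure M (space M)"
    \<comment> \<open>the summand \<open>1\<close> guards against a vanishing volume\<close>
    define \<delta> where "\<delta> = e / (B / \<sigma> * V + 1)"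
    have V: "0 \<le> V"
      by (simp add: V_def)
    have pos: "0 < B / \<sigma> * V + 1"
      using B(1) \<sigma> V by (simp add: add_nonneg_pos)
    have \<delta>: "0 < \<delta>"
      using e pos by (simp add: \<delta>_def)
    have "uniformly_continuous_on (closure (\<Omega> \<times> J)) \<phi>"
      by (rule compact_uniformly_continuous[OF cont compact])
    then obtain d where d: "0 < d" "\<And>z z'. z \<in> closure (\<Omega> \<times> J) \<Longrightarrow> z' \<in> closure (\<Omega> \<times> J) \<Longrightarrow>
        dist z' z < d \<Longrightarrow> dist (\<phi> z') (\<phi> z) < \<delta>"
      unfolding uniformly_continuous_on_def using \<delta> by metis
    show "\<exists>d>0. \<forall>s\<in>J. dist s t < d \<longrightarrow> dist (m s) (m t) < e"
    proof (intro exI[of _ d] conjI ballI impI d(1))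
      fix s assume s: "s \<in> J" "dist s t < d"
      have "(\<integral>x. \<bar>\<phi> (x, s) - \<phi> (x, t)\<bar> \<partial>M) \<le> (\<integral>x. \<delta> \<partial>M)"
      proof (rule integral_mono)
        fix x assume "x \<in> space M"
        then have "(x, s) \<in> closure (\<Omega> \<times> J)" "(x, t) \<in> closure (\<Omega> \<times> J)"
          using sub s(1) t by auto
        moreover have "dist (x, s) (x, t) < d"
          using s(2) by (simp add: dist_Pair_Pair)
        ultimately show "\<bar>\<phi> (x, s) - \<phi> (x, t)\<bar> \<le> \<delta>"
          using d(2)[of "(x, t)" "(x, s)"] by (simp add: dist_real_def)
      qed (use int[OF s(1)] int[OF t] in auto)
      then have "(\<integral>x. \<bar>\<phi> (x, s) - \<phi> (x, t)\<bar> \<partial>M) \<le> V * \<delta>"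
        by (simp add: V_def)
      then have "B / \<sigma> * (\<integral>x. \<bar>\<phi> (x, s) - \<phi> (x, t)\<bar> \<partial>M) \<le> B / \<sigma> * (V * \<delta>)"
        using B(1) \<sigma> by (intro mult_left_mono) auto
      also have "\<dots> < (B / \<sigma> * V + 1) * \<delta>"
        using \<delta> by (simp add: algebra_simps)
      also have "\<dots> = e"
        using pos by (simp add: \<delta>_def)
      finally show "dist (m s) (m t) < e"
        using lip[OF t s(1) thr[OF s(1)] thr[OF t]] by (simp add: dist_real_def)
    qed
  qed
  moreover have "n = m t" if "t \<in> J" "is_threshold M \<sigma> (\<lambda>x. \<phi> (x, t)) n" for t n
    using lip[OF that(1) that(1) that(2) thr[OF that(1)]] by simp
  ultimately show ?thesis
    using that[of m "B / \<sigma>"] lip thr B(1) \<sigma> unfolding M_def by fastforce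
qed

section \<open>The optimality conditions\<close>

text \<open>
  The norm is a conversion of the essential supremum to a real number, which is faithful only if that
  supremum is finite: the bound excludes \<open>\<infinity>\<close>, and a space of positive measure excludes \<open>- \<infinity>\<close>.
\<close>
lemma Lp_norm_infinity:
  assumes f[measurable]: "f \<in> borel_measurable M" and bound: "AE x in M. \<bar>f x\<bar> \<le> C"
    and M: "emeasure M (space M) \<noteq> 0"
  shows "0 \<le> Lp_norm \<infinity> M f" "AE x in M. \<bar>f x\<bar> \<le> Lp_norm \<infinity> M f"
proof -
  let ?e = "esssup M (\<lambda>x. ereal \<bar>f x\<bar>)"
  have "?e \<le> ereal C"
    using bound by (intro esssup_I) auto
  moreover have "0 \<le> ?e"
  proof -
    have "esssup M (\<lambda>x. 0 :: ereal) \<le> ?e"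
      by (intro esssup_mono) auto
    then show ?thesis
      using esssup_const[OF M, of "0::ereal"] by simp
  qed
  ultimately obtain c where c: "?e = ereal c" "0 \<le> c"
    by (cases ?e) auto
  then have "Lp_norm \<infinity> M f = c"
    by (simp add: Lp_norm_def)
  moreover have "AE x in M. ereal \<bar>f x\<bar> \<le> ?e"
    by (rule esssup_AE)
  ultimately show "0 \<le> Lp_norm \<infinity> M f" "AE x in M. \<bar>f x\<bar> \<le> Lp_norm \<infinity> M f"
    using c by auto
qed

lemma Lp_norm_1: "Lp_norm 1 M f = (\<integral>x. \<bar>f x\<bar> \<partial>M)"
proof -
  have "0 \<le> (\<integral>x. \<bar>f x\<bar> \<partial>M)"
    by (rule integral_nonneg_AE) auto
  then show ?thesis
    by (simp add: Lp_norm_def)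
qed

text \<open>
  If the constraint is inactive then \<open>\<mu> = 0\<close> and \<open>m = 0\<close>; so \<open>\<bar>\<mu>\<bar> = m\<close> on the support of \<open>u\<close> in all cases, and
  \<open>m > 0\<close> entails an active constraint. The rest is a case distinction on the sign of \<open>u\<close> at a point.
\<close>
lemma time_slice_threshold:
  fixes u \<phi> \<mu> :: "'a \<Rightarrow> real" and M :: "'a measure"
  defines "m \<equiv> Lp_norm \<infinity> M \<mu>"
  assumes M: "emeasure M (space M) \<noteq> 0" and \<mu>: "\<mu> \<in> borel_measurable M" "AE x in M. \<bar>\<mu> x\<bar> \<le> C"
    and \<kappa>: "0 < \<kappa>"
    and eq: "AE x in M. \<phi> x + \<kappa> * u x + \<mu> x = 0"
    and sign: "AE x in M. u x * \<mu> x = \<bar>u x\<bar> * \<bar>\<mu> x\<bar>"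
    and le: "Lp_norm 1 M u \<le> \<gamma>"
    and inactive: "Lp_norm 1 M u < \<gamma> \<Longrightarrow> AE x in M. \<mu> x = 0"
    and active: "Lp_norm 1 M u = \<gamma> \<Longrightarrow> \<not> (AE x in M. \<mu> x = 0) \<Longrightarrow>
      AE x in M. u x \<noteq> 0 \<longrightarrow> \<bar>\<mu> x\<bar> = m"
    and meas: "u \<in> borel_measurable M" "\<phi> \<in> borel_measurable M"
  shows "AE x in M. u x = - (1 / \<kappa>) * soft_threshold m (\<phi> x)" "is_threshold M (\<kappa> * \<gamma>) \<phi> m"
proof -
  have m_nonneg: "0 \<le> m" and m_bound: "AE x in M. \<bar>\<mu> x\<bar> \<le> m"
    unfolding m_def using Lp_norm_infinity[OF \<mu> M] by auto
  have m_pos: "Lp_norm 1 M u = \<gamma>" if "0 < m"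
  proof (rule ccontr)
    assume "Lp_norm 1 M u \<noteq> \<gamma>"
    then have zero: "AE x in M. \<mu> x = 0"
      using inactive le by simp
    have "m = real_of_ereal (esssup M (\<lambda>x. 0))"
      unfolding m_def Lp_norm_def using zero \<mu>(1)
      by (simp, intro arg_cong[where f=real_of_ereal] esssup_AE_cong) auto
    then show False
      using that M by (simp add: esssup_const)
  qed
  have support: "AE x in M. u x \<noteq> 0 \<longrightarrow> \<bar>\<mu> x\<bar> = m"
  proof (cases "AE x in M. \<mu> x = 0")
    case True
    then have "m = real_of_ereal (esssup M (\<lambda>x. 0))"
      unfolding m_def Lp_norm_def using \<mu>(1)
      by (simp, intro arg_cong[where f=real_of_ereal] esssup_AE_cong) auto
    then have "m = 0"
      using M by (simp add: esssup_const)
    then show ?thesis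
      using True by auto
  next
    case False
    then show ?thesis
      using active inactive le by fastforce
  qed
  show *: "AE x in M. u x = - (1 / \<kappa>) * soft_threshold m (\<phi> x)"
    using eq sign m_bound support
  proof eventually_elim
    case (elim x)
    then have \<phi>: "\<phi> x = - (\<kappa> * u x + \<mu> x)"
      by simp
    show ?case
    proof (cases "u x = 0")
      case True
      then show ?thesis
        using \<phi> elim by (simp add: soft_threshold_def)
    next
      case False
      then have "\<bar>\<mu> x\<bar> = m"
        using elim by simp
      consider "0 < u x" "\<mu> x = m" | "u x < 0" "\<mu> x = - m"
      proof (cases "0 < u x")
        case True
        then have "u x * \<mu> x = u x * \<bar>\<mu> x\<bar>"
          using elim(2) by simp
        then show ?thesis
          using True \<open>\<bar>\<mu> x\<bar> = m\<close> that(1) by simp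
      next
        case neg: False
        then have "u x * \<mu> x = u x * (- \<bar>\<mu> x\<bar>)"
          using elim(2) by simp
        then have "\<mu> x = - \<bar>\<mu> x\<bar>"
          using False by (simp only: mult_cancel_left) simp
        then show ?thesis
          using neg False \<open>\<bar>\<mu> x\<bar> = m\<close> that(2) by simp
      qed
      then show ?thesis
      proof cases
        case 1
        then have "0 < \<kappa> * u x"
          using \<kappa> by simp
        moreover from this have "\<phi> x < 0" "\<bar>\<phi> x\<bar> - m = \<kappa> * u x"
          using \<phi> 1 m_nonneg by auto
        ultimately show ?thesis
          using \<kappa> by (simp add: soft_threshold_def)
      next
        case 2
        then have "0 < - (\<kappa> * u x)"
          using \<kappa> by (simp add: mult_pos_neg)
        moreover from this have "0 < \<phi> x" "\<bar>\<phi> x\<bar> - m = - (\<kappa> * u x)"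
          using \<phi> 2 m_nonneg by auto
        ultimately show ?thesis
          using \<kappa> by (simp add: soft_threshold_def)
      qed
    qed
  qed
  have "(\<integral>x. max (\<bar>\<phi> x\<bar> - m) 0 \<partial>M) = (\<integral>x. \<kappa> * \<bar>u x\<bar> \<partial>M)"
  proof (rule integral_cong_AE)
    show "AE x in M. max (\<bar>\<phi> x\<bar> - m) 0 = \<kappa> * \<bar>u x\<bar>"
      using * by eventually_elim (use \<kappa> m_nonneg in \<open>auto simp: abs_mult abs_soft_threshold\<close>)
  qed (use meas in auto)
  also have "\<dots> = \<kappa> * Lp_norm 1 M u"
    by (simp add: Lp_norm_1)
  finally show "is_threshold M (\<kappa> * \<gamma>) \<phi> m"
    using le m_pos m_nonneg \<kappa> by (simp add: is_threshold_def)
qed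

theorem corollary3p5:
  fixes \<Omega> :: "(real^'n) set" and T \<kappa> \<gamma> :: real and r p :: ennreal
    and A :: "real^'n \<Rightarrow> real^'n^'n" and a :: "real^'n \<Rightarrow> real \<Rightarrow> real \<Rightarrow> real"
    and y0 :: "real^'n \<Rightarrow> real" and yd u y \<phi> \<mu> :: "(real^'n) \<times> real \<Rightarrow> real"
  assumes "CARD('n) \<in> {2, 3}" and "lipschitz_domain \<Omega>" and "T > 0"
    and "elliptic_coefficients \<Omega> A"
    and "y0 \<in> Lp \<infinity> (lebesgue_on \<Omega>)"
    and "r \<ge> 2" and "p \<ge> 2" and "1 / r + of_nat CARD('n) / (2 * p) < 1"
    and "nonlinearity \<Omega> T r p a"
    and "yd \<in> LrLp r p \<Omega> T"
    and "\<kappa> > 0" and "\<gamma> > 0"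
    and "u \<in> U_ad \<Omega> T \<gamma>" and "u \<in> Lp \<infinity> (lebesgue_on (\<Omega> \<times> {0<..<T}))"
    and "is_state \<Omega> T A a y0 u y"
    and "is_adjoint_state \<Omega> T A a yd y \<phi>"
    and "continuous_on (closure (\<Omega> \<times> {0<..<T})) \<phi>" and "\<phi> \<in> H1 (\<Omega> \<times> {0<..<T})"
    and "\<mu> \<in> Lp \<infinity> (lebesgue_on (\<Omega> \<times> {0<..<T}))"
    and "AE z in lebesgue_on (\<Omega> \<times> {0<..<T}). \<phi> z + \<kappa> * u z + \<mu> z = 0"
    and "AE z in lebesgue_on (\<Omega> \<times> {0<..<T}). u z * \<mu> z = \<bar>u z\<bar> * \<bar>\<mu> z\<bar>"
    and "AE t in lebesgue_on {0<..<T}. Lp_norm 1 (lebesgue_on \<Omega>) (\<lambda>x. u (x, t)) < \<gamma> \<longrightarrow>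
           (AE x in lebesgue_on \<Omega>. \<mu> (x, t) = 0)"
    and "AE t in lebesgue_on {0<..<T}. Lp_norm 1 (lebesgue_on \<Omega>) (\<lambda>x. u (x, t)) = \<gamma> \<and>
           \<not> (AE x in lebesgue_on \<Omega>. \<mu> (x, t) = 0) \<longrightarrow>
           (AE x in lebesgue_on \<Omega>. u (x, t) \<noteq> 0 \<longrightarrow> \<bar>\<mu> (x, t)\<bar> = Lp_norm \<infinity> (lebesgue_on \<Omega>) (\<lambda>x. \<mu> (x, t)))"
  shows "(AE (x, t) in lebesgue_on (\<Omega> \<times> {0<..<T}).
            u (x, t) = - (1 / \<kappa>) * sgn (\<phi> (x, t)) * max (\<bar>\<phi> (x, t)\<bar> - Lp_norm \<infinity> (lebesgue_on \<Omega>) (\<lambda>x. \<mu> (x, t))) 0 \<and>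
            - (1 / \<kappa>) * sgn (\<phi> (x, t)) * max (\<bar>\<phi> (x, t)\<bar> - Lp_norm \<infinity> (lebesgue_on \<Omega>) (\<lambda>x. \<mu> (x, t))) 0 =
              - (1 / \<kappa>) * (min (\<phi> (x, t) + Lp_norm \<infinity> (lebesgue_on \<Omega>) (\<lambda>x. \<mu> (x, t))) 0 + max (\<phi> (x, t) - Lp_norm \<infinity> (lebesgue_on \<Omega>) (\<lambda>x. \<mu> (x, t))) 0)) \<and>
         u \<in> H1 (\<Omega> \<times> {0<..<T}) \<and> \<mu> \<in> H1 (\<Omega> \<times> {0<..<T})"
proof -
  define J :: "real set" where "J = {0<..<T}"
  define Q where "Q = \<Omega> \<times> J"
  define M where "M = lebesgue_on \<Omega>"
  note \<kappa> = \<open>\<kappa> > 0\<close> and \<gamma> = \<open>\<gamma> > 0\<close>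
  have \<Omega>: "open \<Omega>" "bounded \<Omega>" "\<Omega> \<noteq> {}"
    using \<open>lipschitz_domain \<Omega>\<close> by (auto simp: lipschitz_domain_def)
  have J: "open J" "bounded J" "convex J"
    by (auto simp: J_def)
  have borel: "\<Omega> \<in> sets borel" "J \<in> sets borel" "Q \<in> sets borel"
    using \<Omega> J by (auto simp: Q_def intro!: borel_open open_Times)
  have \<phi>_cont: "continuous_on (closure Q) \<phi>"
    unfolding Q_def J_def by (fact assms)
  have \<phi>_cont_Q: "continuous_on Q \<phi>"
    using \<phi>_cont closure_subset by (rule continuous_on_subset)
  obtain m c where thr: "\<And>t. t \<in> J \<Longrightarrow> is_threshold M (\<kappa> * \<gamma>) (\<lambda>x. \<phi> (x, t)) (m t)"
    and c: "0 \<le> c" and m_lip: "\<And>s t. s \<in> J \<Longrightarrow> t \<in> J \<Longrightarrow>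
      \<bar>m t - m s\<bar> \<le> c * (\<integral>x. \<bar>\<phi> (x, t) - \<phi> (x, s)\<bar> \<partial>M)"
    and m_cont: "continuous_on J m"
    and m_unique: "\<And>t n. t \<in> J \<Longrightarrow> is_threshold M (\<kappa> * \<gamma>) (\<lambda>x. \<phi> (x, t)) n \<Longrightarrow> n = m t"
    by (rule threshold_family[OF \<Omega>(1,2) J(1,2) \<phi>_cont[unfolded Q_def] mult_pos_pos[OF \<kappa> \<gamma>], folded M_def])
      (rule that; assumption)
  have m_nonneg: "0 \<le> m t" if "t \<in> J" for t
    using thr[OF that] by (simp add: is_threshold_def)
  \<comment> \<open>the continuous representative of \<open>u\<close>\<close>
  define v where "v z = - (1 / \<kappa>) * soft_threshold (m (snd z)) (\<phi> z)" for z
  have M: "emeasure M (space M) \<noteq> 0"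
  proof
    assume "emeasure M (space M) = 0"
    then have "\<Omega> \<in> null_sets lebesgue"
      using borel(1) by (simp add: M_def emeasure_restrict_space null_sets_def)
    then show False
      using \<Omega> open_not_negligible negligible_iff_null_sets by blast
  qed
  have m_cont_Q: "continuous_on Q (\<lambda>z. m (snd z))"
    by (intro continuous_on_compose2[OF m_cont] continuous_intros) (auto simp: Q_def)
  have "continuous_on Q (\<lambda>z. - (1 / \<kappa>) * (min (\<phi> z + m (snd z)) 0 + max (\<phi> z - m (snd z)) 0))"
    by (intro continuous_intros \<phi>_cont_Q m_cont_Q)
  then have v_cont: "continuous_on Q v"
    by (rule continuous_on_cong[THEN iffD1, rotated -1])
      (auto simp: v_def soft_threshold_eq m_nonneg Q_def)

  obtain C where C: "AE z in lebesgue_on Q. \<bar>\<mu> z\<bar> \<le> C"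
    using \<open>\<mu> \<in> Lp \<infinity> (lebesgue_on (\<Omega> \<times> {0<..<T}))\<close> unfolding Q_def J_def by (auto simp: Lp_def)
  note slices = AE_cylinder_slices[OF borel(1,2), folded Q_def M_def]
  have equation: "AE z in lebesgue_on Q. \<phi> z + \<kappa> * u z + \<mu> z = 0"
    and sign: "AE z in lebesgue_on Q. u z * \<mu> z = \<bar>u z\<bar> * \<bar>\<mu> z\<bar>"
    unfolding Q_def J_def by (fact assms)+
  have slice_C: "AE t in lebesgue_on J. AE x in M. \<bar>\<mu> (x, t)\<bar> \<le> C"
    by (rule slices[OF C])
  have slice_eq: "AE t in lebesgue_on J. AE x in M. \<phi> (x, t) + \<kappa> * u (x, t) + \<mu> (x, t) = 0"
    by (rule slices[OF equation])
  have slice_sign: "AE t in lebesgue_on J. AE x in M. u (x, t) * \<mu> (x, t) = \<bar>u (x, t)\<bar> * \<bar>\<mu> (x, t)\<bar>"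
    by (rule slices[OF sign])
  have slice_u: "AE t in lebesgue_on J. (\<lambda>x. u (x, t)) \<in> borel_measurable M"
    using \<open>u \<in> U_ad \<Omega> T \<gamma>\<close> unfolding U_ad_def LrLp_def M_def J_def
    by (auto simp: Lp_def elim!: eventually_mono)
  have slice_le: "AE t in lebesgue_on J. Lp_norm 1 M (\<lambda>x. u (x, t)) \<le> \<gamma>"
    using \<open>u \<in> U_ad \<Omega> T \<gamma>\<close> unfolding U_ad_def M_def J_def by blast
  have slice_inactive: "AE t in lebesgue_on J. Lp_norm 1 M (\<lambda>x. u (x, t)) < \<gamma> \<longrightarrow> (AE x in M. \<mu> (x, t) = 0)"
    unfolding M_def J_def by (fact assms)
  have slice_active: "AE t in lebesgue_on J. Lp_norm 1 M (\<lambda>x. u (x, t)) = \<gamma> \<and> \<not> (AE x in M. \<mu> (x, t) = 0) \<longrightarrow>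
      (AE x in M. u (x, t) \<noteq> 0 \<longrightarrow> \<bar>\<mu> (x, t)\<bar> = Lp_norm \<infinity> M (\<lambda>x. \<mu> (x, t)))"
    unfolding M_def J_def by (fact assms)
  have slice_J: "AE t in lebesgue_on J. t \<in> J"
    using AE_space[of "lebesgue_on J"] by simp
  \<comment> \<open>For the slices of \<open>\<mu>\<close>, measurability comes from the equation, those of \<open>u\<close> and \<open>\<phi>\<close> being measurable.\<close>
  have time: "AE t in lebesgue_on J. Lp_norm \<infinity> M (\<lambda>x. \<mu> (x, t)) = m t \<and> (AE x in M. u (x, t) = v (x, t))"
    using slice_C slice_eq slice_sign slice_u slice_le slice_inactive slice_active slice_J
  proof eventually_elim
    case (elim t)
    have \<phi>_t: "(\<lambda>x. \<phi> (x, t)) \<in> borel_measurable M"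
      unfolding M_def using elim(8)
      by (intro continuous_on_borel_measurable_lebesgue_on[OF borel(1)] continuous_on_compose2[OF \<phi>_cont_Q]
          continuous_intros) (auto simp: Q_def)
    have \<mu>_t: "(\<lambda>x. \<mu> (x, t)) \<in> borel_measurable M"
      unfolding M_def
    proof (rule borel_measurable_lebesgue_on_AE[OF borel(1)])
      show "(\<lambda>x. - \<phi> (x, t) - \<kappa> * u (x, t)) \<in> borel_measurable (lebesgue_on \<Omega>)"
        using \<phi>_t elim(4) unfolding M_def by measurable
      show "AE x in lebesgue_on \<Omega>. - \<phi> (x, t) - \<kappa> * u (x, t) = \<mu> (x, t)"
        using elim(2) unfolding M_def by (rule eventually_mono) simp
    qed
    note * = time_slice_threshold[OF M \<mu>_t elim(1) \<kappa> elim(2,3,5) _ _ elim(4) \<phi>_t]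
    have "is_threshold M (\<kappa> * \<gamma>) (\<lambda>x. \<phi> (x, t)) (Lp_norm \<infinity> M (\<lambda>x. \<mu> (x, t)))"
      using elim(6,7) by (intro *(2)) auto
    then have m_t: "Lp_norm \<infinity> M (\<lambda>x. \<mu> (x, t)) = m t"
      by (rule m_unique[OF elim(8)])
    have "AE x in M. u (x, t) = - (1 / \<kappa>) * soft_threshold (Lp_norm \<infinity> M (\<lambda>x. \<mu> (x, t))) (\<phi> (x, t))"
      using elim(6,7) by (intro *(1)) auto
    then show ?case
      unfolding m_t v_def snd_conv by blast
  qed

  have u_meas: "u \<in> borel_measurable (lebesgue_on Q)" and \<mu>_meas: "\<mu> \<in> borel_measurable (lebesgue_on Q)"
    using assms(14,19) unfolding Q_def J_def by (auto simp: Lp_def)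
  have v_meas: "v \<in> borel_measurable (lebesgue_on Q)"
    by (rule continuous_on_borel_measurable_lebesgue_on[OF borel(3) v_cont])
  have u_v: "AE z in lebesgue_on Q. u z = v z"
    unfolding Q_def
  proof (rule AE_cylinder_of_slices[OF borel(1,2)])
    have "{z \<in> space (lebesgue_on Q). u z \<noteq> v z} \<in> sets (lebesgue_on Q)"
      using u_meas v_meas by measurable
    then show "{z \<in> \<Omega> \<times> J. u z \<noteq> v z} \<in> sets lebesgue"
      using borel(3) by (auto simp: Q_def sets_restrict_space_iff)
    show "AE t in lebesgue_on J. AE x in lebesgue_on \<Omega>. u (x, t) = v (x, t)"
      using time unfolding M_def by (rule eventually_mono) auto
  qed
  have m_norm: "AE z in lebesgue_on Q. Lp_norm \<infinity> M (\<lambda>x. \<mu> (x, snd z)) = m (snd z)"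
    unfolding Q_def by (rule AE_cylinder_of_AE_time[OF borel(1,2)], rule eventually_mono[OF time]) auto
  have formula: "AE z in lebesgue_on Q. case z of (x, t) \<Rightarrow>
            u (x, t) = - (1 / \<kappa>) * sgn (\<phi> (x, t)) * max (\<bar>\<phi> (x, t)\<bar> - Lp_norm \<infinity> M (\<lambda>x. \<mu> (x, t))) 0 \<and>
            - (1 / \<kappa>) * sgn (\<phi> (x, t)) * max (\<bar>\<phi> (x, t)\<bar> - Lp_norm \<infinity> M (\<lambda>x. \<mu> (x, t))) 0 =
              - (1 / \<kappa>) * (min (\<phi> (x, t) + Lp_norm \<infinity> M (\<lambda>x. \<mu> (x, t))) 0 + max (\<phi> (x, t) - Lp_norm \<infinity> M (\<lambda>x. \<mu> (x, t))) 0)"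
    using u_v m_norm AE_space[of "lebesgue_on Q"]
  proof eventually_elim
    case (elim z)
    then have t: "snd z \<in> J"
      by (auto simp: Q_def)
    show ?case
      using elim(1,2) soft_threshold_eq[OF m_nonneg[OF t], of "\<phi> z"]
      by (cases z) (simp add: v_def soft_threshold_def)
  qed

  have "compact (closure Q)"
    using \<Omega> J by (simp add: Q_def bounded_Times compact_closure)
  then have "bounded (\<phi> ` closure Q)"
    by (intro compact_imp_bounded compact_continuous_image \<phi>_cont)
  then obtain B where B: "0 < B" "\<And>z. z \<in> Q \<Longrightarrow> \<bar>\<phi> z\<bar> \<le> B"
    using closure_subset[of Q] by (auto simp: bounded_pos)
  have soft_le: "\<bar>soft_threshold (m (snd z)) (\<phi> z)\<bar> \<le> B" if "z \<in> Q" for z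
    using B(2)[OF that] B(1) m_nonneg[of "snd z"] that by (auto simp: abs_soft_threshold Q_def)
  have dominated_in_H1: "w \<in> H1 Q" if "continuous_on Q w" "\<And>z. z \<in> Q \<Longrightarrow> \<bar>w z\<bar> \<le> D" "0 \<le> A"
      "\<And>z z'. z \<in> Q \<Longrightarrow> z' \<in> Q \<Longrightarrow> \<bar>w z' - w z\<bar> \<le> A * (\<bar>\<phi> z' - \<phi> z\<bar> + \<bar>m (snd z') - m (snd z)\<bar>)" for w D A
    using H1_cylinder_dominated[OF \<Omega>(1,2) J, of \<phi> m c w D A] that \<phi>_cont_Q m_cont c m_lip
      \<open>\<phi> \<in> H1 (\<Omega> \<times> {0<..<T})\<close>
    by (simp add: Q_def J_def M_def)
  have "v \<in> H1 Q"
  proof (rule dominated_in_H1[OF v_cont])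
    show "\<bar>v z\<bar> \<le> 1 / \<kappa> * B" if "z \<in> Q" for z
      using soft_le[OF that] \<kappa> by (simp add: v_def abs_mult divide_right_mono)
    show "\<bar>v z' - v z\<bar> \<le> 1 / \<kappa> * (\<bar>\<phi> z' - \<phi> z\<bar> + \<bar>m (snd z') - m (snd z)\<bar>)" if "z \<in> Q" "z' \<in> Q" for z z'
    proof -
      have "v z' - v z = - (1 / \<kappa>) * (soft_threshold (m (snd z')) (\<phi> z') - soft_threshold (m (snd z)) (\<phi> z))"
        by (simp add: v_def algebra_simps)
      then have "\<bar>v z' - v z\<bar> = 1 / \<kappa> * \<bar>soft_threshold (m (snd z')) (\<phi> z') - soft_threshold (m (snd z)) (\<phi> z)\<bar>"
        using \<kappa> by (simp add: abs_mult)
      then show ?thesis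
        using soft_threshold_lipschitz[of "m (snd z')" "m (snd z)" "\<phi> z'" "\<phi> z"] m_nonneg that \<kappa>
        by (auto simp: Q_def intro!: divide_right_mono)
    qed
  qed (use \<kappa> in auto)
  then have "u \<in> H1 Q"
    by (rule H1_cong_AE[OF _ u_meas]) (use u_v in \<open>auto elim: eventually_mono\<close>)
  moreover have "(\<lambda>z. - \<phi> z - \<kappa> * v z) \<in> H1 Q"
  proof (rule dominated_in_H1)
    \<comment> \<open>up to its sign, the multiplier is the part of \<open>\<phi>\<close> cut off by the thresholding\<close>
    have w: "- \<phi> z - \<kappa> * v z = - (\<phi> z - soft_threshold (m (snd z)) (\<phi> z))" for z
      using \<kappa> by (simp add: v_def)
    show "continuous_on Q (\<lambda>z. - \<phi> z - \<kappa> * v z)"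
      by (intro continuous_intros \<phi>_cont_Q v_cont)
    show "\<bar>- \<phi> z - \<kappa> * v z\<bar> \<le> B + B" if "z \<in> Q" for z
      unfolding w using soft_le[OF that] B(2)[OF that] by linarith
    show "\<bar>(- \<phi> z' - \<kappa> * v z') - (- \<phi> z - \<kappa> * v z)\<bar> \<le> 1 * (\<bar>\<phi> z' - \<phi> z\<bar> + \<bar>m (snd z') - m (snd z)\<bar>)"
      if "z \<in> Q" "z' \<in> Q" for z z'
      unfolding w
      using soft_threshold_residual_lipschitz[of "m (snd z')" "m (snd z)" "\<phi> z'" "\<phi> z"] m_nonneg that
      by (auto simp: Q_def)
  qed simp
  then have "\<mu> \<in> H1 Q"
  proof (rule H1_cong_AE[OF _ \<mu>_meas])
    show "AE z in lebesgue_on Q. - \<phi> z - \<kappa> * v z = \<mu> z"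
      using equation u_v by eventually_elim simp
  qed
  ultimately show ?thesis
    using formula unfolding Q_def J_def M_def by blast
qed

end
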